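(* Let $p\in[1,\infty)$, let $\theta\in(0,p)$, and let $X=(X,d,\mu)$ be a $p$-admissible metric measure space. Let $E\subset X$ be an Ahlfors--David codimension-$\theta$ regular (closed) set. Suppose, in addition, that there exists an $\mathcal H_\theta$-measurable set $A\subset E$ such that $0<\mathcal H_\theta(A)<\infty$ and the measure $\mathcal H_\theta\lfloor_A$ is nonatomic. Then there is no bounded linear extension operator $$\operatorname{Ext}:L_p(E,\mathcal H_\theta\lfloor_E)\to B^{\theta/p}_{p,1}(X),$$ i.e., there is no bounded linear operator $\operatorname{Ext}:L_p(E,\mathcal H_\theta\lfloor_E)\to B^{\theta/p}_{p,1}(X)$ such that $\operatorname{Tr}(\operatorname{Ext}\phi)=\phi$ for every $\phi\in L_p(E,\mathcal H_\theta\lfloor_E)$.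
   Context: **Metric measure space.** A metric measure space is a triple $X=(X,d,\mu)$ where $(X,d)$ is a complete separable metric space and $\mu$ is a Borel regular (outer) measure on $X$ such that every ball has positive finite measure. $B_r(x)$ denotes the open ball with center $x$ and radius $r>0$. All functions are real-valued. For a set $B$ with $0<\mu(B)<\infty$, $f_B=\fint_B f\,d\mu:=\frac1{\mu(B)}\int_B f\,d\mu$. $L_p(X):=L_p(X,\mu)$, and $L_1^{\mathrm{loc}}(X)$ is the set of (classes of) $\mu$-measurable functions integrable on every ball. **Admissibility.** $\operatorname{LIP}(X)$ is the set of Lipschitz functions $f:X\to\mathbb R$; $\operatorname{lip}f(x)=\limsup_{y\to x}\frac{|f(y)-f(x)|}{d(x,y)}$ if $x$ is an accumulation point and $\operatorname{lip} f(x)=0$ if $x$ is isolated. For $\sigma\in[1,\infty)$, $X$ is $\sigma$-admissible if: (1) $\mu$ is uniformly locally doubling: for every $R>0$ there is $C_\mu(R)>0$ with $\mu(B_{2r}(x))\le C_\mu(R)\mu(B_r(x))$ for all $x\in X$, $r\in(0,R]$; (2) $X$ supports a local weak $(1,\sigma)$-Poincaré inequality: for every $R>0$ there are $C_P(R)>0$ and $\lambda(R)\ge1$ such that for every $f\in\operatorname{LIP}(X)$, all $x\in X$ and $0<r\le R$, $$\fint_{B_r(x)}|f-f_{B_r(x)}|\,d\mu\le C_P(R)\,r\left(\fint_{B_{\lambda(R)r}(x)}(\operatorname{lip}f)^\sigma d\mu\right)^{1/\sigma}.$$ **Codimensional Hausdorff measure.** For $\theta\in[0,\infty)$, $\delta\in(0,\infty]$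 and $G\subset X$, $$\mathcal H_{\theta,\delta}(G):=\inf\Big\{\sum_i\frac{\mu(B_{r_i}(x_i))}{r_i^\theta}:\ G\subset\bigcup_iB_{r_i}(x_i),\ 0<r_i<\delta\Big\},$$ the infimum being over all finite or countable coverings by balls, and $\mathcal H_\theta(G):=\lim_{\delta\to0}\mathcal H_{\theta,\delta}(G)$. $\mathcal H_\theta\lfloor_G$ denotes the restriction of $\mathcal H_\theta$ to $G$. **Regular sets.** A closed set $E\subset X$ is Ahlfors--David codimension-$\theta$ regular if there are $C_1,C_2>0$ with $$C_1\frac{\mu(B_r(x))}{r^\theta}\le\mathcal H_\theta(E\cap B_r(x))\le C_2\frac{\mu(B_r(x))}{r^\theta}\quad\text{for all }(x,r)\in E\times(0,1].$$ **Besov space.** For $f\in L_1^{\mathrm{loc}}(X)$, $t>0$, put $\overline\Delta_tf(x):=\fint_{B_t(x)}|f(y)-f_{B_t(x)}|\,d\mu(y)$. For $s\in(0,1)$ and $p\in[1,\infty)$, $B^s_{p,1}(X)$ is the space of all $f\in L_p(X)$ with finite norm $$\|f\|_{B^s_{p,1}(X)}:=\|f\|_{L_p(X)}+\int_0^1t^{-s}\|\overline\Delta_tf\|_{L_p(X)}\frac{dt}{t}.$$ **Trace.** For $f\in L_1^{\mathrm{loc}}(X)$, a measurable function $\phi:E\to\mathbb R$ is a trace of $f$ if $$\lim_{r\to0}\fint_{B_r(x)}|f(y)-\phi(x)|\,d\mu(y)=0\quad\text{for }\mathcal H_\theta\text{-a.e. }x\in E;$$ its class modulo $\mathcal H_\theta\lfloor_E$-null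 sets is denoted $\operatorname{Tr}f$. It is a previously known result that, under the hypotheses on $p,\theta,X,E$ above (without the assumption on $A$), every $f\in B^{\theta/p}_{p,1}(X)$ has a trace to $E$, the set of all traces is exactly $L_p(E,\mathcal H_\theta\lfloor_E)$, and the quotient norm $\inf\{\|f\|_{B^{\theta/p}_{p,1}(X)}:\operatorname{Tr}f=\phi\}$ is equivalent to $\|\phi\|_{L_p(E,\mathcal H_\theta\lfloor_E)}$; in particular $\operatorname{Tr}:B^{\theta/p}_{p,1}(X)\to L_p(E,\mathcal H_\theta\lfloor_E)$ is bounded and linear. *)

theory Defs
  imports "HOL-Analysis.Analysis"
begin

text \<open>
  Both \<open>\<mu>\<close> and the codimensional Hausdorff measure are outer measures, i.e. set functions on all
  subsets of the space. Integration and measurability refer to the complete measure obtained by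
  restricting to the Caratheodory measurable sets.
\<close>

definition caratheodory_measure :: "('a set \<Rightarrow> ennreal) \<Rightarrow> 'a measure" where
  "caratheodory_measure m = measure_of UNIV (lambda_system UNIV (Pow UNIV) m) m"

lemma
  assumes "outer_measure_space (Pow UNIV) m"
  shows space_caratheodory_measure: "space (caratheodory_measure m) = UNIV"
    and sets_caratheodory_measure:
      "sets (caratheodory_measure m) = lambda_system UNIV (Pow UNIV) m"
    and emeasure_caratheodory_measure:
      "A \<in> sets (caratheodory_measure m) \<Longrightarrow> emeasure (caratheodory_measure m) A = m A"
proof -
  have ms: "measure_space UNIV (lambda_system UNIV (Pow UNIV) m) m"
    using sigma_algebra.caratheodory_lemma[OF sigma_algebra_Pow assms] .
  then have sa: "sigma_algebra UNIV (lambda_system UNIV (Pow UNIV) m)"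
    by (simp add: measure_space_def)
  show "space (caratheodory_measure m) = UNIV"
    by (simp add: caratheodory_measure_def space_measure_of_conv)
  show sets: "sets (caratheodory_measure m) = lambda_system UNIV (Pow UNIV) m"
    unfolding caratheodory_measure_def by (rule sigma_algebra.sets_measure_of_eq[OF sa])
  show "emeasure (caratheodory_measure m) A = m A" if "A \<in> sets (caratheodory_measure m)"
    using that ms unfolding sets unfolding caratheodory_measure_def measure_space_def
    by (intro emeasure_measure_of_sigma) auto
qed

definition metric_measure_space :: "('a::polish_space set \<Rightarrow> ennreal) \<Rightarrow> bool" where
  "metric_measure_space \<mu> \<longleftrightarrow>
     outer_measure_space (Pow UNIV) \<mu> \<and>
     sets borel \<subseteq> sets (caratheodory_measure \<mu>) \<and>
     (\<forall>A. \<exists>B \<in> sets borel. A \<subseteq> B \<and> \<mu> B = \<mu> A) \<and>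
     (\<forall>x r. 0 < r \<longrightarrow> 0 < \<mu> (ball x r) \<and> \<mu> (ball x r) < \<infinity>)"

definition average :: "'a measure \<Rightarrow> 'a set \<Rightarrow> ('a \<Rightarrow> real) \<Rightarrow> real" where
  "average M B f = (1 / measure M B) * (LINT y:B|M. f y)"

definition LIP :: "('a::metric_space \<Rightarrow> real) set" where
  "LIP = {f. \<exists>L. L-lipschitz_on UNIV f}"

text \<open>For Lipschitz functions, the only ones to which it is applied, the upper limit is finite.\<close>

definition lip :: "('a::metric_space \<Rightarrow> real) \<Rightarrow> 'a \<Rightarrow> real" where
  "lip f x =
     (if x islimpt UNIV
      then real_of_ereal (Limsup (at x) (\<lambda>y. ereal (\<bar>f y - f x\<bar> / dist x y)))
      else 0)"

definition uniformly_locally_doubling :: "('a::metric_space set \<Rightarrow> ennreal) \<Rightarrow> bool" where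
  "uniformly_locally_doubling \<mu> \<longleftrightarrow>
     (\<forall>R>0. \<exists>C>0. \<forall>x. \<forall>r. 0 < r \<and> r \<le> R \<longrightarrow> \<mu> (ball x (2 * r)) \<le> ennreal C * \<mu> (ball x r))"

definition local_weak_Poincare :: "real \<Rightarrow> ('a::metric_space set \<Rightarrow> ennreal) \<Rightarrow> bool" where
  "local_weak_Poincare \<sigma> \<mu> \<longleftrightarrow>
     (let M = caratheodory_measure \<mu> in
      \<forall>R>0. \<exists>C>0. \<exists>\<Lambda>\<ge>1. \<forall>f\<in>LIP. \<forall>x. \<forall>r. 0 < r \<and> r \<le> R \<longrightarrow>
        average M (ball x r) (\<lambda>y. \<bar>f y - average M (ball x r) f\<bar>)
          \<le> C * r * average M (ball x (\<Lambda> * r)) (\<lambda>y. lip f y powr \<sigma>) powr (1 / \<sigma>))"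

definition admissible :: "real \<Rightarrow> ('a::metric_space set \<Rightarrow> ennreal) \<Rightarrow> bool" where
  "admissible \<sigma> \<mu> \<longleftrightarrow> uniformly_locally_doubling \<mu> \<and> local_weak_Poincare \<sigma> \<mu>"

text \<open>
  The index set \<open>I\<close> is an arbitrary subset of \<open>\<nat>\<close>, so that finite (possibly empty) and countably
  infinite coverings are both included; \<open>\<delta> = \<infinity>\<close> is allowed.
\<close>

definition codim_hausdorff_content ::
    "('a::metric_space set \<Rightarrow> ennreal) \<Rightarrow> real \<Rightarrow> ereal \<Rightarrow> 'a set \<Rightarrow> ennreal" where
  "codim_hausdorff_content \<mu> \<theta> \<delta> G =
     Inf {(\<Sum>i. if i \<in> I then \<mu> (ball (c i) (r i)) / ennreal (r i powr \<theta>) else 0) | I c r.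
            G \<subseteq> (\<Union>i\<in>I. ball (c i) (r i)) \<and> (\<forall>i\<in>I. 0 < r i \<and> ereal (r i) < \<delta>)}"

definition codim_hausdorff ::
    "('a::metric_space set \<Rightarrow> ennreal) \<Rightarrow> real \<Rightarrow> 'a set \<Rightarrow> ennreal" where
  "codim_hausdorff \<mu> \<theta> G = Lim (at_right 0) (\<lambda>\<delta>. codim_hausdorff_content \<mu> \<theta> \<delta> G)"

text \<open>The limit defining the Hausdorff measure exists, by monotonicity in \<open>\<delta>\<close>.\<close>

lemma codim_hausdorff_content_antimono:
  "\<delta> \<le> \<delta>' \<Longrightarrow> codim_hausdorff_content \<mu> \<theta> \<delta>' G \<le> codim_hausdorff_content \<mu> \<theta> \<delta> G"
  unfolding codim_hausdorff_content_def
  by (rule Inf_superset_mono) (fastforce intro: less_le_trans)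

lemma tendsto_codim_hausdorff:
  "((\<lambda>\<delta>. codim_hausdorff_content \<mu> \<theta> \<delta> G) \<longlongrightarrow> codim_hausdorff \<mu> \<theta> G) (at_right 0)"
  and codim_hausdorff_eq_SUP:
  "codim_hausdorff \<mu> \<theta> G = (SUP \<delta>\<in>{0<..}. codim_hausdorff_content \<mu> \<theta> \<delta> G)"
proof -
  let ?h = "\<lambda>\<delta>. codim_hausdorff_content \<mu> \<theta> \<delta> G"
  have lim: "(?h \<longlongrightarrow> (SUP \<delta>\<in>{0<..}. ?h \<delta>)) (at_right 0)"
  proof (rule order_tendstoI)
    fix a assume "a < (SUP \<delta>\<in>{0<..}. ?h \<delta>)"
    then obtain d where d: "d > 0" "a < ?h d" by (auto simp: less_SUP_iff)
    have "\<forall>\<^sub>F x in at_right (0::ereal). x < d"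
      using d(1) by (subst eventually_at_right[of 0 d]) auto
    then show "\<forall>\<^sub>F x in at_right 0. a < ?h x"
      by eventually_elim (rule less_le_trans[OF d(2) codim_hausdorff_content_antimono[OF less_imp_le]])
  next
    fix a assume a: "(SUP \<delta>\<in>{0<..}. ?h \<delta>) < a"
    have "\<forall>\<^sub>F x in at_right (0::ereal). 0 < x"
      by (simp add: eventually_at_filter)
    then show "\<forall>\<^sub>F x in at_right 0. ?h x < a"
      by eventually_elim (rule le_less_trans[OF SUP_upper a], simp)
  qed
  have nb: "at_right (0::ereal) \<noteq> bot"
  proof
    assume "at_right (0::ereal) = bot"
    then have "eventually (\<lambda>_. False) (at_right (0::ereal))" by simp
    then obtain b :: ereal where "0 < b" "\<forall>y>0. y < b \<longrightarrow> False"
      by (subst (asm) eventually_at_right[of 0 1]) auto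
    then show False using dense[of 0 b] by blast
  qed
  show eq: "codim_hausdorff \<mu> \<theta> G = (SUP \<delta>\<in>{0<..}. ?h \<delta>)"
    unfolding codim_hausdorff_def by (rule tendsto_Lim[OF nb lim])
  show "(?h \<longlongrightarrow> codim_hausdorff \<mu> \<theta> G) (at_right 0)"
    using lim by (simp add: eq)
qed

definition AD_codim_regular ::
    "('a::metric_space set \<Rightarrow> ennreal) \<Rightarrow> real \<Rightarrow> 'a set \<Rightarrow> bool" where
  "AD_codim_regular \<mu> \<theta> E \<longleftrightarrow>
     closed E \<and>
     (\<exists>C1>0. \<exists>C2>0. \<forall>x\<in>E. \<forall>r\<in>{0<..1}.
        ennreal C1 * (\<mu> (ball x r) / ennreal (r powr \<theta>)) \<le> codim_hausdorff \<mu> \<theta> (E \<inter> ball x r) \<and>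
        codim_hausdorff \<mu> \<theta> (E \<inter> ball x r) \<le> ennreal C2 * (\<mu> (ball x r) / ennreal (r powr \<theta>)))"

text \<open>
  The restriction \<open>\<H>\<^sub>\<theta>\<lfloor>\<^sub>G\<close> for a measurable set \<open>G\<close>, as a measure space with underlying set \<open>G\<close>.
\<close>

definition codim_hausdorff_on ::
    "('a::metric_space set \<Rightarrow> ennreal) \<Rightarrow> real \<Rightarrow> 'a set \<Rightarrow> 'a measure" where
  "codim_hausdorff_on \<mu> \<theta> G = restrict_space (caratheodory_measure (codim_hausdorff \<mu> \<theta>)) G"

definition nonatomic :: "'a measure \<Rightarrow> bool" where
  "nonatomic M \<longleftrightarrow>
     (\<forall>B\<in>sets M. 0 < emeasure M B \<longrightarrow>
        (\<exists>C\<in>sets M. C \<subseteq> B \<and> 0 < emeasure M C \<and> emeasure M C < emeasure M B))"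

definition ennreal_powr :: "ennreal \<Rightarrow> real \<Rightarrow> ennreal" where
  "ennreal_powr x a = (if x = \<infinity> then \<infinity> else ennreal (enn2real x powr a))"

text \<open>
  Function spaces consist of representatives; elements of the normed space are classes modulo
  equality almost everywhere. For a measure on \<open>E\<close>, the values of a representative outside \<open>E\<close> are
  irrelevant. Norms take values in \<open>[0, \<infinity>]\<close>.
\<close>

definition Lp_norm :: "real \<Rightarrow> 'a measure \<Rightarrow> ('a \<Rightarrow> real) \<Rightarrow> ennreal" where
  "Lp_norm p M f = ennreal_powr (\<integral>\<^sup>+x. ennreal (\<bar>f x\<bar> powr p) \<partial>M) (1 / p)"

definition Lp_space :: "real \<Rightarrow> 'a measure \<Rightarrow> ('a \<Rightarrow> real) set" where
  "Lp_space p M = {f \<in> borel_measurable M. Lp_norm p M f < \<infinity>}"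

definition L1_loc :: "'a::metric_space measure \<Rightarrow> ('a \<Rightarrow> real) set" where
  "L1_loc M = {f \<in> borel_measurable M. \<forall>x. \<forall>r>0. set_integrable M (ball x r) f}"

definition mean_oscillation ::
    "'a::metric_space measure \<Rightarrow> real \<Rightarrow> ('a \<Rightarrow> real) \<Rightarrow> 'a \<Rightarrow> real" where
  "mean_oscillation M t f x = average M (ball x t) (\<lambda>y. \<bar>f y - average M (ball x t) f\<bar>)"

definition besov_norm ::
    "real \<Rightarrow> real \<Rightarrow> 'a::metric_space measure \<Rightarrow> ('a \<Rightarrow> real) \<Rightarrow> ennreal" where
  "besov_norm s p M f =
     Lp_norm p M f +
     (\<integral>\<^sup>+t\<in>{0<..<1}. ennreal (t powr (- s)) * Lp_norm p M (mean_oscillation M t f) * ennreal (1 / t) \<partial>lborel)"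

text \<open>The second summation index of the Besov scale is \<open>1\<close>.\<close>

definition besov_space ::
    "real \<Rightarrow> real \<Rightarrow> 'a::metric_space measure \<Rightarrow> ('a \<Rightarrow> real) set" where
  "besov_space s p M = {f \<in> Lp_space p M. besov_norm s p M f < \<infinity>}"

definition is_trace ::
    "('a::metric_space set \<Rightarrow> ennreal) \<Rightarrow> real \<Rightarrow> 'a set \<Rightarrow> ('a \<Rightarrow> real) \<Rightarrow> ('a \<Rightarrow> real) \<Rightarrow> bool" where
  "is_trace \<mu> \<theta> E f \<phi> \<longleftrightarrow>
     f \<in> L1_loc (caratheodory_measure \<mu>) \<and>
     \<phi> \<in> borel_measurable (codim_hausdorff_on \<mu> \<theta> E) \<and>
     (AE x in codim_hausdorff_on \<mu> \<theta> E.
        ((\<lambda>r. average (caratheodory_measure \<mu>) (ball x r) (\<lambda>y. \<bar>f y - \<phi> x\<bar>)) \<longlongrightarrow> 0) (at_right 0))"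

text \<open>
  A bounded linear operator from a space \<open>V\<close> of functions modulo \<open>M\<close>-null sets to a space \<open>W\<close> of
  functions modulo \<open>N\<close>-null sets, given by its action on representatives.
\<close>

definition bounded_linear_ae ::
    "'a measure \<Rightarrow> ('a \<Rightarrow> real) set \<Rightarrow> (('a \<Rightarrow> real) \<Rightarrow> ennreal) \<Rightarrow>
     'b measure \<Rightarrow> ('b \<Rightarrow> real) set \<Rightarrow> (('b \<Rightarrow> real) \<Rightarrow> ennreal) \<Rightarrow>
     (('a \<Rightarrow> real) \<Rightarrow> ('b \<Rightarrow> real)) \<Rightarrow> bool" where
  "bounded_linear_ae M V normV N W normW T \<longleftrightarrow>
     (\<forall>f\<in>V. T f \<in> W) \<and>
     (\<forall>f\<in>V. \<forall>g\<in>V. (AE x in M. f x = g x) \<longrightarrow> (AE x in N. T f x = T g x)) \<and>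
     (\<forall>f\<in>V. \<forall>g\<in>V. AE x in N. T (\<lambda>z. f z + g z) x = T f x + T g x) \<and>
     (\<forall>f\<in>V. \<forall>a. AE x in N. T (\<lambda>z. a * f z) x = a * T f x) \<and>
     (\<exists>C. \<forall>f\<in>V. normW (T f) \<le> ennreal C * normV f)"

definition bounded_linear_extension ::
    "('a::metric_space set \<Rightarrow> ennreal) \<Rightarrow> real \<Rightarrow> real \<Rightarrow> 'a set \<Rightarrow>
     (('a \<Rightarrow> real) \<Rightarrow> ('a \<Rightarrow> real)) \<Rightarrow> bool" where
  "bounded_linear_extension \<mu> p \<theta> E Ext \<longleftrightarrow>
     (let M = caratheodory_measure \<mu>; H = codim_hausdorff_on \<mu> \<theta> E in
      bounded_linear_ae H (Lp_space p H) (Lp_norm p H)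
        M (besov_space (\<theta> / p) p M) (besov_norm (\<theta> / p) p M) Ext \<and>
      (\<forall>\<phi>\<in>Lp_space p H. is_trace \<mu> \<theta> E (Ext \<phi>) \<phi>))"

end

theory Submission
  imports Defs
begin

text \<open>
  An extension operator would let \<open>L\<^sub>p\<close> of a nonatomic measure sit inside a space whose norm is an
  \<open>\<ell>\<^sub>1\<close>-sum over scales, and random signs exclude this. On \<open>A\<close> there are functions \<open>r\<^sub>n = \<plusminus>1\<close> that are
  pairwise orthogonal. A signed sum of \<open>n\<close> of them is bounded by \<open>n\<close> and has square integral \<open>n \<H>\<^sub>\<theta>(A)\<close>,
  so for every finite \<open>p\<close> its \<open>L\<^sub>p\<close> norm is \<open>o(n)\<close>, uniformly in the signs
  (\<open>Lp_norm_random_sum_small\<close>). If \<open>Ext\<close> is bounded and linear, the Besov norm of every signed sum of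
  \<open>n\<close> of the functions \<open>f\<^sub>n = Ext r\<^sub>n\<close> is therefore \<open>o(n)\<close> as well. Two consequences contradict each
  other.

  At a fixed scale nothing survives. For a ball \<open>B\<close> the functional \<open>\<phi> \<mapsto> (Ext \<phi>)\<^sub>B\<close> is bounded, and
  choosing the signs of its values shows that \<open>(f\<^sub>n)\<^sub>B \<rightarrow> 0\<close> (\<open>functional_null_of_small_sums\<close>). On the
  other hand the trace of \<open>f\<^sub>n\<close> is \<open>r\<^sub>n\<close>, of modulus one, so by Fatou's lemma the distance in
  \<open>L\<^sub>p(A)\<close> between \<open>r\<^sub>n\<close> and the averages of \<open>f\<^sub>n\<close> over balls of a fixed radius \<open>2\<^sup>-\<^sup>k\<close> stays away from
  zero. This distance is controlled by the oscillations of \<open>f\<^sub>n\<close> at the scales below \<open>2\<^sup>-\<^sup>k\<close>: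
  telescoping over dyadic radii bounds it by a sum of \<open>L\<^sub>p(A)\<close> norms of mean oscillations, and the
  upper regularity of \<open>\<H>\<^sub>\<theta>\<close> on \<open>E\<close> together with Tonelli's theorem turns each of them into an
  \<open>L\<^sub>p(\<mu>)\<close> norm at the cost of the factor \<open>t\<^sup>-\<^sup>\<theta>\<^sup>/\<^sup>p\<close> that the Besov norm contains
  (\<open>Lp_norm_trace_minus_average_le\<close>). Hence a fixed amount of the Besov mass of \<open>f\<^sub>n\<close> escapes beyond any
  given scale as \<open>n\<close> grows.

  A gliding hump then selects \<open>n\<close> of the functions \<open>f\<^sub>i\<close> together with disjoint blocks of scales, each
  function having mass at least \<open>c\<close> on its own block. For suitable signs the sum keeps all these
  contributions, because flipping a sign can only help on average, and since masses on disjoint blocks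
  add up in an \<open>\<ell>\<^sub>1\<close>-sum its norm is at least \<open>c n\<close> (\<open>no_escaping_seminorm_mass\<close>). This is not \<open>o(n)\<close>.

  Measurability of the averaging operators rests on the fact that Borel sets are measurable for the
  codimensional Hausdorff measure, which follows from Caratheodory's criterion for metric outer
  measures.
\<close>

section \<open>Borel sets and the codimensional Hausdorff measure\<close>

text \<open>
  Caratheodory's criterion. To split a test set \<open>T\<close> along a closed set \<open>F\<close>, the part of \<open>T\<close> outside \<open>F\<close> is
  exhausted by the sets \<open>A n\<close> of points at distance at least \<open>1 / (n + 1)\<close>, on which additivity holds by
  separation. What is missing is covered by the thin shells \<open>R i\<close>, whose measures are summable because
  shells that are not adjacent are separated.
\<close>

lemma borel_subset_lambda_system_metric:
  fixes m :: "'a::metric_space set \<Rightarrow> ennreal"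
  assumes outer: "outer_measure_space (Pow UNIV) m"
    and separated: "\<And>G H e. 0 < e \<Longrightarrow> (\<And>x y. x \<in> G \<Longrightarrow> y \<in> H \<Longrightarrow> e \<le> dist x y) \<Longrightarrow>
      m G + m H \<le> m (G \<union> H)"
  shows "sets borel \<subseteq> lambda_system UNIV (Pow UNIV) m"
proof -
  have mono: "m G \<le> m H" if "G \<subseteq> H" for G H
    using outer that by (auto simp: outer_measure_space_def increasing_def)
  have empty: "m {} = 0"
    using outer by (auto simp: outer_measure_space_def positive_def)
  have csub: "m (\<Union>i. G i) \<le> (\<Sum>i. m (G i))" for G :: "nat \<Rightarrow> 'a set"
  proof -
    have "m (\<Union>i. disjointed G i) \<le> (\<Sum>i. m (disjointed G i))"
      using outer disjoint_family_disjointed[of G]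
      unfolding outer_measure_space_def countably_subadditive_def by blast
    also have "\<dots> \<le> (\<Sum>i. m (G i))"
      by (intro suminf_le mono disjointed_subset) auto
    finally show ?thesis by (simp only: UN_disjointed_eq)
  qed
  have sub: "m (G \<union> H) \<le> m G + m H" for G H
  proof -
    have "G \<union> H = (\<Union>i. binaryset G H i)" by (simp add: UN_binaryset_eq)
    also have "m \<dots> \<le> (\<Sum>i. m (binaryset G H i))" by (rule csub)
    also have "\<dots> = m G + m H" by (rule suminf_binaryset_eq) (rule empty)
    finally show ?thesis .
  qed
  have key: "m (F \<inter> T) + m (T - F) \<le> m T" if F: "closed F" "F \<noteq> {}" and T: "m T < \<infinity>" for F T
  proof -
    define A where "A n = {x \<in> T. 1 / real (Suc n) \<le> infdist x F}" for n
    define R where "R n = {x \<in> T. 1 / real (Suc (Suc n)) \<le> infdist x F \<and> infdist x F < 1 / real (Suc n)}" for n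
    define U where "U k = (\<Union>i<k. R i)" for k
    \<comment> \<open>Shell number \<open>k + 1\<close> is separated from the union of the shells before number \<open>k\<close>.\<close>
    have sumR: "(\<Sum>i<Suc k. m (R i)) \<le> m (U (Suc k)) + m (U k)" for k
    proof (induction k)
      case 0
      then show ?case by (simp add: U_def empty lessThan_Suc)
    next
      case (Suc k)
      have "m (U k) + m (R (Suc k)) \<le> m (U k \<union> R (Suc k))"
      proof (rule separated[where e = "1 / real (Suc k) - 1 / real (Suc (Suc k))"])
        show "0 < 1 / real (Suc k) - 1 / real (Suc (Suc k))"
          using frac_less2[of 1 1 "real (Suc k)" "real (Suc (Suc k))"] by simp
        fix x y assume x: "x \<in> U k" and y: "y \<in> R (Suc k)"
        then obtain i where i: "i < k" "x \<in> R i" by (auto simp: U_def)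
        have "1 / real (Suc k) \<le> 1 / real (Suc (Suc i))" using i by (simp add: field_simps)
        also have "\<dots> \<le> infdist x F" using i by (simp add: R_def)
        also have "\<dots> \<le> infdist y F + dist x y" by (rule infdist_triangle)
        finally show "1 / real (Suc k) - 1 / real (Suc (Suc k)) \<le> dist x y"
          using y by (simp add: R_def)
      qed
      also have "\<dots> \<le> m (U (Suc (Suc k)))"
        by (rule mono) (auto simp: U_def less_Suc_eq)
      finally have "m (U k) + m (R (Suc k)) \<le> m (U (Suc (Suc k)))" .
      note step = this
      have "(\<Sum>i<Suc (Suc k). m (R i)) = (\<Sum>i<Suc k. m (R i)) + m (R (Suc k))" by simp
      also have "\<dots> \<le> (m (U (Suc k)) + m (U k)) + m (R (Suc k))"
        by (rule add_right_mono[OF Suc])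
      also have "\<dots> = m (U (Suc k)) + (m (U k) + m (R (Suc k)))" by (rule add.assoc)
      also have "\<dots> \<le> m (U (Suc k)) + m (U (Suc (Suc k)))" by (rule add_left_mono[OF step])
      finally show ?case by (simp only: add.commute)
    qed
    have "(\<Sum>i. m (R i)) \<le> m T + m T"
    proof (rule suminf_le_const)
      show "summable (\<lambda>i. m (R i))" by simp
      fix n
      have "(\<Sum>i<n. m (R i)) \<le> (\<Sum>i<Suc n. m (R i))" by simp
      also have "\<dots> \<le> m (U (Suc n)) + m (U n)" by (rule sumR)
      also have "\<dots> \<le> m T + m T" by (intro add_mono mono) (auto simp: U_def R_def)
      finally show "(\<Sum>i<n. m (R i)) \<le> m T + m T" .
    qed
    also have "\<dots> < \<infinity>" using T by simp
    finally have fin: "(\<Sum>i. m (R i)) < \<infinity>" .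
    \<comment> \<open>Adding the partial sums of the shells instead of subtracting tails keeps all terms in the extended reals.\<close>
    have step: "m (F \<inter> T) + m (T - F) + (\<Sum>i<n. m (R i)) \<le> m T + (\<Sum>i. m (R i))" for n
    proof -
      have "T - F \<subseteq> A n \<union> (\<Union>i. R (i + n))"
      proof
        fix x assume x: "x \<in> T - F"
        show "x \<in> A n \<union> (\<Union>i. R (i + n))"
        proof (cases "x \<in> A n")
          case False
          have pos: "infdist x F > 0"
            using x F in_closed_iff_infdist_zero[of F x] infdist_nonneg[of x F] by auto
          then obtain N where N: "1 / real (Suc N) < infdist x F"
            using reals_Archimedean[OF pos] by (auto simp: inverse_eq_divide)
          define j where "j = (LEAST j. 1 / real (Suc j) \<le> infdist x F)"
          have j: "1 / real (Suc j) \<le> infdist x F"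
            unfolding j_def by (rule LeastI[of _ N]) (use N in simp)
          have "n < j"
          proof (rule ccontr)
            assume "\<not> n < j"
            then have "1 / real (Suc n) \<le> 1 / real (Suc j)" by (simp add: field_simps)
            with j False x show False by (auto simp: A_def)
          qed
          then obtain l where l: "j = Suc (l + n)" by (metis less_natE add.commute)
          have "\<not> 1 / real (Suc (l + n)) \<le> infdist x F"
            using not_less_Least[of "l + n" "\<lambda>j. 1 / real (Suc j) \<le> infdist x F"] l j_def by simp
          with j l x have "x \<in> R (l + n)" by (auto simp: R_def)
          then show ?thesis by blast
        qed simp
      qed
      then have "m (T - F) \<le> m (A n \<union> (\<Union>i. R (i + n)))" by (rule mono)
      also have "\<dots> \<le> m (A n) + (\<Sum>i. m (R (i + n)))"
        by (rule order_trans[OF sub add_left_mono[OF csub]])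
      finally have "m (F \<inter> T) + m (T - F) + (\<Sum>i<n. m (R i))
          \<le> m (F \<inter> T) + (m (A n) + (\<Sum>i. m (R (i + n)))) + (\<Sum>i<n. m (R i))"
        by (intro add_right_mono add_left_mono)
      also have "\<dots> = (m (F \<inter> T) + m (A n)) + ((\<Sum>i. m (R (i + n))) + (\<Sum>i<n. m (R i)))"
        by (simp only: add.assoc)
      also have "(\<Sum>i. m (R (i + n))) + (\<Sum>i<n. m (R i)) = (\<Sum>i. m (R i))"
        by (rule suminf_offset[symmetric]) simp
      also have "m (F \<inter> T) + m (A n) \<le> m T"
      proof -
        have "m (F \<inter> T) + m (A n) \<le> m (F \<inter> T \<union> A n)"
        proof (rule separated[where e = "1 / real (Suc n)"])
          fix x y assume "x \<in> F \<inter> T" "y \<in> A n"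
          then have "1 / real (Suc n) \<le> infdist y F" "infdist y F \<le> dist y x"
            by (auto simp: A_def intro: infdist_le)
          then show "1 / real (Suc n) \<le> dist x y" by (simp add: dist_commute)
        qed simp
        also have "\<dots> \<le> m T" by (rule mono) (auto simp: A_def)
        finally show ?thesis .
      qed
      finally show ?thesis by (simp add: add_right_mono)
    qed
    have "m (F \<inter> T) + m (T - F) + (\<Sum>i. m (R i)) \<le> m T + (\<Sum>i. m (R i))"
    proof (rule LIMSEQ_le_const2)
      show "(\<lambda>n. m (F \<inter> T) + m (T - F) + (\<Sum>i<n. m (R i))) \<longlonglongrightarrow> m (F \<inter> T) + m (T - F) + (\<Sum>i. m (R i))"
        by (intro tendsto_add tendsto_const summable_LIMSEQ) simp
    qed (use step in blast)
    then show ?thesis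
      using fin by (auto simp: add.commute[of _ "\<Sum>i. m (R i)"] ennreal_add_left_cancel_le)
  qed
  have closed: "F \<in> lambda_system UNIV (Pow UNIV) m" if F: "closed F" for F
    unfolding lambda_system_def
  proof (intro CollectI conjI ballI antisym)
    fix T :: "'a set"
    have split: "T = F \<inter> T \<union> (UNIV - F) \<inter> T" by blast
    show "m T \<le> m (F \<inter> T) + m ((UNIV - F) \<inter> T)"
      by (subst split) (rule sub)
    have diff: "(UNIV - F) \<inter> T = T - F" by blast
    show "m (F \<inter> T) + m ((UNIV - F) \<inter> T) \<le> m T"
    proof (cases "F \<noteq> {} \<and> m T < \<infinity>")
      case True
      then show ?thesis unfolding diff using F by (intro key) auto
    next
      case False
      then show ?thesis by (cases "F = {}") (simp_all add: empty less_top[symmetric])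
    qed
  qed simp
  have "sigma_algebra UNIV (lambda_system UNIV (Pow UNIV) m)"
    using sigma_algebra.caratheodory_lemma[OF sigma_algebra_Pow outer] by (simp add: measure_space_def)
  then have "sigma_sets UNIV (Collect closed) \<subseteq> lambda_system UNIV (Pow UNIV) m"
    by (rule sigma_algebra.sigma_sets_subset) (use closed in blast)
  then show ?thesis by (simp add: borel_eq_closed)
qed

lemma codim_hausdorff_content_mono:
  "G \<subseteq> H \<Longrightarrow> codim_hausdorff_content \<mu> \<theta> \<delta> G \<le> codim_hausdorff_content \<mu> \<theta> \<delta> H"
  unfolding codim_hausdorff_content_def by (rule Inf_superset_mono) blast

lemma codim_hausdorff_content_empty: "codim_hausdorff_content \<mu> \<theta> \<delta> {} = 0"
proof -
  have "codim_hausdorff_content \<mu> \<theta> \<delta> {} \<le> (\<Sum>i. if i \<in> {} then \<mu> (ball undefined 1) / ennreal (1 powr \<theta>) else 0)"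
    unfolding codim_hausdorff_content_def
    by (rule Inf_lower, rule CollectI, rule exI[of _ "{}"], rule exI[of _ "\<lambda>_. undefined"], rule exI[of _ "\<lambda>_. 1"]) simp
  then show ?thesis by simp
qed

text \<open>
  The coverings of the countably many pieces, each optimal up to \<open>e / 2\<^sup>n\<^sup>+\<^sup>1\<close>, are merged into one
  covering indexed by pairs of natural numbers.
\<close>

lemma codim_hausdorff_content_UN:
  fixes G :: "nat \<Rightarrow> 'a::metric_space set"
  shows "codim_hausdorff_content \<mu> \<theta> \<delta> (\<Union>n. G n) \<le> (\<Sum>n. codim_hausdorff_content \<mu> \<theta> \<delta> (G n))"
proof (rule ennreal_le_epsilon)
  let ?K = "codim_hausdorff_content \<mu> \<theta> \<delta>"
  let ?w = "\<lambda>c r i. \<mu> (ball (c i) (r i)) / ennreal (r i powr \<theta>)"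
  fix e :: real assume fin: "(\<Sum>n. ?K (G n)) < top" and e: "0 < e"
  define P where "P n I c r \<longleftrightarrow> G n \<subseteq> (\<Union>i\<in>I. ball (c i) (r i)) \<and> (\<forall>i\<in>I. 0 < r i \<and> ereal (r i) < \<delta>) \<and>
      (\<Sum>i. if i \<in> I then ?w c r i else 0) \<le> ?K (G n) + ennreal (e * (1 / 2) ^ Suc n)" for n I c r
  have "\<exists>I c r. P n I c r" for n
  proof -
    have "?K (G n) < top"
      using fin by (metis ennreal_suminf_lessD infinity_ennreal_def)
    then have "?K (G n) < ?K (G n) + ennreal (e * (1 / 2) ^ Suc n)"
      using e by (simp add: ennreal_add_left_cancel_less less_top[symmetric] ennreal_eq_0_iff)
    then show ?thesis
      unfolding P_def
      by (subst (asm) codim_hausdorff_content_def, subst (asm) Inf_less_iff) (auto intro!: less_imp_le)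
  qed
  then obtain I c r where P: "\<And>n. P n (I n) (c n) (r n)" by metis
  then have cov: "\<And>n. G n \<subseteq> (\<Union>i\<in>I n. ball (c n i) (r n i))"
    and rad: "\<And>n i. i \<in> I n \<Longrightarrow> 0 < r n i \<and> ereal (r n i) < \<delta>"
    and le: "\<And>n. (\<Sum>i. if i \<in> I n then ?w (c n) (r n) i else 0) \<le> ?K (G n) + ennreal (e * (1 / 2) ^ Suc n)"
    by (simp_all add: P_def)
  define J where "J = {k. snd (prod_decode k) \<in> I (fst (prod_decode k))}"
  define c' where "c' k = c (fst (prod_decode k)) (snd (prod_decode k))" for k
  define r' where "r' k = r (fst (prod_decode k)) (snd (prod_decode k))" for k
  have "?K (\<Union>n. G n) \<le> (\<Sum>k. if k \<in> J then ?w c' r' k else 0)"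
    unfolding codim_hausdorff_content_def
  proof (rule Inf_lower, rule CollectI, intro exI conjI)
    show "(\<Union>n. G n) \<subseteq> (\<Union>i\<in>J. ball (c' i) (r' i))"
    proof
      fix x assume "x \<in> (\<Union>n. G n)"
      then obtain n i where "i \<in> I n" "x \<in> ball (c n i) (r n i)" using cov by blast
      then show "x \<in> (\<Union>i\<in>J. ball (c' i) (r' i))"
        by (intro UN_I[of "prod_encode (n, i)"]) (auto simp: J_def c'_def r'_def)
    qed
    show "\<forall>i\<in>J. 0 < r' i \<and> ereal (r' i) < \<delta>"
      using rad by (auto simp: J_def r'_def)
  qed (rule refl)
  also have "\<dots> = (\<Sum>k. (\<lambda>(n, i). if i \<in> I n then ?w (c n) (r n) i else 0) (prod_decode k))"
    by (rule suminf_cong) (auto simp: J_def c'_def r'_def split: prod.splits)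
  also have "\<dots> = (\<Sum>n. \<Sum>i. if i \<in> I n then ?w (c n) (r n) i else 0)"
    by (rule suminf_ennreal_2dimen) simp
  also have "\<dots> \<le> (\<Sum>n. ?K (G n) + ennreal (e * (1 / 2) ^ Suc n))"
    by (intro suminf_le le) auto
  also have "\<dots> = (\<Sum>n. ?K (G n)) + (\<Sum>n. ennreal (e * (1 / 2) ^ Suc n))"
    by (rule suminf_add[symmetric]) auto
  also have "(\<Sum>n. ennreal (e * (1 / 2) ^ Suc n)) = ennreal e"
    using e sums_mult[OF power_half_series, of e] by (intro suminf_ennreal_eq) auto
  finally show "?K (\<Union>n. G n) \<le> (\<Sum>n. ?K (G n)) + ennreal e" .
qed

lemma outer_measure_codim_hausdorff: "outer_measure_space (Pow UNIV) (codim_hausdorff \<mu> \<theta>)"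
  unfolding outer_measure_space_def
proof (intro conjI)
  show "positive (Pow UNIV) (codim_hausdorff \<mu> \<theta>)"
    by (auto simp: positive_def codim_hausdorff_eq_SUP codim_hausdorff_content_empty bot_ennreal[symmetric]
        intro!: antisym SUP_least)
  show "increasing (Pow UNIV) (codim_hausdorff \<mu> \<theta>)"
    by (auto simp: increasing_def codim_hausdorff_eq_SUP intro!: SUP_mono codim_hausdorff_content_mono)
  show "countably_subadditive (Pow UNIV) (codim_hausdorff \<mu> \<theta>)"
    unfolding countably_subadditive_def
  proof (intro allI impI)
    fix G :: "nat \<Rightarrow> 'a set"
    show "codim_hausdorff \<mu> \<theta> (\<Union>i. G i) \<le> (\<Sum>i. codim_hausdorff \<mu> \<theta> (G i))"
      unfolding codim_hausdorff_eq_SUP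
      by (rule SUP_least, rule order_trans[OF codim_hausdorff_content_UN], rule suminf_le)
         (auto intro: SUP_upper)
  qed
qed

text \<open>
  A ball of radius less than \<open>e / 2\<close> cannot meet two sets at distance \<open>e\<close>, so a covering of the union
  splits into disjoint coverings of the two sets.
\<close>

lemma codim_hausdorff_content_separated:
  fixes G H :: "'a::metric_space set"
  assumes sep: "\<And>x y. x \<in> G \<Longrightarrow> y \<in> H \<Longrightarrow> e \<le> dist x y" and \<delta>: "\<delta> \<le> ereal (e / 2)"
  shows "codim_hausdorff_content \<mu> \<theta> \<delta> G + codim_hausdorff_content \<mu> \<theta> \<delta> H
    \<le> codim_hausdorff_content \<mu> \<theta> \<delta> (G \<union> H)"
  (is "?K G + ?K H \<le> _")
  unfolding codim_hausdorff_content_def[of _ _ _ "G \<union> H"]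
proof (rule Inf_greatest, elim CollectE exE conjE, hypsubst)
  fix I :: "nat set" and c :: "nat \<Rightarrow> 'a" and r :: "nat \<Rightarrow> real"
  let ?w = "\<lambda>i. \<mu> (ball (c i) (r i)) / ennreal (r i powr \<theta>)"
  assume cov: "G \<union> H \<subseteq> (\<Union>i\<in>I. ball (c i) (r i))" and rad: "\<forall>i\<in>I. 0 < r i \<and> ereal (r i) < \<delta>"
  define J where "J S = {i \<in> I. ball (c i) (r i) \<inter> S \<noteq> {}}" for S
  have le: "?K S \<le> (\<Sum>i. if i \<in> J S then ?w i else 0)" if "S \<subseteq> G \<union> H" for S
    unfolding codim_hausdorff_content_def
  proof (rule Inf_lower, rule CollectI, intro exI conjI)
    show "S \<subseteq> (\<Union>i\<in>J S. ball (c i) (r i))"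
      using cov that by (fastforce simp: J_def)
    show "\<forall>i\<in>J S. 0 < r i \<and> ereal (r i) < \<delta>"
      using rad by (simp add: J_def)
  qed (rule refl)
  have disj: "i \<notin> J H" if i: "i \<in> J G" for i
  proof
    assume "i \<in> J H"
    with i obtain x y where xy: "x \<in> G" "y \<in> H" "x \<in> ball (c i) (r i)" "y \<in> ball (c i) (r i)" "i \<in> I"
      by (auto simp: J_def)
    have "ereal (r i) < ereal (e / 2)" using rad xy \<delta> by (metis less_le_trans)
    then have "r i < e / 2" by simp
    moreover have "dist x y \<le> dist (c i) x + dist (c i) y" by (rule dist_triangle3)
    ultimately show False using sep[OF xy(1,2)] xy(3,4) by simp
  qed
  have "?K G + ?K H \<le> (\<Sum>i. if i \<in> J G then ?w i else 0) + (\<Sum>i. if i \<in> J H then ?w i else 0)"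
    by (intro add_mono le) auto
  also have "\<dots> = (\<Sum>i. (if i \<in> J G then ?w i else 0) + (if i \<in> J H then ?w i else 0))"
    by (rule suminf_add) auto
  also have "\<dots> \<le> (\<Sum>i. if i \<in> I then ?w i else 0)"
    by (intro suminf_le) (use disj in \<open>auto simp: J_def\<close>)
  finally show "?K G + ?K H \<le> (\<Sum>i. if i \<in> I then ?w i else 0)" .
qed

text \<open>
  Contents are additive on separated sets only for small \<open>\<delta>\<close>, which suffices for the limit.
\<close>

lemma borel_subset_codim_hausdorff:
  "sets borel \<subseteq> sets (caratheodory_measure (codim_hausdorff \<mu> \<theta>))"
proof -
  have "sets borel \<subseteq> lambda_system UNIV (Pow UNIV) (codim_hausdorff \<mu> \<theta>)"
  proof (rule borel_subset_lambda_system_metric[OF outer_measure_codim_hausdorff])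
    fix G H :: "'a set" and e :: real
    let ?K = "codim_hausdorff_content \<mu> \<theta>"
    assume e: "0 < e" and sep: "\<And>x y. x \<in> G \<Longrightarrow> y \<in> H \<Longrightarrow> e \<le> dist x y"
    show "codim_hausdorff \<mu> \<theta> G + codim_hausdorff \<mu> \<theta> H \<le> codim_hausdorff \<mu> \<theta> (G \<union> H)"
    proof (rule tendsto_le)
      show "at_right (0::ereal) \<noteq> bot"
      proof
        assume "at_right (0::ereal) = bot"
        then have "eventually (\<lambda>_. False) (at_right (0::ereal))" by simp
        then obtain b :: ereal where "0 < b" "\<forall>y>0. y < b \<longrightarrow> False"
          by (subst (asm) eventually_at_right[of 0 1]) auto
        then show False using dense[of 0 b] by blast
      qed
      show "((\<lambda>\<delta>. ?K \<delta> (G \<union> H)) \<longlongrightarrow> codim_hausdorff \<mu> \<theta> (G \<union> H)) (at_right 0)"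
        by (rule tendsto_codim_hausdorff)
      show "((\<lambda>\<delta>. ?K \<delta> G + ?K \<delta> H) \<longlongrightarrow> codim_hausdorff \<mu> \<theta> G + codim_hausdorff \<mu> \<theta> H) (at_right 0)"
        by (intro tendsto_add tendsto_codim_hausdorff)
      have "\<forall>\<^sub>F \<delta> in at_right (0::ereal). \<delta> < ereal (e / 2)"
        using e by (subst eventually_at_right[of 0 "ereal (e / 2)"]) (auto intro: exI[of _ "ereal (e / 2)"])
      then show "\<forall>\<^sub>F \<delta> in at_right 0. ?K \<delta> G + ?K \<delta> H \<le> ?K \<delta> (G \<union> H)"
        by eventually_elim (rule codim_hausdorff_content_separated[OF sep less_imp_le])
    qed
  qed
  then show ?thesis
    by (simp only: sets_caratheodory_measure[OF outer_measure_codim_hausdorff])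
qed

section \<open>Orthogonal signs on a nonatomic measure space\<close>

text \<open>
  One of the two pieces of a nontrivial splitting has at most half of the measure; iterate.
\<close>

lemma nonatomic_small_subset:
  assumes fin: "finite_measure M" and na: "nonatomic M"
    and B: "B \<in> sets M" "0 < measure M B" and e: "0 < e"
  shows "\<exists>C\<in>sets M. C \<subseteq> B \<and> 0 < measure M C \<and> measure M C < e"
proof -
  interpret finite_measure M by fact
  have half: "\<exists>D\<in>sets M. D \<subseteq> C \<and> 0 < measure M D \<and> measure M D \<le> measure M C / 2"
    if C: "C \<in> sets M" "0 < measure M C" for C
  proof -
    obtain D where D: "D \<in> sets M" "D \<subseteq> C" "0 < emeasure M D" "emeasure M D < emeasure M C"
      using na C unfolding nonatomic_def by (metis emeasure_eq_measure ennreal_less_zero_iff)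
    then have D': "0 < measure M D" "measure M D < measure M C"
      by (simp_all add: emeasure_eq_measure ennreal_less_iff)
    have diff: "measure M (C - D) = measure M C - measure M D"
      using C D by (simp add: finite_measure_Diff)
    show ?thesis
    proof (cases "measure M D \<le> measure M C / 2")
      case True
      with D D' show ?thesis by blast
    next
      case False
      with diff D' C D show ?thesis by (intro bexI[of _ "C - D"]) auto
    qed
  qed
  have iter: "\<exists>C\<in>sets M. C \<subseteq> B \<and> 0 < measure M C \<and> measure M C \<le> measure M B / 2 ^ n" for n
  proof (induction n)
    case 0
    then show ?case using B by auto
  next
    case (Suc n)
    then obtain C where C: "C \<in> sets M" "C \<subseteq> B" "0 < measure M C" "measure M C \<le> measure M B / 2 ^ n"
      by blast
    obtain D where "D \<in> sets M" "D \<subseteq> C" "0 < measure M D" "measure M D \<le> measure M C / 2"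
      using half[OF C(1,3)] by blast
    with C show ?case by (intro bexI[of _ D]) auto
  qed
  have "(\<lambda>n. measure M B / 2 ^ n) \<longlonglongrightarrow> 0"
    using tendsto_mult[OF tendsto_const[of "measure M B"] LIMSEQ_power_zero[of "1 / 2 :: real"]]
    by (simp add: power_divide)
  then have "\<forall>\<^sub>F n in sequentially. measure M B / 2 ^ n < e"
    using e by (rule order_tendstoD)
  then obtain n where "measure M B / 2 ^ n < e"
    by (auto simp: eventually_sequentially)
  with iter[of n] show ?thesis by (meson le_less_trans)
qed

text \<open>
  Sierpinski's theorem. The set is exhausted greedily: in every step at least half of the largest
  admissible amount of measure is added. If the limit fell short of \<open>t\<close>, a small set \<open>D\<close> would remain
  admissible forever, and every step would add at least half of its measure.
\<close>

lemma nonatomic_subset_of_measure: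
  assumes fin: "finite_measure M" and na: "nonatomic M"
    and B: "B \<in> sets M" and t: "0 \<le> t" "t \<le> measure M B"
  shows "\<exists>C\<in>sets M. C \<subseteq> B \<and> measure M C = t"
proof -
  interpret finite_measure M by fact
  \<comment> \<open>The sets \<open>D\<close> that may still be added to \<open>C\<close>.\<close>
  define adm where "adm C D \<longleftrightarrow> D \<in> sets M \<and> D \<subseteq> B - C \<and> measure M C + measure M D \<le> t" for C D
  have "\<exists>C. \<forall>n. (C n \<in> sets M \<and> C n \<subseteq> B \<and> measure M (C n) \<le> t) \<and>
      (C n \<subseteq> C (Suc n) \<and> (\<forall>D. adm (C n) D \<longrightarrow> measure M D \<le> 2 * (measure M (C (Suc n)) - measure M (C n))))"
  proof (rule dependent_nat_choice)
    show "\<exists>C. C \<in> sets M \<and> C \<subseteq> B \<and> measure M C \<le> t" using t by (intro exI[of _ "{}"]) auto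
  next
    fix C n assume C: "C \<in> sets M \<and> C \<subseteq> B \<and> measure M C \<le> t"
    let ?S = "measure M ` Collect (adm C)"
    have "adm C {}" using C by (simp add: adm_def)
    have bdd: "bdd_above ?S"
    proof (rule bdd_aboveI[of _ t])
      fix y assume "y \<in> ?S"
      then obtain D where "y = measure M D" "measure M C + measure M D \<le> t" by (auto simp: adm_def)
      then show "y \<le> t" using measure_nonneg[of M C] by linarith
    qed
    have "\<exists>D. adm C D \<and> Sup ?S \<le> 2 * measure M D"
    proof (cases "Sup ?S \<le> 0")
      case True
      with \<open>adm C {}\<close> show ?thesis by force
    next
      case False
      then have "Sup ?S / 2 < Sup ?S" by simp
      then obtain D where "adm C D" "Sup ?S / 2 < measure M D"
        using \<open>adm C {}\<close> bdd by (subst (asm) less_cSup_iff) auto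
      then show ?thesis by (intro exI[of _ D]) auto
    qed
    then obtain D where D: "adm C D" "Sup ?S \<le> 2 * measure M D" by blast
    have U: "measure M (C \<union> D) = measure M C + measure M D"
      using C D(1) by (intro finite_measure_Union) (auto simp: adm_def)
    show "\<exists>C'. (C' \<in> sets M \<and> C' \<subseteq> B \<and> measure M C' \<le> t) \<and> C \<subseteq> C' \<and>
        (\<forall>D. adm C D \<longrightarrow> measure M D \<le> 2 * (measure M C' - measure M C))"
    proof (intro exI[of _ "C \<union> D"] conjI allI impI)
      fix D' assume "adm C D'"
      then have "measure M D' \<le> Sup ?S" by (intro cSup_upper bdd) auto
      with D(2) U show "measure M D' \<le> 2 * (measure M (C \<union> D) - measure M C)" by simp
    qed (use C D(1) U in \<open>auto simp: adm_def\<close>)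
  qed
  then obtain C where C: "\<And>n. C n \<in> sets M" "\<And>n. C n \<subseteq> B" "\<And>n. measure M (C n) \<le> t"
    and mono: "\<And>n. C n \<subseteq> C (Suc n)"
    and large: "\<And>n D. adm (C n) D \<Longrightarrow> measure M D \<le> 2 * (measure M (C (Suc n)) - measure M (C n))"
    by blast
  have lim: "(\<lambda>n. measure M (C n)) \<longlonglongrightarrow> measure M (\<Union>n. C n)"
    by (rule finite_Lim_measure_incseq) (use C mono incseq_SucI[of C] in auto)
  have le: "measure M (C n) \<le> measure M (\<Union>n. C n)" for n
    using C by (intro finite_measure_mono) auto
  have U: "(\<Union>n. C n) \<in> sets M" "(\<Union>n. C n) \<subseteq> B" using C by auto
  have "measure M (\<Union>n. C n) \<le> t"
    using lim C(3) by (intro LIMSEQ_le_const2) auto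
  moreover have "\<not> measure M (\<Union>n. C n) < t"
  proof
    assume less: "measure M (\<Union>n. C n) < t"
    have "measure M (B - (\<Union>n. C n)) = measure M B - measure M (\<Union>n. C n)"
      using U B by (intro finite_measure_Diff) auto
    then have "0 < measure M (B - (\<Union>n. C n))" using less t by simp
    then obtain D where D: "D \<in> sets M" "D \<subseteq> B - (\<Union>n. C n)" "0 < measure M D"
        "measure M D < t - measure M (\<Union>n. C n)"
      using nonatomic_small_subset[OF fin na, of "B - (\<Union>n. C n)" "t - measure M (\<Union>n. C n)"] B U less
      by auto
    have "adm (C n) D" for n using D le[of n] by (auto simp: adm_def)
    then have "measure M D \<le> 2 * (measure M (C (Suc n)) - measure M (C n))" for n by (rule large)
    moreover have "(\<lambda>n. 2 * (measure M (C (Suc n)) - measure M (C n))) \<longlonglongrightarrow> 2 * (measure M (\<Union>n. C n) - measure M (\<Union>n. C n))"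
      by (intro tendsto_intros lim LIMSEQ_Suc[OF lim])
    ultimately have "measure M D \<le> 2 * (measure M (\<Union>n. C n) - measure M (\<Union>n. C n))"
      by (intro LIMSEQ_le_const) auto
    with D(3) show False by simp
  qed
  ultimately show ?thesis using U by (intro bexI[of _ "\<Union>n. C n"]) auto
qed

text \<open>
  Bisecting the pieces of \<open>B\<close> inside and outside of one of the sets keeps the bisection of all the others.
\<close>

lemma nonatomic_simultaneous_halving:
  assumes fin: "finite_measure M" and na: "nonatomic M"
    and S: "finite S" "S \<subseteq> sets M" and B: "B \<in> sets M"
  shows "\<exists>C\<in>sets M. C \<subseteq> B \<and> measure M C = measure M B / 2 \<and>
    (\<forall>T\<in>S. measure M (C \<inter> T) = measure M (B \<inter> T) / 2)"
  using S B
proof (induction S arbitrary: B rule: finite_induct)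
  case empty
  then show ?case using nonatomic_subset_of_measure[OF fin na, of B "measure M B / 2"] by auto
next
  case (insert T S)
  interpret finite_measure M by fact
  have T: "T \<in> sets M" "S \<subseteq> sets M" using insert.prems by auto
  obtain C where C: "C \<in> sets M" "C \<subseteq> B \<inter> T" "measure M C = measure M (B \<inter> T) / 2"
      "\<And>T'. T' \<in> S \<Longrightarrow> measure M (C \<inter> T') = measure M (B \<inter> T \<inter> T') / 2"
    using insert.IH[of "B \<inter> T"] insert.prems T by auto
  obtain D where D: "D \<in> sets M" "D \<subseteq> B - T" "measure M D = measure M (B - T) / 2"
      "\<And>T'. T' \<in> S \<Longrightarrow> measure M (D \<inter> T') = measure M ((B - T) \<inter> T') / 2"
    using insert.IH[of "B - T"] insert.prems T by auto
  have split: "measure M (X \<inter> T) + measure M (X - T) = measure M X" if "X \<in> sets M" for X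
    using that T by (subst finite_measure_Union[symmetric]) (auto intro!: arg_cong[where f = "measure M"])
  show ?case
  proof (intro bexI[of _ "C \<union> D"] conjI ballI)
    show "C \<union> D \<subseteq> B" using C D by auto
    show "C \<union> D \<in> sets M" using C D by auto
    have "measure M (C \<union> D) = measure M C + measure M D"
      using C D by (intro finite_measure_Union) auto
    then show "measure M (C \<union> D) = measure M B / 2" using C D split[of B] insert.prems by simp
    fix T' assume T': "T' \<in> insert T S"
    show "measure M ((C \<union> D) \<inter> T') = measure M (B \<inter> T') / 2"
    proof (cases "T' = T")
      case True
      have "(C \<union> D) \<inter> T = C" using C D by auto
      with True C show ?thesis by simp
    next
      case False
      then have T'': "T' \<in> S" "T' \<in> sets M" using T' T by auto
      have sets_eq: "B \<inter> T \<inter> T' = B \<inter> T' \<inter> T" "(B - T) \<inter> T' = B \<inter> T' - T" by blast+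
      have "(C \<union> D) \<inter> T' = (C \<inter> T') \<union> (D \<inter> T')" by blast
      also have "measure M \<dots> = measure M (C \<inter> T') + measure M (D \<inter> T')"
        using C(1,2) D(1,2) T'' by (intro finite_measure_Union) auto
      finally have "measure M ((C \<union> D) \<inter> T') = (measure M (B \<inter> T' \<inter> T) + measure M (B \<inter> T' - T)) / 2"
        using C(4)[OF T''(1)] D(4)[OF T''(1)] sets_eq by (simp add: add_divide_distrib)
      also have "\<dots> = measure M (B \<inter> T') / 2" using split[of "B \<inter> T'"] insert.prems T'' by simp
      finally show ?thesis .
    qed
  qed
qed

text \<open>
  These are Rademacher functions: \<open>r n\<close> is positive on a set \<open>R n\<close> of half measure that bisects all the
  earlier sets \<open>R m\<close>.
\<close>

lemma nonatomic_orthogonal_signs: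
  assumes fin: "finite_measure M" and na: "nonatomic M"
  obtains r :: "nat \<Rightarrow> 'a \<Rightarrow> real" where "\<And>n. r n \<in> borel_measurable M" "\<And>n x. \<bar>r n x\<bar> = 1"
    "\<And>m n. m \<noteq> n \<Longrightarrow> (\<integral>x. r m x * r n x \<partial>M) = 0"
proof -
  interpret finite_measure M by fact
  let ?\<Omega> = "space M"
  define halves where "halves S C \<longleftrightarrow> C \<in> sets M \<and> measure M C = measure M ?\<Omega> / 2 \<and>
      (\<forall>T\<in>S. measure M (C \<inter> T) = measure M (?\<Omega> \<inter> T) / 2)" for S C
  have "\<exists>C. halves S C" if "finite S" "S \<subseteq> sets M" for S
    using nonatomic_simultaneous_halving[OF fin na that sets.top] unfolding halves_def by blast
  then obtain pick where pick: "\<And>S. finite S \<Longrightarrow> S \<subseteq> sets M \<Longrightarrow> halves S (pick S)" by metis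
  \<comment> \<open>\<open>S n\<close> collects the sets \<open>R m\<close> with \<open>m < n\<close>.\<close>
  define S where "S = rec_nat {} (\<lambda>_ S. insert (pick S) S)"
  have S_simps: "S 0 = {}" "S (Suc n) = insert (pick (S n)) (S n)" for n by (simp_all add: S_def)
  have S: "finite (S n) \<and> S n \<subseteq> sets M" for n
    by (induction n) (use pick in \<open>auto simp: S_simps halves_def\<close>)
  define R where "R n = pick (S n)" for n
  have R: "R n \<in> sets M" "measure M (R n) = measure M ?\<Omega> / 2"
    "\<And>T. T \<in> S n \<Longrightarrow> measure M (R n \<inter> T) = measure M (?\<Omega> \<inter> T) / 2" for n
    using pick[of "S n"] S[of n] unfolding R_def halves_def by blast+
  have mem: "R m \<in> S n" if "m < n" for m n
    using that by (induction n) (auto simp: S_simps R_def less_Suc_eq)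
  define r where "r n x = 2 * indicator (R n) x - (1::real)" for n x
  have meas: "r n \<in> borel_measurable M" for n unfolding r_def using R by measurable
  have orth: "(\<integral>x. r m x * r n x \<partial>M) = 0" if "m < n" for m n
  proof -
    have i: "measure M (R n \<inter> R m) = measure M ?\<Omega> / 4"
      using R(3)[OF mem[OF that]] R(2)[of m] sets.sets_into_space[OF R(1)[of m]] by (simp add: Int_absorb1)
    have "(\<integral>x. r m x * r n x \<partial>M)
        = (\<integral>x. 4 * indicator (R n \<inter> R m) x - 2 * indicator (R n) x - 2 * indicator (R m) x + 1 \<partial>M)"
      by (rule Bochner_Integration.integral_cong) (auto simp: r_def split: split_indicator)
    also have "\<dots> = 4 * measure M (R n \<inter> R m) - 2 * measure M (R n) - 2 * measure M (R m) + measure M ?\<Omega>"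
      using R(1) by (simp add: sets.Int_space_eq2 emeasure_eq_measure)
    finally show ?thesis using i R(2) by simp
  qed
  show thesis
  proof (rule that)
    show "r n \<in> borel_measurable M" for n by (rule meas)
    show "\<bar>r n x\<bar> = 1" for n x by (auto simp: r_def split: split_indicator)
    fix m n :: nat assume "m \<noteq> n"
    then consider "m < n" | "n < m" by linarith
    then show "(\<integral>x. r m x * r n x \<partial>M) = 0"
      by cases (use orth[of m n] orth[of n m] in \<open>simp_all add: mult.commute\<close>)
  qed
qed

section \<open>The seminorm properties of the Lebesgue norm\<close>

lemma Lp_norm_le_iff:
  assumes p: "1 \<le> p" and c: "0 \<le> c"
  shows "Lp_norm p M f \<le> ennreal c \<longleftrightarrow> (\<integral>\<^sup>+x. ennreal (\<bar>f x\<bar> powr p) \<partial>M) \<le> ennreal (c powr p)"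
proof (cases "\<integral>\<^sup>+x. ennreal (\<bar>f x\<bar> powr p) \<partial>M")
  case (real v)
  have "v powr (1 / p) \<le> c \<longleftrightarrow> v \<le> c powr p"
  proof
    assume "v powr (1 / p) \<le> c"
    then have "(v powr (1 / p)) powr p \<le> c powr p" using p by (intro powr_mono2) auto
    then show "v \<le> c powr p" using p real by (simp add: powr_powr)
  next
    assume "v \<le> c powr p"
    then have "v powr (1 / p) \<le> (c powr p) powr (1 / p)" using p real by (intro powr_mono2) auto
    then show "v powr (1 / p) \<le> c" using p c by (simp add: powr_powr)
  qed
  with real c show ?thesis by (simp add: Lp_norm_def ennreal_powr_def ennreal_le_iff)
next
  case top
  then show ?thesis by (simp add: Lp_norm_def ennreal_powr_def top_unique)
qed

lemma Lp_norm_mono_AE: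
  assumes p: "1 \<le> p" and le: "AE x in M. \<bar>f x\<bar> \<le> \<bar>g x\<bar>"
  shows "Lp_norm p M f \<le> Lp_norm p M g"
proof (cases "Lp_norm p M g")
  case (real c)
  have "(\<integral>\<^sup>+x. ennreal (\<bar>f x\<bar> powr p) \<partial>M) \<le> (\<integral>\<^sup>+x. ennreal (\<bar>g x\<bar> powr p) \<partial>M)"
    by (intro nn_integral_mono_AE eventually_mono[OF le]) (use p in \<open>auto intro!: ennreal_leI powr_mono2\<close>)
  also have "\<dots> \<le> ennreal (c powr p)" using Lp_norm_le_iff[OF p, of c M g] real by simp
  finally show ?thesis using Lp_norm_le_iff[OF p, of c M f] real by simp
qed simp

lemma Lp_norm_scale:
  assumes p: "1 \<le> p" and f: "f \<in> borel_measurable M"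
  shows "Lp_norm p M (\<lambda>x. a * f x) = ennreal \<bar>a\<bar> * Lp_norm p M f"
proof -
  have le: "Lp_norm p M (\<lambda>x. a * f x) \<le> ennreal \<bar>a\<bar> * Lp_norm p M f"
    if f: "f \<in> borel_measurable M" and a: "a \<noteq> 0" for a and f :: "'a \<Rightarrow> real"
  proof (cases "Lp_norm p M f")
    case (real c)
    have "(\<integral>\<^sup>+x. ennreal (\<bar>a * f x\<bar> powr p) \<partial>M) = (\<integral>\<^sup>+x. ennreal (\<bar>a\<bar> powr p) * ennreal (\<bar>f x\<bar> powr p) \<partial>M)"
      by (simp add: abs_mult powr_mult ennreal_mult)
    also have "\<dots> = ennreal (\<bar>a\<bar> powr p) * (\<integral>\<^sup>+x. ennreal (\<bar>f x\<bar> powr p) \<partial>M)"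
      using f by (intro nn_integral_cmult) measurable
    also have "\<dots> \<le> ennreal (\<bar>a\<bar> powr p) * ennreal (c powr p)"
      using Lp_norm_le_iff[OF p, of c M f] real by (intro mult_left_mono) simp_all
    also have "\<dots> = ennreal ((\<bar>a\<bar> * c) powr p)" using real by (simp add: powr_mult ennreal_mult)
    finally have "Lp_norm p M (\<lambda>x. a * f x) \<le> ennreal (\<bar>a\<bar> * c)"
      using real by (subst Lp_norm_le_iff[OF p]) auto
    then show ?thesis using real by (simp add: ennreal_mult)
  next
    case top
    then show ?thesis using a by (simp add: ennreal_mult_top)
  qed
  show ?thesis
  proof (cases "a = 0")
    case True
    then have "Lp_norm p M (\<lambda>x. a * f x) \<le> ennreal 0"
      by (subst Lp_norm_le_iff[OF p]) auto
    with True show ?thesis by simp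
  next
    case False
    have "Lp_norm p M f = Lp_norm p M (\<lambda>x. (1 / a) * (a * f x))" using False by simp
    also have "\<dots> \<le> ennreal \<bar>1 / a\<bar> * Lp_norm p M (\<lambda>x. a * f x)"
      using False f by (intro le) auto
    finally have "ennreal \<bar>a\<bar> * Lp_norm p M f \<le> ennreal \<bar>a\<bar> * (ennreal \<bar>1 / a\<bar> * Lp_norm p M (\<lambda>x. a * f x))"
      by (rule mult_left_mono) simp
    also have "\<dots> = Lp_norm p M (\<lambda>x. a * f x)"
      using False by (simp add: mult.assoc[symmetric] ennreal_mult[symmetric])
    finally show ?thesis using le[OF f False] by (rule antisym[rotated])
  qed
qed

lemma powr_convex_combination:
  fixes x y u :: real
  assumes p: "1 \<le> p" and "0 \<le> x" "0 \<le> y" "0 \<le> u" "u \<le> 1"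
  shows "(u * x + (1 - u) * y) powr p \<le> u * x powr p + (1 - u) * y powr p"
proof -
  have small: "(v * z) powr p \<le> v * z powr p" if "0 \<le> v" "v \<le> 1" "0 \<le> z" for v z :: real
  proof -
    have "v powr p \<le> v" using that p powr_mono'[of 1 p v] by (cases "v = 0") auto
    with that show ?thesis by (simp add: powr_mult mult_right_mono)
  qed
  consider "x = 0" | "y = 0" | "0 < x" "0 < y" using assms by linarith
  then show ?thesis
  proof cases
    case 3
    then show ?thesis
      using convex_onD[OF powr_convex[OF p], of "1 - u" x y] assms by simp
  qed (use small[of u x] small[of "1 - u" y] assms in simp_all)
qed

text \<open>
  Minkowski's inequality, from convexity of \<open>t \<mapsto> t\<^sup>p\<close> applied to the normalised functions. Passing to
  numbers \<open>a\<close> and \<open>b\<close> slightly above the two norms avoids division by zero.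
\<close>

lemma Lp_norm_triangle:
  assumes p: "1 \<le> p" and f: "f \<in> borel_measurable M" and g: "g \<in> borel_measurable M"
  shows "Lp_norm p M (\<lambda>x. f x + g x) \<le> Lp_norm p M f + Lp_norm p M g"
proof (cases "Lp_norm p M f"; cases "Lp_norm p M g")
  fix \<alpha> \<beta> assume \<alpha>: "0 \<le> \<alpha>" "Lp_norm p M f = ennreal \<alpha>" and \<beta>: "0 \<le> \<beta>" "Lp_norm p M g = ennreal \<beta>"
  show ?thesis
  proof (rule ennreal_le_epsilon)
    fix e :: real assume e: "0 < e"
    define a b where "a = \<alpha> + e / 2" and "b = \<beta> + e / 2"
    have ab: "0 < a" "0 < b" using \<alpha> \<beta> e by (auto simp: a_def b_def)
    define u where "u = a / (a + b)"
    have u: "0 \<le> u" "u \<le> 1" "1 - u = b / (a + b)" using ab by (auto simp: u_def field_simps)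
    have scaled: "(\<integral>\<^sup>+x. ennreal ((\<bar>h x\<bar> / c) powr p) \<partial>M) \<le> 1"
      if h: "h \<in> borel_measurable M" "Lp_norm p M h \<le> ennreal c" and c: "0 < c" for h c
    proof -
      have "(\<integral>\<^sup>+x. ennreal ((\<bar>h x\<bar> / c) powr p) \<partial>M)
          = (\<integral>\<^sup>+x. ennreal (inverse (c powr p)) * ennreal (\<bar>h x\<bar> powr p) \<partial>M)"
      proof (rule nn_integral_cong)
        fix x
        have "(\<bar>h x\<bar> / c) powr p = inverse (c powr p) * \<bar>h x\<bar> powr p"
          using c by (subst powr_divide) (auto simp: divide_inverse mult.commute)
        then show "ennreal ((\<bar>h x\<bar> / c) powr p) = ennreal (inverse (c powr p)) * ennreal (\<bar>h x\<bar> powr p)"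
          by (simp add: ennreal_mult)
      qed
      also have "\<dots> = ennreal (inverse (c powr p)) * (\<integral>\<^sup>+x. ennreal (\<bar>h x\<bar> powr p) \<partial>M)"
        using h by (intro nn_integral_cmult) measurable
      also have "\<dots> \<le> ennreal (inverse (c powr p)) * ennreal (c powr p)"
        using h(2) c by (intro mult_left_mono) (simp_all add: Lp_norm_le_iff[OF p])
      also have "\<dots> = 1" using c by (simp add: ennreal_mult[symmetric])
      finally show ?thesis .
    qed
    have "(\<integral>\<^sup>+x. ennreal (\<bar>f x + g x\<bar> powr p) \<partial>M)
        \<le> (\<integral>\<^sup>+x. ennreal ((a + b) powr p) * (ennreal u * ennreal ((\<bar>f x\<bar> / a) powr p) + ennreal (1 - u) * ennreal ((\<bar>g x\<bar> / b) powr p)) \<partial>M)"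
    proof (rule nn_integral_mono)
      fix x
      have "\<bar>f x + g x\<bar> \<le> (a + b) * (u * (\<bar>f x\<bar> / a) + (1 - u) * (\<bar>g x\<bar> / b))"
        unfolding u(3) using ab by (simp add: u_def distrib_left abs_triangle_ineq)
      then have "\<bar>f x + g x\<bar> powr p \<le> ((a + b) * (u * (\<bar>f x\<bar> / a) + (1 - u) * (\<bar>g x\<bar> / b))) powr p"
        using p by (intro powr_mono2) auto
      also have "\<dots> = (a + b) powr p * (u * (\<bar>f x\<bar> / a) + (1 - u) * (\<bar>g x\<bar> / b)) powr p"
        by (rule powr_mult)
      also have "\<dots> \<le> (a + b) powr p * (u * (\<bar>f x\<bar> / a) powr p + (1 - u) * (\<bar>g x\<bar> / b) powr p)"
        using ab u by (intro mult_left_mono powr_convex_combination p) auto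
      finally have le: "\<bar>f x + g x\<bar> powr p \<le>
          (a + b) powr p * (u * (\<bar>f x\<bar> / a) powr p + (1 - u) * (\<bar>g x\<bar> / b) powr p)" .
      have "ennreal ((a + b) powr p * (u * (\<bar>f x\<bar> / a) powr p + (1 - u) * (\<bar>g x\<bar> / b) powr p)) =
          ennreal ((a + b) powr p) *
          (ennreal u * ennreal ((\<bar>f x\<bar> / a) powr p) + ennreal (1 - u) * ennreal ((\<bar>g x\<bar> / b) powr p))"
        using u(1,2) by (simp add: ennreal_mult)
      then show "ennreal (\<bar>f x + g x\<bar> powr p) \<le> ennreal ((a + b) powr p) *
          (ennreal u * ennreal ((\<bar>f x\<bar> / a) powr p) + ennreal (1 - u) * ennreal ((\<bar>g x\<bar> / b) powr p))"
        using ennreal_leI[OF le] by simp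
    qed
    also have "\<dots> = ennreal ((a + b) powr p) * (ennreal u * (\<integral>\<^sup>+x. ennreal ((\<bar>f x\<bar> / a) powr p) \<partial>M)
        + ennreal (1 - u) * (\<integral>\<^sup>+x. ennreal ((\<bar>g x\<bar> / b) powr p) \<partial>M))"
      using f g by (simp add: nn_integral_cmult nn_integral_add)
    also have "\<dots> \<le> ennreal ((a + b) powr p) * (ennreal u * 1 + ennreal (1 - u) * 1)"
    proof -
      have "Lp_norm p M f \<le> ennreal a" "Lp_norm p M g \<le> ennreal b"
        using \<alpha> \<beta> e by (auto simp: a_def b_def intro!: ennreal_leI)
      then show ?thesis by (intro mult_left_mono add_mono scaled f g ab) auto
    qed
    also have "\<dots> = ennreal ((a + b) powr p)"
      using u(1,2) by (simp add: ennreal_plus[symmetric] del: ennreal_plus)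
    finally have "Lp_norm p M (\<lambda>x. f x + g x) \<le> ennreal (a + b)"
      using ab by (subst Lp_norm_le_iff[OF p]) auto
    also have "\<dots> = Lp_norm p M f + Lp_norm p M g + ennreal e"
      using \<alpha> \<beta> e by (simp add: a_def b_def ennreal_plus[symmetric] del: ennreal_plus)
    finally show "Lp_norm p M (\<lambda>x. f x + g x) \<le> Lp_norm p M f + Lp_norm p M g + ennreal e" .
  qed
qed simp_all

lemma Lp_norm_sum_le:
  assumes p: "1 \<le> p" and S: "finite S" and f: "\<And>i. i \<in> S \<Longrightarrow> f i \<in> borel_measurable M"
  shows "Lp_norm p M (\<lambda>x. \<Sum>i\<in>S. f i x) \<le> (\<Sum>i\<in>S. Lp_norm p M (f i))"
  using S f
proof (induction S rule: finite_induct)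
  case empty
  have "Lp_norm p M (\<lambda>x. 0) \<le> ennreal 0" by (subst Lp_norm_le_iff[OF p]) auto
  then show ?case by simp
next
  case (insert i S)
  have "Lp_norm p M (\<lambda>x. f i x + (\<Sum>i\<in>S. f i x)) \<le> Lp_norm p M (f i) + Lp_norm p M (\<lambda>x. \<Sum>i\<in>S. f i x)"
    using insert.prems by (intro Lp_norm_triangle p borel_measurable_sum) auto
  also have "\<dots> \<le> Lp_norm p M (f i) + (\<Sum>i\<in>S. Lp_norm p M (f i))"
    using insert by (intro add_left_mono) auto
  finally show ?case using insert by simp
qed

section \<open>Signed sums of orthogonal signs\<close>

text \<open>
  The sum \<open>F\<close> of \<open>n\<close> signs satisfies \<open>\<bar>F\<bar> \<le> n\<close> and, by orthogonality, has square integral \<open>n \<mu>(\<Omega>)\<close>. Hence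
  \<open>\<bar>F\<bar>\<close> exceeds \<open>\<delta> n\<close> only on a set of measure \<open>O(1 / n)\<close>, which gives \<open>o(n)\<close> in \<open>L\<^sub>p\<close> for every finite \<open>p\<close>.
\<close>

lemma Lp_norm_random_sum_small:
  fixes r :: "nat \<Rightarrow> 'a \<Rightarrow> real" and \<epsilon> p :: real
  assumes fin: "finite_measure M" and p: "1 \<le> p"
    and r: "\<And>n. r n \<in> borel_measurable M" "\<And>n x. \<bar>r n x\<bar> = 1"
    and orth: "\<And>m n. m \<noteq> n \<Longrightarrow> (\<integral>x. r m x * r n x \<partial>M) = 0"
    and \<epsilon>: "0 < \<epsilon>"
  shows "\<exists>N. \<forall>S e. finite S \<longrightarrow> N \<le> card S \<longrightarrow> (\<forall>i\<in>S. \<bar>e i\<bar> = 1) \<longrightarrow>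
    Lp_norm p M (\<lambda>x. \<Sum>i\<in>S. e i * r i x) \<le> ennreal (\<epsilon> * real (card S))"
proof -
  interpret finite_measure M by fact
  define a where "a = measure M (space M) + 1"
  have a: "0 < a" "measure M (space M) \<le> a" by (auto simp: a_def add_nonneg_pos)
  \<comment> \<open>This choice makes \<open>\<delta>\<^sup>p a\<close> half of \<open>\<epsilon>\<^sup>p\<close>; the other half absorbs \<open>a / (\<delta>\<^sup>2 n)\<close> for large \<open>n\<close>.\<close>
  define \<delta> where "\<delta> = \<epsilon> * (1 / (2 * a)) powr (1 / p)"
  have \<delta>: "0 < \<delta>" using \<epsilon> a by (simp add: \<delta>_def)
  have \<delta>p: "\<delta> powr p * a = \<epsilon> powr p / 2"
    using \<epsilon> a p by (simp add: \<delta>_def powr_mult powr_powr field_simps)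
  obtain N :: nat where N: "2 * a / (\<delta>\<^sup>2 * \<epsilon> powr p) \<le> real N" using real_arch_simple by blast
  show ?thesis
  proof (intro exI[of _ "Suc N"] allI impI)
    fix S :: "nat set" and e :: "nat \<Rightarrow> real"
    assume S: "finite S" "Suc N \<le> card S" and e: "\<forall>i\<in>S. \<bar>e i\<bar> = 1"
    define n where "n = real (card S)"
    have n: "0 < n" "2 * a / (\<delta>\<^sup>2 * \<epsilon> powr p) \<le> n" using S N by (auto simp: n_def)
    define F where "F x = (\<Sum>i\<in>S. e i * r i x)" for x
    have F_meas: "F \<in> borel_measurable M" unfolding F_def using r by measurable
    have F_le: "\<bar>F x\<bar> \<le> n" for x
    proof -
      have "\<bar>F x\<bar> \<le> (\<Sum>i\<in>S. \<bar>e i * r i x\<bar>)" unfolding F_def by (rule sum_abs)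
      also have "\<dots> = n" using e r(2) by (simp add: abs_mult n_def)
      finally show ?thesis .
    qed
    have int: "integrable M (\<lambda>x. e i * e j * (r i x * r j x))" for i j
      using r by (intro integrable_const_bound[where B = "\<bar>e i * e j\<bar>"]) (auto simp: abs_mult)
    have sq: "(F x)\<^sup>2 = (\<Sum>i\<in>S. \<Sum>j\<in>S. e i * e j * (r i x * r j x))" for x
      unfolding F_def power2_eq_square sum_product by (simp add: mult_ac)
    have "(\<integral>x. (F x)\<^sup>2 \<partial>M) = (\<Sum>i\<in>S. \<integral>x. (\<Sum>j\<in>S. e i * e j * (r i x * r j x)) \<partial>M)"
      unfolding sq by (intro Bochner_Integration.integral_sum Bochner_Integration.integrable_sum int)
    also have "\<dots> = (\<Sum>i\<in>S. \<Sum>j\<in>S. \<integral>x. e i * e j * (r i x * r j x) \<partial>M)"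
      by (intro sum.cong refl Bochner_Integration.integral_sum int)
    also have "\<dots> = (\<Sum>i\<in>S. \<Sum>j\<in>S. e i * e j * (\<integral>x. r i x * r j x \<partial>M))"
      by simp
    also have "\<dots> = (\<Sum>i\<in>S. \<Sum>j\<in>S. if i = j then measure M (space M) else 0)"
    proof (intro sum.cong refl)
      fix i j assume "i \<in> S" "j \<in> S"
      then have "e i * e i = 1" "r i x * r i x = 1" for x
        using e r(2)[of i x] by (metis abs_mult_self_eq mult_1)+
      then show "e i * e j * (\<integral>x. r i x * r j x \<partial>M) = (if i = j then measure M (space M) else 0)"
        using orth[of i j] by (cases "i = j") auto
    qed
    also have "\<dots> = n * measure M (space M)" using S by (simp add: n_def)
    finally have L2: "(\<integral>x. (F x)\<^sup>2 \<partial>M) = n * measure M (space M)" .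
    have intF: "integrable M (\<lambda>x. (F x)\<^sup>2)"
      unfolding sq by (intro Bochner_Integration.integrable_sum int)
    \<comment> \<open>Where \<open>\<bar>F\<bar> > \<delta> n\<close>, the last factor is at least one after division by \<open>(\<delta> n)\<^sup>2\<close>, and \<open>\<bar>F\<bar> \<le> n\<close>.\<close>
    have pw: "\<bar>F x\<bar> powr p \<le> (\<delta> * n) powr p + n powr p / (\<delta> * n)\<^sup>2 * (F x)\<^sup>2" for x
    proof (cases "\<bar>F x\<bar> \<le> \<delta> * n")
      case True
      then have "\<bar>F x\<bar> powr p \<le> (\<delta> * n) powr p" using p by (intro powr_mono2) auto
      then show ?thesis by (simp add: add_increasing2)
    next
      case False
      then have "(\<delta> * n)\<^sup>2 \<le> (F x)\<^sup>2"
        using power_mono[of "\<delta> * n" "\<bar>F x\<bar>" 2] \<delta> n by simp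
      then have "1 \<le> (F x)\<^sup>2 / (\<delta> * n)\<^sup>2" using \<delta> n by (simp add: field_simps)
      have "\<bar>F x\<bar> powr p \<le> n powr p" using F_le[of x] p by (intro powr_mono2) auto
      also have "\<dots> \<le> n powr p * ((F x)\<^sup>2 / (\<delta> * n)\<^sup>2)"
        using mult_left_mono[OF \<open>1 \<le> (F x)\<^sup>2 / (\<delta> * n)\<^sup>2\<close>, of "n powr p"] by simp
      also have "\<dots> = n powr p / (\<delta> * n)\<^sup>2 * (F x)\<^sup>2" by simp
      finally show ?thesis by (simp add: add_increasing)
    qed
    have "(\<integral>\<^sup>+x. ennreal (\<bar>F x\<bar> powr p) \<partial>M) \<le> (\<integral>\<^sup>+x. ennreal ((\<delta> * n) powr p + n powr p / (\<delta> * n)\<^sup>2 * (F x)\<^sup>2) \<partial>M)"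
      by (intro nn_integral_mono ennreal_leI pw)
    also have "\<dots> = ennreal (\<integral>x. (\<delta> * n) powr p + n powr p / (\<delta> * n)\<^sup>2 * (F x)\<^sup>2 \<partial>M)"
      by (intro nn_integral_eq_integral Bochner_Integration.integrable_add integrable_mult_right intF) auto
    also have "(\<integral>x. (\<delta> * n) powr p + n powr p / (\<delta> * n)\<^sup>2 * (F x)\<^sup>2 \<partial>M)
        = measure M (space M) * (\<delta> * n) powr p + n powr p / (\<delta> * n)\<^sup>2 * (n * measure M (space M))"
      using intF by (simp add: L2)
    also have "\<dots> \<le> a * (\<delta> * n) powr p + n powr p / (\<delta> * n)\<^sup>2 * (n * a)"
      using a n by (intro add_mono mult_right_mono mult_left_mono) auto
    also have "\<dots> = n powr p * (\<delta> powr p * a + a / (\<delta>\<^sup>2 * n))"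
      using n \<delta> by (simp add: powr_mult power2_eq_square field_simps)
    also have "\<dots> \<le> n powr p * (\<epsilon> powr p / 2 + \<epsilon> powr p / 2)"
    proof -
      have "a / (\<delta>\<^sup>2 * n) \<le> \<epsilon> powr p / 2" using n \<delta> \<epsilon> by (simp add: field_simps)
      then show ?thesis unfolding \<delta>p by (intro mult_left_mono add_mono) auto
    qed
    also have "\<dots> = (\<epsilon> * n) powr p" by (simp add: powr_mult)
    finally have "(\<integral>\<^sup>+x. ennreal (\<bar>F x\<bar> powr p) \<partial>M) \<le> ennreal ((\<epsilon> * n) powr p)"
      by (simp add: ennreal_leI)
    then show "Lp_norm p M (\<lambda>x. \<Sum>i\<in>S. e i * r i x) \<le> ennreal (\<epsilon> * real (card S))"
      using \<epsilon> n by (subst Lp_norm_le_iff[OF p]) (auto simp: F_def n_def)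
  qed
qed

section \<open>Choice of signs and the gliding hump\<close>

text \<open>
  The numbers \<open>L i\<close> are the values of a linear functional on \<open>r i\<close>. If infinitely many of them were at least
  \<open>\<delta>\<close> in modulus, the signs \<open>sgn (L i)\<close> would produce sums of size \<open>\<delta> n\<close>.
\<close>

lemma functional_null_of_small_sums:
  fixes L :: "nat \<Rightarrow> real"
  assumes small: "\<And>\<epsilon>. 0 < \<epsilon> \<Longrightarrow> \<exists>N. \<forall>S e. finite S \<longrightarrow> N \<le> card S \<longrightarrow> (\<forall>i\<in>S. \<bar>e i\<bar> = 1) \<longrightarrow>
      (\<Sum>i\<in>S. e i * L i) \<le> \<epsilon> * real (card S)"
  shows "L \<longlonglongrightarrow> 0"
proof (rule ccontr)
  assume "\<not> L \<longlonglongrightarrow> 0"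
  then obtain \<delta> where \<delta>: "0 < \<delta>" and "\<And>n0. \<exists>n\<ge>n0. \<delta> \<le> \<bar>L n\<bar>"
    by (auto simp: LIMSEQ_iff not_less)
  then have inf: "infinite {n. \<delta> \<le> \<bar>L n\<bar>}"
    by (auto simp: infinite_nat_iff_unbounded_le)
  obtain N where N: "\<And>S e. finite S \<Longrightarrow> N \<le> card S \<Longrightarrow> (\<forall>i\<in>S. \<bar>e i\<bar> = 1) \<Longrightarrow>
      (\<Sum>i\<in>S. e i * L i) \<le> \<delta> / 2 * real (card S)"
    using small[of "\<delta> / 2"] \<delta> by auto
  obtain S where S: "finite S" "card S = Suc N" "S \<subseteq> {n. \<delta> \<le> \<bar>L n\<bar>}"
    using infinite_arbitrarily_large[OF inf] by blast
  have "\<delta> * real (card S) = (\<Sum>i\<in>S. \<delta>)" by simp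
  also have "\<dots> \<le> (\<Sum>i\<in>S. sgn (L i) * L i)"
    using S by (intro sum_mono) (auto simp: mult.commute[of "sgn _"] mult_sgn_abs abs_sgn[symmetric])
  also have "\<dots> \<le> \<delta> / 2 * real (card S)"
    using S \<delta> by (intro N) (auto simp: abs_sgn_eq)
  finally show False using S \<delta> by simp
qed

text \<open>
  Signs are chosen one at a time. The two sums obtained from \<open>w + v a\<close> and \<open>w - v a\<close> add up to at least
  twice the required bound, since \<open>2 w\<close> and \<open>2 v a\<close> are the sum and the difference of these two vectors;
  so one of the two is large enough. The offset \<open>w\<close> is what makes the induction work.
\<close>

lemma seminorm_sign_choice:
  fixes q :: "'i \<Rightarrow> ('a \<Rightarrow> real) \<Rightarrow> real" and v :: "'i \<Rightarrow> 'a \<Rightarrow> real"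
  assumes V: "\<And>f g. f \<in> V \<Longrightarrow> g \<in> V \<Longrightarrow> (\<lambda>x. f x + g x) \<in> V" "\<And>a f. f \<in> V \<Longrightarrow> (\<lambda>x. a * f x) \<in> V"
    and sub: "\<And>i f g. f \<in> V \<Longrightarrow> g \<in> V \<Longrightarrow> q i (\<lambda>x. f x + g x) \<le> q i f + q i g"
    and scale: "\<And>i a f. f \<in> V \<Longrightarrow> q i (\<lambda>x. a * f x) = \<bar>a\<bar> * q i f"
    and v: "\<And>i. v i \<in> V" and I: "finite I" "S \<subseteq> I" and w: "w \<in> V"
  shows "\<exists>e. (\<forall>i. \<bar>e i\<bar> = 1) \<and>
    (\<Sum>i\<in>I - S. q i w) + (\<Sum>i\<in>S. q i (v i)) \<le> (\<Sum>i\<in>I. q i (\<lambda>x. w x + (\<Sum>l\<in>S. e l * v l x)))"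
proof -
  have "finite S" using I finite_subset by blast
  then show ?thesis using I(2) w
  proof (induction S arbitrary: w rule: finite_induct)
    case empty
    show ?case by (intro exI[of _ "\<lambda>_. 1"]) simp
  next
    case (insert a S)
    define wp wm where "wp = (\<lambda>x. w x + v a x)" and "wm = (\<lambda>x. w x + -1 * v a x)"
    have mem: "wp \<in> V" "wm \<in> V"
      unfolding wp_def wm_def using insert.prems v V by blast+
    obtain ep where ep: "\<And>i. \<bar>ep i\<bar> = 1"
      "(\<Sum>i\<in>I - S. q i wp) + (\<Sum>i\<in>S. q i (v i)) \<le> (\<Sum>i\<in>I. q i (\<lambda>x. wp x + (\<Sum>l\<in>S. ep l * v l x)))"
      using insert.IH[OF _ mem(1)] insert.prems by blast
    obtain em where em: "\<And>i. \<bar>em i\<bar> = 1"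
      "(\<Sum>i\<in>I - S. q i wm) + (\<Sum>i\<in>S. q i (v i)) \<le> (\<Sum>i\<in>I. q i (\<lambda>x. wm x + (\<Sum>l\<in>S. em l * v l x)))"
      using insert.IH[OF _ mem(2)] insert.prems by blast
    have w2: "2 * q i w \<le> q i wp + q i wm" for i
    proof -
      have "(\<lambda>x. 2 * w x) = (\<lambda>x. wp x + wm x)" by (auto simp: wp_def wm_def)
      with scale[OF insert.prems(2), of i 2] sub[OF mem, of i] show ?thesis by simp
    qed
    have v2: "2 * q a (v a) \<le> q a wp + q a wm"
    proof -
      have "(\<lambda>x. 2 * v a x) = (\<lambda>x. wp x + -1 * wm x)" by (auto simp: wp_def wm_def)
      with scale[OF v[of a], of a 2] sub[OF mem(1) V(2)[OF mem(2)], of a "-1"] scale[OF mem(2), of a "-1"]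
      show ?thesis by simp
    qed
    have halve: thesis if "2 * x \<le> y + z" "x \<le> y \<Longrightarrow> thesis" "x \<le> z \<Longrightarrow> thesis" for x y z :: real and thesis
      using that by argo
    have split: "I - S = insert a (I - insert a S)" using insert by auto
    have "2 * ((\<Sum>i\<in>I - insert a S. q i w) + (\<Sum>i\<in>insert a S. q i (v i)))
        = (\<Sum>i\<in>I - insert a S. 2 * q i w) + 2 * q a (v a) + 2 * (\<Sum>i\<in>S. q i (v i))"
      using insert by (simp add: sum_distrib_left)
    also have "\<dots> \<le> (\<Sum>i\<in>I - insert a S. q i wp + q i wm) + (q a wp + q a wm) + 2 * (\<Sum>i\<in>S. q i (v i))"
      by (intro add_mono sum_mono w2 v2) auto
    also have "\<dots> = ((\<Sum>i\<in>I - S. q i wp) + (\<Sum>i\<in>S. q i (v i))) + ((\<Sum>i\<in>I - S. q i wm) + (\<Sum>i\<in>S. q i (v i)))"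
      unfolding split using I(1) by (simp add: sum.distrib)
    finally consider
        "(\<Sum>i\<in>I - insert a S. q i w) + (\<Sum>i\<in>insert a S. q i (v i)) \<le> (\<Sum>i\<in>I - S. q i wp) + (\<Sum>i\<in>S. q i (v i))"
      | "(\<Sum>i\<in>I - insert a S. q i w) + (\<Sum>i\<in>insert a S. q i (v i)) \<le> (\<Sum>i\<in>I - S. q i wm) + (\<Sum>i\<in>S. q i (v i))"
      by (rule halve)
    then show ?case
    proof cases
      case 1
      have "(\<lambda>x. w x + (\<Sum>l\<in>insert a S. (ep(a := 1)) l * v l x)) = (\<lambda>x. wp x + (\<Sum>l\<in>S. ep l * v l x))"
        using insert.hyps by (auto simp: wp_def intro!: ext sum.cong)
      with 1 ep show ?thesis by (intro exI[of _ "ep(a := 1)"]) auto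
    next
      case 2
      have "(\<lambda>x. w x + (\<Sum>l\<in>insert a S. (em(a := -1)) l * v l x)) = (\<lambda>x. wm x + (\<Sum>l\<in>S. em l * v l x))"
        using insert.hyps by (auto simp: wm_def intro!: ext sum.cong)
      with 2 em show ?thesis by (intro exI[of _ "em(a := -1)"]) auto
    qed
  qed
qed

text \<open>
  The gliding hump: indices \<open>n m\<close> and consecutive blocks of scales \<open>k m ..< k (m + 1)\<close> are chosen alternately
  such that \<open>r (n m)\<close> has mass at least \<open>c\<close> on the block with number \<open>m\<close>.
\<close>

lemma no_escaping_seminorm_mass:
  fixes q :: "nat \<Rightarrow> ('a \<Rightarrow> real) \<Rightarrow> real" and r :: "nat \<Rightarrow> 'a \<Rightarrow> real"
  assumes V: "\<And>f g. f \<in> V \<Longrightarrow> g \<in> V \<Longrightarrow> (\<lambda>x. f x + g x) \<in> V" "\<And>a f. f \<in> V \<Longrightarrow> (\<lambda>x. a * f x) \<in> V"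
    and sub: "\<And>j f g. f \<in> V \<Longrightarrow> g \<in> V \<Longrightarrow> q j (\<lambda>x. f x + g x) \<le> q j f + q j g"
    and scale: "\<And>j a f. f \<in> V \<Longrightarrow> q j (\<lambda>x. a * f x) = \<bar>a\<bar> * q j f"
    and r: "\<And>n. r n \<in> V"
    and small: "\<And>\<epsilon>. 0 < \<epsilon> \<Longrightarrow> \<exists>N. \<forall>S e K. finite S \<longrightarrow> N \<le> card S \<longrightarrow> (\<forall>i\<in>S. \<bar>e i\<bar> = 1) \<longrightarrow>
      (\<Sum>j<K. q j (\<lambda>x. \<Sum>i\<in>S. e i * r i x)) \<le> \<epsilon> * real (card S)"
    and c: "0 < c"
    and escape: "\<And>k. \<exists>n0. \<forall>n\<ge>n0. \<exists>K. c \<le> (\<Sum>j=k..<K. q j (r n))"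
  shows False
proof -
  have nonneg: "0 \<le> q j f" if "f \<in> V" for j f
  proof -
    have "q j (\<lambda>x. f x + -1 * f x) \<le> q j f + q j (\<lambda>x. -1 * f x)" using that V by (intro sub)
    moreover have "(\<lambda>x. f x + -1 * f x) = (\<lambda>x. 0 * f x)" by auto
    ultimately show ?thesis using scale[OF that, of j 0] scale[OF that, of j "-1"] by simp
  qed
  \<comment> \<open>A triple \<open>t\<close> consists of an index and the two ends of a block of scales.\<close>
  define mass where "mass t \<longleftrightarrow> c \<le> (\<Sum>j=fst (snd t)..<snd (snd t). q j (r (fst t)))"
    for t :: "nat \<times> nat \<times> nat"
  have "\<exists>s. \<forall>m. mass (s m) \<and> (fst (s m) < fst (s (Suc m)) \<and> fst (snd (s (Suc m))) = snd (snd (s m)))"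
  proof (rule dependent_nat_choice)
    obtain n0 where "\<forall>n\<ge>n0. \<exists>K. c \<le> (\<Sum>j=0..<K. q j (r n))" using escape[of 0] by blast
    then obtain K where "c \<le> (\<Sum>j=0..<K. q j (r n0))" by blast
    then show "\<exists>t. mass t" by (intro exI[of _ "(n0, 0, K)"]) (simp add: mass_def)
  next
    fix t :: "nat \<times> nat \<times> nat" and m :: nat
    obtain n0 where n0: "\<forall>n\<ge>n0. \<exists>K. c \<le> (\<Sum>j=snd (snd t)..<K. q j (r n))"
      using escape[of "snd (snd t)"] by blast
    let ?n = "max n0 (Suc (fst t))"
    have "n0 \<le> ?n" by simp
    with n0 obtain K where "c \<le> (\<Sum>j=snd (snd t)..<K. q j (r ?n))" by blast
    then show "\<exists>t'. mass t' \<and> (fst t < fst t' \<and> fst (snd t') = snd (snd t))"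
      by (intro exI[of _ "(?n, snd (snd t), K)"]) (simp add: mass_def)
  qed
  then obtain s where s: "\<forall>m. mass (s m) \<and> (fst (s m) < fst (s (Suc m)) \<and> fst (snd (s (Suc m))) = snd (snd (s m)))"
    by (rule exE)
  define n where "n m = fst (s m)" for m
  define k where "k m = fst (snd (s m))" for m
  have mass: "c \<le> (\<Sum>j=k m..<k (Suc m). q j (r (n m)))" for m
    using s[rule_format, of m] by (simp add: n_def k_def mass_def)
  have "strict_mono n" unfolding strict_mono_Suc_iff
    using s by (simp add: n_def)
  have k_le: "k m \<le> k (Suc m)" for m
    using mass[of m] c by (cases "k m \<le> k (Suc m)") auto
  define qb where "qb m f = (\<Sum>j=k m..<k (Suc m). q j f)" for m f
  have blocks: "(\<Sum>m<N. qb m f) = (\<Sum>j=k 0..<k N. q j f)" for N f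
  proof (induction N)
    case (Suc N)
    have "k 0 \<le> k N" by (rule lift_Suc_mono_le[of k]) (use k_le in auto)
    with Suc show ?case using k_le[of N] by (simp add: qb_def sum.atLeastLessThan_concat)
  qed simp
  obtain N where N: "\<And>S e K. finite S \<Longrightarrow> N \<le> card S \<Longrightarrow> (\<forall>i\<in>S. \<bar>e i\<bar> = 1) \<Longrightarrow>
      (\<Sum>j<K. q j (\<lambda>x. \<Sum>i\<in>S. e i * r i x)) \<le> c / 2 * real (card S)"
    using small[OF half_gt_zero[OF c]] by blast
  let ?L = "Suc N"
  have zero: "(\<lambda>x. 0 * r 0 x) \<in> V" using r V by blast
  have "\<exists>e. (\<forall>i. \<bar>e i\<bar> = 1) \<and>
      (\<Sum>m\<in>{..<?L} - {..<?L}. qb m (\<lambda>x. 0 * r 0 x)) + (\<Sum>m\<in>{..<?L}. qb m (r (n m)))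
      \<le> (\<Sum>m\<in>{..<?L}. qb m (\<lambda>x. 0 * r 0 x + (\<Sum>l\<in>{..<?L}. e l * r (n l) x)))"
  proof (rule seminorm_sign_choice[OF V])
    show "qb m (\<lambda>x. g x + h x) \<le> qb m g + qb m h" if "g \<in> V" "h \<in> V" for m g h
      unfolding qb_def sum.distrib[symmetric] using that by (intro sum_mono sub)
    show "qb m (\<lambda>x. a * g x) = \<bar>a\<bar> * qb m g" if "g \<in> V" for m a g
      unfolding qb_def sum_distrib_left using that by (intro sum.cong refl scale)
  qed (use r zero in auto)
  then obtain e where e: "\<And>i. \<bar>e i\<bar> = 1"
    "(\<Sum>m<?L. qb m (r (n m))) \<le> (\<Sum>m<?L. qb m (\<lambda>x. \<Sum>l<?L. e l * r (n l) x))"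
    by (auto simp del: sum.lessThan_Suc)
  define f where "f = (\<lambda>x. \<Sum>l<?L. e l * r (n l) x)"
  \<comment> \<open>The selected sum as a signed sum over a set of indices, to which the smallness hypothesis applies.\<close>
  have f_alt: "f = (\<lambda>x. \<Sum>i\<in>n ` {..<?L}. e (inv n i) * r i x)"
    using strict_mono_imp_inj_on[OF \<open>strict_mono n\<close>]
    by (auto simp: f_def sum.reindex inj_on_subset[of n UNIV] inv_f_f)
  have sum_V: "(\<lambda>x. \<Sum>l\<in>T. e l * r (n l) x) \<in> V" if "finite T" for T :: "nat set"
    using that
  proof (induction T rule: finite_induct)
    case empty
    then show ?case using zero by simp
  next
    case (insert l T)
    then show ?case using V(1)[OF V(2)[OF r[of "n l"], of "e l"] insert.IH] by simp
  qed
  have f_V: "f \<in> V" unfolding f_def by (rule sum_V) simp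
  have "c * real ?L = (\<Sum>m<?L. c)" by simp
  also have "\<dots> \<le> (\<Sum>m<?L. qb m (r (n m)))" by (intro sum_mono) (simp add: qb_def mass)
  also have "\<dots> \<le> (\<Sum>m<?L. qb m f)" using e(2) by (simp only: f_def)
  also have "\<dots> \<le> (\<Sum>j<k ?L. q j f)"
    unfolding blocks by (intro sum_mono2) (auto intro: nonneg f_V)
  also have "\<dots> \<le> c / 2 * real (card (n ` {..<?L}))"
    unfolding f_alt using strict_mono_imp_inj_on[OF \<open>strict_mono n\<close>] e(1)
    by (intro N) (auto simp: card_image inj_on_subset[of n UNIV])
  also have "\<dots> = c / 2 * real ?L"
    using strict_mono_imp_inj_on[OF \<open>strict_mono n\<close>] by (simp add: card_image inj_on_subset[of n UNIV])
  finally show False using c by simp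
qed

section \<open>Mean oscillation in a doubling space\<close>

text \<open>
  Doubling is required for radii up to one only. The larger balls below have radius at most two,
  because the comparisons take place at scales \<open>t\<close> with \<open>2 t \<le> 1\<close>.
\<close>

locale doubling_space =
  fixes M :: "'a::polish_space measure" and D :: real
  assumes space_M: "space M = UNIV" and borel_M: "sets borel \<subseteq> sets M"
    and ball: "0 < r \<Longrightarrow> 0 < emeasure M (ball x r)" "0 < r \<Longrightarrow> emeasure M (ball x r) < \<infinity>"
    and doubling: "0 < r \<Longrightarrow> r \<le> 1 \<Longrightarrow> measure M (ball x (2 * r)) \<le> D * measure M (ball x r)"
begin

lemma open_sets: "open U \<Longrightarrow> U \<in> sets M"
  using borel_M by auto

lemma ball_sets: "ball x r \<in> sets M"
  by (simp add: open_sets)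

lemma ball_fmeasurable: "0 < r \<Longrightarrow> ball x r \<in> fmeasurable M"
  using ball(2) by (intro fmeasurableI ball_sets) auto

lemma emeasure_ball: "0 < r \<Longrightarrow> emeasure M (ball x r) = ennreal (measure M (ball x r))"
  using ball(2)[of r x] by (intro emeasure_eq_ennreal_measure) auto

lemma measure_ball_pos: "0 < r \<Longrightarrow> 0 < measure M (ball x r)"
  using ball(1)[of r x] by (simp add: emeasure_ball)

lemma measure_ball_mono: "0 < t \<Longrightarrow> ball x s \<subseteq> ball y t \<Longrightarrow> measure M (ball x s) \<le> measure M (ball y t)"
  by (rule measure_mono_fmeasurable) (auto intro: ball_fmeasurable ball_sets)

lemma D_ge_1: "1 \<le> D"
proof -
  define x :: 'a where "x = undefined"
  have "1 * measure M (ball x 1) \<le> measure M (ball x (2 * 1))"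
    using measure_ball_mono[of 2 x 1 x] subset_ball[of 1 2 x] by simp
  also have "\<dots> \<le> D * measure M (ball x 1)" by (rule doubling) auto
  finally show ?thesis using measure_ball_pos[of 1 x] by (simp only: mult_le_cancel_right_pos zero_less_one)
qed

lemma doubling_twice:
  assumes "0 < r" "2 * r \<le> 1"
  shows "measure M (ball x (4 * r)) \<le> D\<^sup>2 * measure M (ball x r)"
proof -
  have "measure M (ball x (2 * (2 * r))) \<le> D * measure M (ball x (2 * r))"
    using assms by (intro doubling) auto
  also have "\<dots> \<le> D * (D * measure M (ball x r))"
    using assms D_ge_1 by (intro mult_left_mono doubling) auto
  finally show ?thesis by (simp add: power2_eq_square mult.assoc)
qed

lemma sigma_finite: "sigma_finite_measure M"
proof
  fix x :: 'a
  show "\<exists>A. countable A \<and> A \<subseteq> sets M \<and> \<Union> A = space M \<and> (\<forall>a\<in>A. emeasure M a \<noteq> \<infinity>)"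
  proof (intro exI[of _ "(\<lambda>n::nat. ball undefined (real (Suc n))) ` UNIV"] conjI ballI)
    have "y \<in> (\<Union>n. ball undefined (real (Suc n)))" for y :: 'a
    proof -
      obtain n :: nat where "dist undefined y < real n" using reals_Archimedean2 by blast
      then show ?thesis by (auto intro!: exI[of _ n])
    qed
    then show "\<Union> ((\<lambda>n::nat. ball undefined (real (Suc n))) ` UNIV) = space M"
      by (auto simp: space_M)
    fix a :: "'a set" assume "a \<in> (\<lambda>n::nat. ball undefined (real (Suc n))) ` UNIV"
    then show "emeasure M a \<noteq> \<infinity>" using ball(2) by (auto simp: less_top)
  qed (auto simp: ball_sets)
qed

lemma L1_locD: "f \<in> L1_loc M \<Longrightarrow> f \<in> borel_measurable M" "f \<in> L1_loc M \<Longrightarrow> 0 < r \<Longrightarrow> set_integrable M (ball x r) f"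
  by (auto simp: L1_loc_def)

lemma set_integrable_const: "0 < r \<Longrightarrow> set_integrable M (ball x r) (\<lambda>_. c :: real)"
  unfolding set_integrable_def using ball(2)[of r x]
  by (intro integrable_scaleR_left integrable_real_indicator ball_sets)

lemma set_integrable_abs_diff:
  "f \<in> L1_loc M \<Longrightarrow> 0 < r \<Longrightarrow> set_integrable M (ball x r) (\<lambda>y. \<bar>f y - c\<bar>)"
  by (intro set_integrable_abs set_integral_diff(1) set_integrable_const L1_locD)

lemma abs_average_diff_le:
  assumes f: "f \<in> L1_loc M" and r: "0 < r"
  shows "\<bar>average M (ball x r) f - c\<bar> \<le> average M (ball x r) (\<lambda>y. \<bar>f y - c\<bar>)"
proof -
  have pos: "0 < measure M (ball x r)" using r by (rule measure_ball_pos)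
  have "(LINT y:ball x r|M. f y - c) = (LINT y:ball x r|M. f y) - (LINT y:ball x r|M. c)"
    using f r by (intro set_integral_diff L1_locD set_integrable_const)
  also have "(LINT y:ball x r|M. c) = measure M (ball x r) * c"
    using ball(2)[OF r, of x] by (subst set_integral_const) (auto simp: ball_sets)
  finally have "average M (ball x r) f - c = (1 / measure M (ball x r)) * (LINT y:ball x r|M. f y - c)"
    using pos by (simp add: average_def field_simps)
  moreover have "\<bar>LINT y:ball x r|M. f y - c\<bar> \<le> (LINT y:ball x r|M. \<bar>f y - c\<bar>)"
    unfolding set_lebesgue_integral_def
    by (rule order_trans[OF integral_abs_bound]) (simp add: abs_mult)
  ultimately show ?thesis
    using pos by (simp add: average_def abs_mult divide_right_mono)
qed

lemma average_le_average:
  assumes g: "set_integrable M (ball y t) g" "\<And>z. 0 \<le> g z" and st: "0 < s" "0 < t" "ball x s \<subseteq> ball y t"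
    and K: "measure M (ball y t) \<le> K * measure M (ball x s)"
  shows "average M (ball x s) g \<le> K * average M (ball y t) g"
proof -
  have pos: "0 < measure M (ball x s)" "0 < measure M (ball y t)" using st by (auto intro: measure_ball_pos)
  have gs: "set_integrable M (ball x s) g"
    using g(1) by (rule set_integrable_subset) (use st in \<open>auto simp: ball_sets\<close>)
  have "(LINT z:ball x s|M. g z) \<le> (LINT z:ball y t|M. g z)"
    unfolding set_lebesgue_integral_def
    by (rule integral_mono) (use g gs st(3) in \<open>auto simp: set_integrable_def split: split_indicator\<close>)
  then have "average M (ball x s) g \<le> (1 / measure M (ball x s)) * (LINT z:ball y t|M. g z)"
    unfolding average_def using pos by (intro mult_left_mono) auto
  also have "\<dots> \<le> (K / measure M (ball y t)) * (LINT z:ball y t|M. g z)"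
  proof (rule mult_right_mono)
    show "1 / measure M (ball x s) \<le> K / measure M (ball y t)" using K pos by (simp add: field_simps)
    show "0 \<le> (LINT z:ball y t|M. g z)"
      unfolding set_lebesgue_integral_def using g by (intro integral_nonneg_AE) auto
  qed
  finally show ?thesis by (simp add: average_def)
qed

lemma mean_oscillation_nonneg: "0 \<le> mean_oscillation M t f x"
  unfolding mean_oscillation_def average_def set_lebesgue_integral_def
  by (intro mult_nonneg_nonneg integral_nonneg_AE) auto

text \<open>
  Both averages over the smaller ball are compared with \<open>f - c\<close>, where \<open>c\<close> is the average over the larger
  ball; enlarging the domain of integration costs the factor \<open>K\<close>.
\<close>

lemma
  assumes f: "f \<in> L1_loc M" and st: "0 < s" "0 < t" "ball x s \<subseteq> ball y t"
    and K: "measure M (ball y t) \<le> K * measure M (ball x s)"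
  shows average_diff_le_oscillation:
      "\<bar>average M (ball x s) f - average M (ball y t) f\<bar> \<le> K * mean_oscillation M t f y"
    and oscillation_le_oscillation: "mean_oscillation M s f x \<le> 2 * K * mean_oscillation M t f y"
proof -
  define c where "c = average M (ball y t) f"
  define a where "a = average M (ball x s) f"
  have "average M (ball x s) (\<lambda>z. \<bar>f z - c\<bar>) \<le> K * average M (ball y t) (\<lambda>z. \<bar>f z - c\<bar>)"
    using f st K by (intro average_le_average set_integrable_abs_diff) auto
  then have A: "average M (ball x s) (\<lambda>z. \<bar>f z - c\<bar>) \<le> K * mean_oscillation M t f y"
    by (simp add: mean_oscillation_def c_def)
  have B: "\<bar>a - c\<bar> \<le> average M (ball x s) (\<lambda>z. \<bar>f z - c\<bar>)"
    unfolding a_def using f st by (intro abs_average_diff_le)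
  show "\<bar>average M (ball x s) f - average M (ball y t) f\<bar> \<le> K * mean_oscillation M t f y"
    using A B by (simp add: a_def c_def)
  have pos: "0 < measure M (ball x s)" using st by (auto intro: measure_ball_pos)
  have "(LINT z:ball x s|M. \<bar>f z - a\<bar>) \<le> (LINT z:ball x s|M. \<bar>f z - c\<bar> + \<bar>a - c\<bar>)"
    by (intro set_integral_mono set_integral_add(1) set_integrable_abs_diff set_integrable_const f st) auto
  also have "\<dots> = (LINT z:ball x s|M. \<bar>f z - c\<bar>) + (LINT z:ball x s|M. \<bar>a - c\<bar>)"
    by (intro set_integral_add(2) set_integrable_abs_diff set_integrable_const f st)
  also have "(LINT z:ball x s|M. \<bar>a - c\<bar>) = measure M (ball x s) * \<bar>a - c\<bar>"
    using ball(2)[OF st(1), of x] by (subst set_integral_const) (auto simp: ball_sets)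
  finally have le: "(LINT z:ball x s|M. \<bar>f z - a\<bar>) \<le> (LINT z:ball x s|M. \<bar>f z - c\<bar>) + measure M (ball x s) * \<bar>a - c\<bar>" .
  have "mean_oscillation M s f x \<le> average M (ball x s) (\<lambda>z. \<bar>f z - c\<bar>) + \<bar>a - c\<bar>"
  proof -
    have "mean_oscillation M s f x = (1 / measure M (ball x s)) * (LINT z:ball x s|M. \<bar>f z - a\<bar>)"
      by (simp add: mean_oscillation_def average_def a_def)
    also have "\<dots> \<le> (1 / measure M (ball x s)) *
        ((LINT z:ball x s|M. \<bar>f z - c\<bar>) + measure M (ball x s) * \<bar>a - c\<bar>)"
      using le pos by (intro mult_left_mono) auto
    also have "\<dots> = average M (ball x s) (\<lambda>z. \<bar>f z - c\<bar>) + \<bar>a - c\<bar>"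
      using pos by (simp add: average_def[of M "ball x s" "\<lambda>z. \<bar>f z - c\<bar>"] distrib_left)
    finally show ?thesis .
  qed
  with A B show "mean_oscillation M s f x \<le> 2 * K * mean_oscillation M t f y" by simp
qed

lemma measurable_dist_less:
  assumes N: "(\<lambda>x. x) \<in> N \<rightarrow>\<^sub>M borel"
  shows "{z \<in> space (N \<Otimes>\<^sub>M M). dist (fst z) (snd z) < t} \<in> sets (N \<Otimes>\<^sub>M M)"
proof -
  have M: "(\<lambda>x. x) \<in> M \<rightarrow>\<^sub>M borel"
    using borel_M by (auto intro!: measurableI simp: space_M)
  have "fst \<in> N \<Otimes>\<^sub>M M \<rightarrow>\<^sub>M borel" "snd \<in> N \<Otimes>\<^sub>M M \<rightarrow>\<^sub>M borel"
    by (rule measurable_compose[OF measurable_fst N]) (rule measurable_compose[OF measurable_snd M])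
  then show ?thesis by measurable
qed

lemma measurable_indicator_ball:
  assumes N: "(\<lambda>x. x) \<in> N \<rightarrow>\<^sub>M borel"
  shows "(\<lambda>z. indicator (ball (fst z) t) (snd z) :: real) \<in> borel_measurable (N \<Otimes>\<^sub>M M)"
    and "(\<lambda>z. indicator (ball (fst z) t) (snd z) :: ennreal) \<in> borel_measurable (N \<Otimes>\<^sub>M M)"
proof -
  let ?A = "{z \<in> space (N \<Otimes>\<^sub>M M). dist (fst z) (snd z) < t}"
  have eq: "z \<in> space (N \<Otimes>\<^sub>M M) \<Longrightarrow> indicator (ball (fst z) t) (snd z) = indicator ?A z" for z
    by (simp add: indicator_def)
  show "(\<lambda>z. indicator (ball (fst z) t) (snd z) :: real) \<in> borel_measurable (N \<Otimes>\<^sub>M M)"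
    by (subst measurable_cong[OF eq]) (auto intro!: borel_measurable_indicator measurable_dist_less[OF N])
  have eq: "z \<in> space (N \<Otimes>\<^sub>M M) \<Longrightarrow> (indicator (ball (fst z) t) (snd z) :: ennreal) = indicator ?A z" for z
    by (simp add: indicator_def)
  show "(\<lambda>z. indicator (ball (fst z) t) (snd z) :: ennreal) \<in> borel_measurable (N \<Otimes>\<^sub>M M)"
    by (subst measurable_cong[OF eq]) (auto intro!: borel_measurable_indicator measurable_dist_less[OF N])
qed

lemma measurable_set_integral_ball:
  assumes g: "(\<lambda>z. g (fst z) (snd z)) \<in> borel_measurable (borel \<Otimes>\<^sub>M M)"
  shows "(\<lambda>x. LINT y:ball x t|M. (g x y :: real)) \<in> borel_measurable borel"
proof -
  interpret sigma_finite_measure M by (rule sigma_finite)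
  show ?thesis unfolding set_lebesgue_integral_def
    by (rule borel_measurable_lebesgue_integral)
       (use measurable_indicator_ball(1)[of borel t] g in \<open>simp add: case_prod_beta'\<close>)
qed

lemma measurable_measure_ball:
  shows "(\<lambda>x. measure M (ball x t)) \<in> borel_measurable borel"
proof (cases "0 < t")
  case True
  have "(\<lambda>x. LINT y:ball x t|M. (1::real)) \<in> borel_measurable borel"
    by (rule measurable_set_integral_ball) simp
  moreover have "(LINT y:ball x t|M. (1::real)) = measure M (ball x t)" for x
    using ball(2)[OF True, of x] by (subst set_integral_const) (auto simp: ball_sets)
  ultimately show ?thesis by simp
next
  case False
  then have "(\<lambda>x. measure M (ball x t)) = (\<lambda>x. 0)" by (simp add: ball_empty)
  then show ?thesis by simp
qed

lemma measurable_average: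
  assumes g: "(\<lambda>z. g (fst z) (snd z)) \<in> borel_measurable (borel \<Otimes>\<^sub>M M)"
  shows "(\<lambda>x. average M (ball x t) (g x)) \<in> borel_measurable borel"
  unfolding average_def using measurable_set_integral_ball[OF g] measurable_measure_ball by simp

lemma measurable_ball_average:
  assumes f: "f \<in> borel_measurable M"
  shows "(\<lambda>x. average M (ball x t) f) \<in> borel_measurable borel"
  using f by (intro measurable_average) simp

lemma measurable_mean_oscillation:
  assumes f: "f \<in> borel_measurable M"
  shows "mean_oscillation M t f \<in> borel_measurable borel"
  unfolding mean_oscillation_def[abs_def]
proof (rule measurable_average)
  have [measurable]: "(\<lambda>x. average M (ball x t) f) \<in> borel_measurable borel"
    by (rule measurable_ball_average[OF f])
  note f[measurable]
  show "(\<lambda>z. \<bar>f (snd z) - average M (ball (fst z) t) f\<bar>) \<in> borel_measurable (borel \<Otimes>\<^sub>M M)"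
    by measurable
qed

lemma borel_measurable_M: "g \<in> borel_measurable borel \<Longrightarrow> g \<in> borel_measurable M"
  using borel_M by (auto simp: measurable_def space_M)

end

section \<open>Oscillation against a regular measure and the dyadic Besov norm\<close>

text \<open>
  The radii start at \<open>1 / 2\<close>, so that all the intervals \<open>[t, 2 t)\<close> lie in the range \<open>(0, 1)\<close> of the Besov norm.
\<close>

abbreviation dyadic :: "nat \<Rightarrow> real" where
  "dyadic j \<equiv> (1 / 2) ^ Suc j"

lemma dyadic_bounds: "0 < dyadic j" "2 * dyadic (Suc j) = dyadic j" "2 * dyadic j \<le> 1"
proof -
  have "(1 / 2 :: real) ^ j \<le> 1" by (rule power_le_one) auto
  then show "2 * dyadic j \<le> 1" by simp
qed auto

context doubling_space
begin

text \<open>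
  For \<open>y \<in> B\<^sub>t(x)\<close> the oscillation on \<open>B\<^sub>t(x)\<close> is controlled by the one on \<open>B\<^sub>2\<^sub>t(y)\<close>, so it can be averaged over
  such \<open>y\<close>. Exchanging the integrals leaves the \<open>H\<close>-measure of \<open>B\<^sub>t(y)\<close> divided by its \<open>M\<close>-measure, which is
  at most \<open>C\<close>.
\<close>

lemma nn_integral_oscillation_powr_le:
  assumes H: "sigma_finite_measure H" and id: "(\<lambda>x. x) \<in> H \<rightarrow>\<^sub>M borel"
    and p: "1 \<le> p" and f: "f \<in> L1_loc M" and t: "0 < t" "2 * t \<le> 1" and C: "0 \<le> C"
    and upper: "\<And>y. emeasure H {x \<in> space H. dist x y < t} \<le> ennreal (C * measure M (ball y t))"
  shows "(\<integral>\<^sup>+x. ennreal (\<bar>mean_oscillation M t f x\<bar> powr p) \<partial>H) \<le>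
    ennreal (C * D * (2 * D\<^sup>2) powr p) * (\<integral>\<^sup>+y. ennreal (\<bar>mean_oscillation M (2 * t) f y\<bar> powr p) \<partial>M)"
proof -
  interpret MM: sigma_finite_measure M by (rule sigma_finite)
  interpret HH: sigma_finite_measure H by (rule H)
  interpret HM: pair_sigma_finite H M ..
  define m where "m x = measure M (ball x t)" for x
  have m: "0 < m x" for x using t by (simp add: m_def measure_ball_pos)
  define o1 where "o1 = mean_oscillation M t f"
  define o2 where "o2 = mean_oscillation M (2 * t) f"
  have o_nonneg: "0 \<le> o1 x" "0 \<le> o2 x" for x by (simp_all add: o1_def o2_def mean_oscillation_nonneg)
  have o2_borel: "o2 \<in> borel_measurable borel"
    unfolding o2_def using f by (intro measurable_mean_oscillation L1_locD)
  have m_borel: "m \<in> borel_measurable borel"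
    unfolding m_def by (rule measurable_measure_ball)
  have [measurable]: "o2 \<in> borel_measurable M" "m \<in> borel_measurable M"
    using o2_borel m_borel by (auto intro: borel_measurable_M)
  let ?c = "\<lambda>y. ennreal (D / m y * (2 * D\<^sup>2 * o2 y) powr p)"
  \<comment> \<open>Doubling compares both the oscillations and the measures of the balls around \<open>x\<close> and \<open>y\<close>.\<close>
  have near: "1 / m x * o1 x powr p \<le> D / m y * (2 * D\<^sup>2 * o2 y) powr p" if "y \<in> ball x t" for x y
  proof (rule mult_mono)
    have "ball y t \<subseteq> ball x (2 * t)"
    proof
      fix z assume "z \<in> ball y t"
      then show "z \<in> ball x (2 * t)" using that dist_triangle[of x z y] by simp
    qed
    then have "m y \<le> measure M (ball x (2 * t))"
      unfolding m_def using t by (intro measure_ball_mono) auto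
    also have "\<dots> \<le> D * m x" unfolding m_def using t by (intro doubling) auto
    finally show "1 / m x \<le> D / m y" using m[of x] m[of y] by (simp add: field_simps)
    have sub: "ball x t \<subseteq> ball y (2 * t)" "ball y (2 * t) \<subseteq> ball x (4 * t)"
    proof -
      show "ball x t \<subseteq> ball y (2 * t)"
      proof
        fix z assume "z \<in> ball x t"
        then show "z \<in> ball y (2 * t)" using that dist_triangle[of y z x] by (simp add: dist_commute)
      qed
      show "ball y (2 * t) \<subseteq> ball x (4 * t)"
      proof
        fix z assume "z \<in> ball y (2 * t)"
        then show "z \<in> ball x (4 * t)" using that t dist_triangle[of x z y] by (simp add: dist_commute)
      qed
    qed
    have "measure M (ball y (2 * t)) \<le> measure M (ball x (4 * t))"
      using t sub by (intro measure_ball_mono) auto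
    also have "\<dots> \<le> D\<^sup>2 * measure M (ball x t)" using t by (rule doubling_twice)
    finally have "o1 x \<le> 2 * D\<^sup>2 * o2 y"
      unfolding o1_def o2_def using f t sub by (intro oscillation_le_oscillation) auto
    then show "o1 x powr p \<le> (2 * D\<^sup>2 * o2 y) powr p" using p o_nonneg by (intro powr_mono2) auto
  qed (use m D_ge_1 in \<open>auto simp: less_imp_le\<close>)
  have "(\<integral>\<^sup>+x. ennreal (\<bar>o1 x\<bar> powr p) \<partial>H)
      = (\<integral>\<^sup>+x. \<integral>\<^sup>+y. ennreal (1 / m x * o1 x powr p) * indicator (ball x t) y \<partial>M \<partial>H)"
  proof (rule nn_integral_cong)
    fix x
    have "(\<integral>\<^sup>+y. ennreal (1 / m x * o1 x powr p) * indicator (ball x t) y \<partial>M)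
        = ennreal (1 / m x * o1 x powr p) * ennreal (m x)"
      using t by (subst nn_integral_cmult_indicator) (auto simp: ball_sets emeasure_ball m_def)
    also have "\<dots> = ennreal (o1 x powr p)" using m[of x] by (simp add: ennreal_mult[symmetric])
    finally show "ennreal (\<bar>o1 x\<bar> powr p) = (\<integral>\<^sup>+y. ennreal (1 / m x * o1 x powr p) * indicator (ball x t) y \<partial>M)"
      using o_nonneg[of x] by simp
  qed
  also have "\<dots> \<le> (\<integral>\<^sup>+x. \<integral>\<^sup>+y. ?c y * indicator (ball x t) y \<partial>M \<partial>H)"
    using near by (intro nn_integral_mono) (auto split: split_indicator intro!: ennreal_leI)
  also have "\<dots> = (\<integral>\<^sup>+y. \<integral>\<^sup>+x. ?c y * indicator (ball x t) y \<partial>H \<partial>M)"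
  proof (rule HM.Fubini'[symmetric])
    note measurable_indicator_ball(2)[OF id, of t, measurable]
    show "(\<lambda>(x, y). ?c y * indicator (ball x t) y) \<in> borel_measurable (H \<Otimes>\<^sub>M M)"
      unfolding case_prod_beta' by measurable
  qed
  also have "\<dots> \<le> (\<integral>\<^sup>+y. ennreal (C * D * (2 * D\<^sup>2) powr p) * ennreal (\<bar>o2 y\<bar> powr p) \<partial>M)"
  proof (rule nn_integral_mono)
    fix y
    let ?A = "{x \<in> space H. dist x y < t}"
    have A: "?A \<in> sets H"
    proof -
      have "ball y t \<in> sets borel" by simp
      from measurable_sets[OF id this] show ?thesis
        by (rule back_subst[of "\<lambda>A. A \<in> sets H"]) (auto simp: dist_commute)
    qed
    have "(\<integral>\<^sup>+x. ?c y * indicator (ball x t) y \<partial>H) = (\<integral>\<^sup>+x. ?c y * indicator ?A x \<partial>H)"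
      by (intro nn_integral_cong) (auto split: split_indicator)
    also have "\<dots> = ?c y * emeasure H ?A" using A by (rule nn_integral_cmult_indicator)
    also have "\<dots> \<le> ?c y * ennreal (C * m y)" unfolding m_def by (intro mult_left_mono upper) simp
    also have "\<dots> = ennreal (C * D * (2 * D\<^sup>2) powr p) * ennreal (\<bar>o2 y\<bar> powr p)"
      using m[of y] o_nonneg[of y] D_ge_1 C by (simp add: ennreal_mult[symmetric] powr_mult)
    finally show "(\<integral>\<^sup>+x. ?c y * indicator (ball x t) y \<partial>H) \<le>
        ennreal (C * D * (2 * D\<^sup>2) powr p) * ennreal (\<bar>o2 y\<bar> powr p)" .
  qed
  also have "\<dots> = ennreal (C * D * (2 * D\<^sup>2) powr p) * (\<integral>\<^sup>+y. ennreal (\<bar>o2 y\<bar> powr p) \<partial>M)"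
    by (rule nn_integral_cmult) measurable
  finally show ?thesis by (simp add: o1_def o2_def)
qed

lemma Lp_norm_oscillation_le:
  assumes H: "sigma_finite_measure H" and id: "(\<lambda>x. x) \<in> H \<rightarrow>\<^sub>M borel"
    and p: "1 \<le> p" and f: "f \<in> L1_loc M" and t: "0 < t" "2 * t \<le> 1" and C: "0 \<le> C"
    and upper: "\<And>y. emeasure H {x \<in> space H. dist x y < t} \<le> ennreal (C * measure M (ball y t))"
  shows "Lp_norm p H (mean_oscillation M t f) \<le>
    ennreal ((C * D * (2 * D\<^sup>2) powr p) powr (1 / p)) * Lp_norm p M (mean_oscillation M (2 * t) f)"
proof -
  define K where "K = C * D * (2 * D\<^sup>2) powr p"
  have K: "0 \<le> K" using C D_ge_1 by (simp add: K_def)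
  show ?thesis unfolding K_def[symmetric]
  proof (cases "Lp_norm p M (mean_oscillation M (2 * t) f)")
    case (real c)
    have "(\<integral>\<^sup>+x. ennreal (\<bar>mean_oscillation M t f x\<bar> powr p) \<partial>H) \<le>
        ennreal K * (\<integral>\<^sup>+y. ennreal (\<bar>mean_oscillation M (2 * t) f y\<bar> powr p) \<partial>M)"
      unfolding K_def by (rule nn_integral_oscillation_powr_le[OF assms])
    also have "\<dots> \<le> ennreal K * ennreal (c powr p)"
      using Lp_norm_le_iff[OF p real(1), of M "mean_oscillation M (2 * t) f"] real(2)
      by (intro mult_left_mono) auto
    also have "\<dots> = ennreal ((K powr (1 / p) * c) powr p)"
      using K p by (simp add: powr_mult powr_powr ennreal_mult)
    finally have "Lp_norm p H (mean_oscillation M t f) \<le> ennreal (K powr (1 / p) * c)"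
      using real by (subst Lp_norm_le_iff[OF p]) auto
    then show "Lp_norm p H (mean_oscillation M t f) \<le>
        ennreal (K powr (1 / p)) * Lp_norm p M (mean_oscillation M (2 * t) f)"
      using real by (simp add: ennreal_mult)
  next
    case top
    show "Lp_norm p H (mean_oscillation M t f) \<le>
        ennreal (K powr (1 / p)) * Lp_norm p M (mean_oscillation M (2 * t) f)"
    proof (cases "K = 0")
      case True
      have "(\<integral>\<^sup>+x. ennreal (\<bar>mean_oscillation M t f x\<bar> powr p) \<partial>H) \<le>
          ennreal K * (\<integral>\<^sup>+y. ennreal (\<bar>mean_oscillation M (2 * t) f y\<bar> powr p) \<partial>M)"
        unfolding K_def by (rule nn_integral_oscillation_powr_le[OF assms])
      then have "Lp_norm p H (mean_oscillation M t f) \<le> ennreal 0"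
        using True p by (subst Lp_norm_le_iff[OF p]) auto
      then show ?thesis by simp
    next
      case False
      then show ?thesis using top K by (simp add: ennreal_mult_top)
    qed
  qed
qed

text \<open>Up to constants, the part of the Besov norm that stems from the radii in \<open>[t, 2 t)\<close>, where \<open>t = dyadic j\<close>.\<close>

definition dyadic_besov :: "real \<Rightarrow> real \<Rightarrow> nat \<Rightarrow> ('a \<Rightarrow> real) \<Rightarrow> ennreal" where
  "dyadic_besov s p j f = ennreal (dyadic j powr (- s)) * Lp_norm p M (mean_oscillation M (dyadic j) f)"

text \<open>
  Averages over successive dyadic balls differ by at most an oscillation. Passing from \<open>H\<close> to \<open>M\<close> doubles the
  radius, which is why the averages are taken one scale below the oscillations.
\<close>

lemma Lp_norm_dyadic_average_diff_le:
  assumes H: "sigma_finite_measure H" and id: "(\<lambda>x. x) \<in> H \<rightarrow>\<^sub>M borel"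
    and p: "1 \<le> p" and f: "f \<in> L1_loc M" and C: "0 \<le> C"
    and upper: "\<And>t y. 0 < t \<Longrightarrow> 2 * t \<le> 1 \<Longrightarrow>
      emeasure H {x \<in> space H. dist x y < t} \<le> ennreal (C * t powr (- \<theta>) * measure M (ball y t))"
    and km: "k \<le> m"
  shows "Lp_norm p H (\<lambda>x. average M (ball x (dyadic (Suc m))) f - average M (ball x (dyadic (Suc k))) f)
    \<le> ennreal (D * (C * D * (2 * D\<^sup>2) powr p) powr (1 / p) * 2 powr (\<theta> / p)) *
      (\<Sum>j=k..<m. dyadic_besov (\<theta> / p) p j f)"
proof -
  define A where "A j x = average M (ball x (dyadic j)) f" for j x
  define B where "B = (C * D * (2 * D\<^sup>2) powr p) powr (1 / p)"
  have osc_H: "mean_oscillation M t f \<in> borel_measurable H" for t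
    using measurable_comp[OF id measurable_mean_oscillation[of f t]] f by (simp add: L1_locD comp_def)
  have A_H: "A j \<in> borel_measurable H" for j
    using measurable_comp[OF id measurable_ball_average[of f "dyadic j"]] f by (simp add: L1_locD A_def[abs_def] comp_def)
  have half_powr: "(a / 2) powr (- q) = 2 powr q * a powr (- q)" for a q :: real
  proof -
    have "(a / 2) powr (- q) = a powr (- q) / 2 powr (- q)" by (rule powr_divide)
    also have "2 powr (- q) = 1 / 2 powr q" by (rule powr_minus_divide)
    finally show ?thesis by simp
  qed
  have step: "Lp_norm p H (\<lambda>x. A (Suc (Suc j)) x - A (Suc j) x)
      \<le> ennreal (D * B * 2 powr (\<theta> / p)) * dyadic_besov (\<theta> / p) p j f" for j
  proof -
    let ?t = "dyadic (Suc j)"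
    have pw: "\<bar>A (Suc (Suc j)) x - A (Suc j) x\<bar> \<le> D * mean_oscillation M ?t f x" for x
      unfolding A_def
    proof (rule average_diff_le_oscillation[OF f])
      show "measure M (ball x ?t) \<le> D * measure M (ball x (dyadic (Suc (Suc j))))"
        using doubling[of "dyadic (Suc (Suc j))" x] dyadic_bounds[of "Suc (Suc j)"] dyadic_bounds(2)[of "Suc j"] by simp
    qed (auto intro!: subset_ball)
    have "Lp_norm p H (\<lambda>x. A (Suc (Suc j)) x - A (Suc j) x) \<le> Lp_norm p H (\<lambda>x. D * mean_oscillation M ?t f x)"
      using pw by (intro Lp_norm_mono_AE p AE_I2) (metis abs_ge_self order_trans)
    also have "\<dots> = ennreal D * Lp_norm p H (mean_oscillation M ?t f)"
      using D_ge_1 by (subst Lp_norm_scale[OF p osc_H]) simp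
    also have "\<dots> \<le> ennreal D * (ennreal ((C * ?t powr (- \<theta>) * D * (2 * D\<^sup>2) powr p) powr (1 / p)) *
        Lp_norm p M (mean_oscillation M (2 * ?t) f))"
      using dyadic_bounds[of "Suc j"] C
      by (intro mult_left_mono Lp_norm_oscillation_le[OF H id p f _ _ _ upper]) auto
    also have "(C * ?t powr (- \<theta>) * D * (2 * D\<^sup>2) powr p) powr (1 / p) = B * (2 powr (\<theta> / p) * dyadic j powr (- (\<theta> / p)))"
    proof -
      have "C * ?t powr (- \<theta>) * D * (2 * D\<^sup>2) powr p = (C * D * (2 * D\<^sup>2) powr p) * ?t powr (- \<theta>)" by simp
      then have "(C * ?t powr (- \<theta>) * D * (2 * D\<^sup>2) powr p) powr (1 / p) = B * ?t powr (- (\<theta> / p))"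
        by (simp only: powr_mult powr_powr B_def) simp
      also have "?t powr (- (\<theta> / p)) = 2 powr (\<theta> / p) * dyadic j powr (- (\<theta> / p))"
        using half_powr[of "dyadic j"] by simp
      finally show ?thesis .
    qed
    also have "2 * ?t = dyadic j" by simp
    also have "ennreal D * (ennreal (B * (2 powr (\<theta> / p) * dyadic j powr (- (\<theta> / p)))) * Lp_norm p M (mean_oscillation M (dyadic j) f))
        = ennreal (D * B * 2 powr (\<theta> / p)) * dyadic_besov (\<theta> / p) p j f"
      using D_ge_1 by (simp add: dyadic_besov_def B_def ennreal_mult mult_ac)
    finally show ?thesis .
  qed
  have tele: "(\<lambda>x. A (Suc m) x - A (Suc k) x) = (\<lambda>x. \<Sum>j\<in>{k..<m}. A (Suc (Suc j)) x - A (Suc j) x)"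
    using sum_Suc_diff'[OF km, of "\<lambda>j. A (Suc j) _"] by auto
  have "Lp_norm p H (\<lambda>x. A (Suc m) x - A (Suc k) x)
      \<le> (\<Sum>j=k..<m. Lp_norm p H (\<lambda>x. A (Suc (Suc j)) x - A (Suc j) x))"
    unfolding tele using A_H by (intro Lp_norm_sum_le p) auto
  also have "\<dots> \<le> (\<Sum>j=k..<m. ennreal (D * B * 2 powr (\<theta> / p)) * dyadic_besov (\<theta> / p) p j f)"
    by (intro sum_mono step)
  finally show ?thesis by (simp add: sum_distrib_left A_def B_def)
qed

text \<open>
  Up to a constant, the oscillation at a dyadic radius \<open>t\<close> is at most the oscillation at every radius in
  \<open>[t, 2 t)\<close>, and these intervals are disjoint subsets of \<open>(0, 1)\<close>. The integral
  computed here is that of a step function below the integrand of the Besov norm.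
\<close>

lemma sum_dyadic_besov_le:
  assumes p: "1 \<le> p" and s: "0 < s" and f: "f \<in> L1_loc M"
  shows "(\<Sum>j<K. dyadic_besov s p j f) \<le> ennreal (2 * D * 2 powr (s + 1)) * besov_norm s p M f"
proof -
  define I where "I j = {dyadic j..<2 * dyadic j}" for j
  define G where "G t = ennreal (t powr (- s)) * Lp_norm p M (mean_oscillation M t f) * ennreal (1 / t)" for t
  define c where "c = 2 * D * 2 powr (s + 1)"
  have c: "0 < c" using D_ge_1 by (simp add: c_def)
  have osc_M: "mean_oscillation M t f \<in> borel_measurable M" for t
    using f by (intro borel_measurable_M measurable_mean_oscillation L1_locD)
  have assoc3: "ennreal a * (ennreal b * (ennreal d * L)) = ennreal (a * b * d) * L"
    if "0 \<le> a" "0 \<le> b" "0 \<le> d" for a b d L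
    using that by (simp add: ennreal_mult mult.assoc)
  have assoc2: "ennreal (a * (b * d)) * L = ennreal a * (ennreal b * L * ennreal d)"
    if "0 \<le> a" "0 \<le> b" "0 \<le> d" for a b d L
    using that by (simp add: ennreal_mult mult_ac)
  have cancel: "ennreal (1 / d) * L * ennreal d = L" if "0 < d" for d L
  proof -
    have "ennreal (1 / d) * L * ennreal d = ennreal (1 / d * d) * L"
      using that by (simp only: ennreal_mult less_imp_le zero_le_divide_1_iff mult_ac)
    then show ?thesis using that by simp
  qed
  \<comment> \<open>The integrand of the Besov norm dominates a constant on each of the intervals \<open>I j\<close>, which have length \<open>dyadic j\<close>.\<close>
  have lower: "ennreal (1 / dyadic j) * dyadic_besov s p j f \<le> ennreal c * G t" if t: "t \<in> I j" for j t
  proof -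
    have tpos: "0 < t" "dyadic j \<le> t" "t \<le> 2 * dyadic j" using t dyadic_bounds(1)[of j] by (auto simp: I_def)
    have "mean_oscillation M (dyadic j) f x \<le> 2 * D * mean_oscillation M t f x" for x
    proof (rule oscillation_le_oscillation[OF f])
      have "measure M (ball x t) \<le> measure M (ball x (2 * dyadic j))"
        using tpos dyadic_bounds(1)[of j] by (intro measure_ball_mono subset_ball) auto
      also have "\<dots> \<le> D * measure M (ball x (dyadic j))"
        using dyadic_bounds[of j] by (intro doubling) auto
      finally show "measure M (ball x t) \<le> D * measure M (ball x (dyadic j))" .
      show "ball x (dyadic j) \<subseteq> ball x t" using tpos by (intro subset_ball)
    qed (use tpos in auto)
    then have "Lp_norm p M (mean_oscillation M (dyadic j) f) \<le> Lp_norm p M (\<lambda>x. 2 * D * mean_oscillation M t f x)"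
      using mean_oscillation_nonneg D_ge_1
      by (intro Lp_norm_mono_AE p AE_I2) (simp add: abs_of_nonneg)
    also have "\<dots> = ennreal (2 * D) * Lp_norm p M (mean_oscillation M t f)"
      using D_ge_1 by (subst Lp_norm_scale[OF p osc_M]) simp
    finally have le: "Lp_norm p M (mean_oscillation M (dyadic j) f) \<le> ennreal (2 * D) * Lp_norm p M (mean_oscillation M t f)" .
    have scal: "1 / dyadic j * dyadic j powr (- s) * (2 * D) \<le> c * (t powr (- s) * (1 / t))"
    proof -
      have "(2 * dyadic j) powr (- (s + 1)) \<le> t powr (- (s + 1))"
        using tpos s by (intro powr_mono2') auto
      moreover have "(2 * dyadic j) powr (- (s + 1)) = 2 powr (- (s + 1)) * (dyadic j powr (- s) / dyadic j)"
        using dyadic_bounds(1)[of j] by (subst powr_mult) (simp add: powr_diff)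
      moreover have "t powr (- (s + 1)) = t powr (- s) * (1 / t)"
        using tpos powr_diff[of t "-s" 1] by simp
      ultimately have le: "2 powr (- (s + 1)) * (dyadic j powr (- s) / dyadic j) \<le> t powr (- s) * (1 / t)" by simp
      have "c * (2 powr (- (s + 1)) * (dyadic j powr (- s) / dyadic j)) \<le> c * (t powr (- s) * (1 / t))"
        using le c by (intro mult_left_mono) auto
      moreover have "c * 2 powr (- (s + 1)) = 2 * D"
        using powr_add[of 2 "s + 1" "- (s + 1)"] by (simp add: c_def)
      ultimately have "2 * D * (dyadic j powr (- s) / dyadic j) \<le> c * (t powr (- s) * (1 / t))"
        by (simp only: mult.assoc[symmetric])
      moreover have "1 / d * e * (2 * D) = 2 * D * (e / d)" for d e :: real by simp
      ultimately show ?thesis by (simp only:)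
    qed
    have "ennreal (1 / dyadic j) * dyadic_besov s p j f
        \<le> ennreal (1 / dyadic j) * (ennreal (dyadic j powr (- s)) * (ennreal (2 * D) * Lp_norm p M (mean_oscillation M t f)))"
      unfolding dyadic_besov_def by (intro mult_left_mono le) auto
    also have "\<dots> = ennreal (1 / dyadic j * dyadic j powr (- s) * (2 * D)) * Lp_norm p M (mean_oscillation M t f)"
      using D_ge_1 by (intro assoc3) auto
    also have "\<dots> \<le> ennreal (c * (t powr (- s) * (1 / t))) * Lp_norm p M (mean_oscillation M t f)"
      by (intro mult_right_mono ennreal_leI scal) auto
    also have "\<dots> = ennreal c * G t"
      unfolding G_def using c tpos by (intro assoc2) auto
    finally show ?thesis .
  qed
  have [measurable]: "I j \<in> sets borel" for j by (simp add: I_def)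
  have disj: "disjoint_family I"
  proof -
    have ordered: "I i \<inter> I j = {}" if "i < j" for i j
    proof -
      have "2 * dyadic j \<le> dyadic i"
        using that power_decreasing[of "Suc i" j "1 / 2 :: real"] by simp
      then show ?thesis by (auto simp: I_def)
    qed
    have "I i \<inter> I j = {}" if "i \<noteq> j" for i j
      using that ordered[of i j] ordered[of j i] by (cases i j rule: linorder_cases) blast+
    then show ?thesis by (simp add: disjoint_family_on_def)
  qed
  have "(\<Sum>j<K. dyadic_besov s p j f) = (\<Sum>j<K. \<integral>\<^sup>+t. ennreal (1 / dyadic j) * dyadic_besov s p j f * indicator (I j) t \<partial>lborel)"
  proof (rule sum.cong[OF refl])
    fix j
    have "(\<integral>\<^sup>+t. ennreal (1 / dyadic j) * dyadic_besov s p j f * indicator (I j) t \<partial>lborel)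
        = ennreal (1 / dyadic j) * dyadic_besov s p j f * ennreal (dyadic j)"
      using dyadic_bounds(1)[of j] by (subst nn_integral_cmult_indicator) (auto simp: I_def)
    also have "\<dots> = dyadic_besov s p j f"
      by (rule cancel[OF dyadic_bounds(1)])
    finally show "dyadic_besov s p j f = (\<integral>\<^sup>+t. ennreal (1 / dyadic j) * dyadic_besov s p j f * indicator (I j) t \<partial>lborel)" by simp
  qed
  also have "\<dots> = (\<integral>\<^sup>+t. (\<Sum>j<K. ennreal (1 / dyadic j) * dyadic_besov s p j f * indicator (I j) t) \<partial>lborel)"
    by (rule nn_integral_sum[symmetric]) measurable
  finally have eq: "(\<Sum>j<K. dyadic_besov s p j f) =
    (\<integral>\<^sup>+t. (\<Sum>j<K. ennreal (1 / dyadic j) * dyadic_besov s p j f * indicator (I j) t) \<partial>lborel)" .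
  have "ennreal (1 / c) * (\<Sum>j<K. dyadic_besov s p j f)
    = (\<integral>\<^sup>+t. ennreal (1 / c) * (\<Sum>j<K. ennreal (1 / dyadic j) * dyadic_besov s p j f * indicator (I j) t) \<partial>lborel)"
    unfolding eq by (rule nn_integral_cmult[symmetric]) measurable
  also have "\<dots> \<le> (\<integral>\<^sup>+t\<in>{0<..<1}. G t \<partial>lborel)"
  proof (rule nn_integral_mono)
    fix t :: real
    have "(\<Sum>j<K. ennreal (1 / dyadic j) * dyadic_besov s p j f * indicator (I j) t) \<le> ennreal c * (G t * indicator {0<..<1} t)"
    proof (cases "\<exists>j<K. t \<in> I j")
      case True
      then obtain j where j: "j < K" "t \<in> I j" by blast
      have other: "i = j" if "t \<in> I i" for i
        using disjoint_family_onD[OF disj, of i j] that j(2) by blast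
      have "(\<Sum>i<K. ennreal (1 / dyadic i) * dyadic_besov s p i f * indicator (I i) t)
          = (\<Sum>i<K. if i = j then ennreal (1 / dyadic j) * dyadic_besov s p j f else 0)"
      proof (rule sum.cong[OF refl])
        fix i
        show "ennreal (1 / dyadic i) * dyadic_besov s p i f * indicator (I i) t
            = (if i = j then ennreal (1 / dyadic j) * dyadic_besov s p j f else 0)"
        proof (cases "i = j")
          case False
          with other have "t \<notin> I i" by blast
          with False show ?thesis by simp
        qed (use j(2) in simp)
      qed
      also have "\<dots> = ennreal (1 / dyadic j) * dyadic_besov s p j f" using j(1) by simp
      also have "\<dots> \<le> ennreal c * G t" by (rule lower[OF j(2)])
      also have "t \<in> {0<..<1}" using j(2) dyadic_bounds(1,3)[of j] by (auto simp: I_def)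
      then have "ennreal c * G t = ennreal c * (G t * indicator {0<..<1} t)" by simp
      finally show ?thesis .
    next
      case False
      then show ?thesis by (auto intro!: sum_nonpos)
    qed
    then have "ennreal (1 / c) * (\<Sum>j<K. ennreal (1 / dyadic j) * dyadic_besov s p j f * indicator (I j) t)
        \<le> ennreal (1 / c) * (ennreal c * (G t * indicator {0<..<1} t))" by (rule mult_left_mono) simp
    also have "\<dots> = G t * indicator {0<..<1} t"
      using c by (simp add: mult.assoc[symmetric] ennreal_mult[symmetric])
    finally show "ennreal (1 / c) * (\<Sum>j<K. ennreal (1 / dyadic j) * dyadic_besov s p j f * indicator (I j) t)
        \<le> G t * indicator {0<..<1} t" .
  qed
  also have "\<dots> \<le> besov_norm s p M f" by (simp add: besov_norm_def G_def add_increasing)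
  finally have "ennreal c * (ennreal (1 / c) * (\<Sum>j<K. dyadic_besov s p j f)) \<le> ennreal c * besov_norm s p M f"
    by (rule mult_left_mono) simp
  then show ?thesis using c by (simp add: mult.assoc[symmetric] ennreal_mult[symmetric] c_def[symmetric])
qed

end

section \<open>Dyadic Besov seminorms and traces\<close>

context doubling_space
begin

lemma L1_loc_add: "f \<in> L1_loc M \<Longrightarrow> g \<in> L1_loc M \<Longrightarrow> (\<lambda>x. f x + g x) \<in> L1_loc M"
  by (auto simp: L1_loc_def intro: set_integral_add(1))

lemma L1_loc_scale: "f \<in> L1_loc M \<Longrightarrow> (\<lambda>x. a * f x) \<in> L1_loc M"
  by (auto simp: L1_loc_def)

lemma average_add:
  assumes "f \<in> L1_loc M" "g \<in> L1_loc M" "0 < r"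
  shows "average M (ball x r) (\<lambda>y. f y + g y) = average M (ball x r) f + average M (ball x r) g"
  using assms by (simp add: average_def set_integral_add(2)[OF L1_locD(2) L1_locD(2)] distrib_left)

lemma average_scale: "average M B (\<lambda>y. a * f y) = a * average M B f"
  by (simp add: average_def)

lemma average_cong_AE:
  assumes "f \<in> borel_measurable M" "g \<in> borel_measurable M" "AE x in M. f x = g x" "B \<in> sets M"
  shows "average M B f = average M B g"
  unfolding average_def
  using assms by (intro arg_cong2[where f = "(*)"] refl set_lebesgue_integral_cong_AE) auto

lemma mean_oscillation_cong_AE:
  assumes "f \<in> borel_measurable M" "g \<in> borel_measurable M" "AE x in M. f x = g x"
  shows "mean_oscillation M t f = mean_oscillation M t g"
proof
  fix x
  have a: "average M (ball x t) f = average M (ball x t) g"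
    using assms by (intro average_cong_AE) (auto simp: ball_sets)
  show "mean_oscillation M t f x = mean_oscillation M t g x"
    unfolding mean_oscillation_def a using assms
    by (intro average_cong_AE) (auto simp: ball_sets)
qed

lemma mean_oscillation_add_le:
  assumes f: "f \<in> L1_loc M" and g: "g \<in> L1_loc M" and t: "0 < t"
  shows "mean_oscillation M t (\<lambda>y. f y + g y) x \<le> mean_oscillation M t f x + mean_oscillation M t g x"
proof -
  define a b where "a = average M (ball x t) f" and "b = average M (ball x t) g"
  have pos: "0 < measure M (ball x t)" using t by (rule measure_ball_pos)
  have "(LINT y:ball x t|M. \<bar>f y + g y - (a + b)\<bar>) \<le> (LINT y:ball x t|M. \<bar>f y - a\<bar> + \<bar>g y - b\<bar>)"
    by (intro set_integral_mono set_integral_add(1) set_integrable_abs_diff L1_loc_add f g t) auto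
  also have "\<dots> = (LINT y:ball x t|M. \<bar>f y - a\<bar>) + (LINT y:ball x t|M. \<bar>g y - b\<bar>)"
    by (intro set_integral_add(2) set_integrable_abs_diff f g t)
  finally have le: "(LINT y:ball x t|M. \<bar>f y + g y - (a + b)\<bar>)
    \<le> (LINT y:ball x t|M. \<bar>f y - a\<bar>) + (LINT y:ball x t|M. \<bar>g y - b\<bar>)" .
  have "mean_oscillation M t (\<lambda>y. f y + g y) x = (1 / measure M (ball x t)) * (LINT y:ball x t|M. \<bar>f y + g y - (a + b)\<bar>)"
    unfolding mean_oscillation_def average_add[OF f g t] a_def b_def by (simp only: average_def)
  also have "\<dots> \<le> (1 / measure M (ball x t)) * ((LINT y:ball x t|M. \<bar>f y - a\<bar>) + (LINT y:ball x t|M. \<bar>g y - b\<bar>))"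
    using le pos by (intro mult_left_mono) auto
  also have "\<dots> = mean_oscillation M t f x + mean_oscillation M t g x"
    unfolding mean_oscillation_def a_def b_def by (simp only: average_def distrib_left)
  finally show ?thesis .
qed

lemma mean_oscillation_scale: "mean_oscillation M t (\<lambda>y. a * f y) x = \<bar>a\<bar> * mean_oscillation M t f x"
  unfolding mean_oscillation_def average_scale
  by (simp add: average_scale[symmetric] abs_mult[symmetric] right_diff_distrib)

lemma mean_oscillation_measurable: "f \<in> L1_loc M \<Longrightarrow> mean_oscillation M t f \<in> borel_measurable M"
  by (intro borel_measurable_M measurable_mean_oscillation L1_locD)

lemma dyadic_besov_add:
  assumes p: "1 \<le> p" and f: "f \<in> L1_loc M" and g: "g \<in> L1_loc M"
  shows "dyadic_besov s p j (\<lambda>x. f x + g x) \<le> dyadic_besov s p j f + dyadic_besov s p j g"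
proof -
  have "Lp_norm p M (mean_oscillation M (dyadic j) (\<lambda>x. f x + g x))
      \<le> Lp_norm p M (\<lambda>x. mean_oscillation M (dyadic j) f x + mean_oscillation M (dyadic j) g x)"
    using mean_oscillation_add_le[OF f g dyadic_bounds(1)[of j]]
    by (intro Lp_norm_mono_AE p AE_I2) (simp add: mean_oscillation_nonneg abs_of_nonneg add_nonneg_nonneg)
  also have "\<dots> \<le> Lp_norm p M (mean_oscillation M (dyadic j) f) + Lp_norm p M (mean_oscillation M (dyadic j) g)"
    by (intro Lp_norm_triangle p mean_oscillation_measurable f g)
  finally show ?thesis
    unfolding dyadic_besov_def distrib_left[symmetric] by (rule mult_left_mono) simp
qed

lemma dyadic_besov_scale:
  assumes p: "1 \<le> p" and f: "f \<in> L1_loc M"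
  shows "dyadic_besov s p j (\<lambda>x. a * f x) = ennreal \<bar>a\<bar> * dyadic_besov s p j f"
proof -
  have "mean_oscillation M (dyadic j) (\<lambda>x. a * f x) = (\<lambda>x. \<bar>a\<bar> * mean_oscillation M (dyadic j) f x)"
    by (rule ext) (rule mean_oscillation_scale)
  then have "Lp_norm p M (mean_oscillation M (dyadic j) (\<lambda>x. a * f x)) = ennreal \<bar>a\<bar> * Lp_norm p M (mean_oscillation M (dyadic j) f)"
    using Lp_norm_scale[OF p mean_oscillation_measurable[OF f], of "\<bar>a\<bar>" "dyadic j"] by simp
  then show ?thesis unfolding dyadic_besov_def by (simp only: mult.left_commute)
qed

lemma dyadic_besov_cong_AE:
  assumes "f \<in> L1_loc M" "g \<in> L1_loc M" "AE x in M. f x = g x"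
  shows "dyadic_besov s p j f = dyadic_besov s p j g"
  using mean_oscillation_cong_AE[OF L1_locD(1)[OF assms(1)] L1_locD(1)[OF assms(2)] assms(3)]
  by (simp add: dyadic_besov_def)

text \<open>
  From the pointwise bound \<open>f \<le> c + c\<^sup>1\<^sup>-\<^sup>p \<bar>f\<bar>\<^sup>p\<close>, a substitute for Hoelder's inequality. The bound is linear
  in \<open>c\<close>, which is all that boundedness of the averaging functional requires.
\<close>

lemma average_le_of_Lp_norm:
  assumes p: "1 \<le> p" and f: "f \<in> L1_loc M" and c: "0 < c" "Lp_norm p M f \<le> ennreal c" and r: "0 < r"
  shows "average M (ball x r) f \<le> c * (1 + 1 / measure M (ball x r))"
proof -
  have pos: "0 < measure M (ball x r)" using r by (rule measure_ball_pos)
  have [measurable]: "f \<in> borel_measurable M" using f by (rule L1_locD)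
  have [measurable]: "ball x r \<in> sets M" by (rule ball_sets)
  have nn: "(\<integral>\<^sup>+y. ennreal (\<bar>f y\<bar> powr p) \<partial>M) \<le> ennreal (c powr p)"
    using c by (simp add: Lp_norm_le_iff[OF p])
  then have int: "integrable M (\<lambda>y. \<bar>f y\<bar> powr p)"
    by (intro integrableI_bounded) (auto intro: le_less_trans)
  have "ennreal (\<integral>y. \<bar>f y\<bar> powr p \<partial>M) \<le> ennreal (c powr p)"
    using nn nn_integral_eq_integral[OF int] by simp
  then have le: "(\<integral>y. \<bar>f y\<bar> powr p \<partial>M) \<le> c powr p" by simp
  have setint: "set_integrable M (ball x r) (\<lambda>y. \<bar>f y\<bar> powr p)"
    unfolding set_integrable_def
  proof (rule Bochner_Integration.integrable_bound[OF int])
    show "(\<lambda>y. indicator (ball x r) y *\<^sub>R \<bar>f y\<bar> powr p) \<in> borel_measurable M" by measurable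
  qed (auto split: split_indicator)
  have pw: "f y \<le> c + c powr (1 - p) * \<bar>f y\<bar> powr p" for y
  proof (cases "f y \<le> c")
    case False
    then have "1 \<le> (f y / c) powr (p - 1)" using c p by (intro ge_one_powr_ge_zero) auto
    then have "f y * 1 \<le> f y * (f y / c) powr (p - 1)" using False c by (intro mult_left_mono) auto
    also have "\<dots> = c powr (1 - p) * \<bar>f y\<bar> powr p"
    proof -
      have "(f y / c) powr (p - 1) = f y powr (p - 1) * c powr (1 - p)"
        using powr_minus_divide[of c "p - 1"] by (simp add: powr_divide)
      moreover have "f y * f y powr (p - 1) = f y powr p"
        using False c powr_mult_base[of "f y" "p - 1"] by simp
      ultimately show ?thesis using False c by (simp add: mult.assoc[symmetric] mult.commute)
    qed
    finally show ?thesis using c by simp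
  qed (simp add: add_increasing2)
  have "(LINT y:ball x r|M. f y) \<le> (LINT y:ball x r|M. c + c powr (1 - p) * \<bar>f y\<bar> powr p)"
    using f r by (intro set_integral_mono set_integral_add(1) set_integrable_const set_integrable_mult_right setint L1_locD pw) auto
  also have "\<dots> = (LINT y:ball x r|M. c) + c powr (1 - p) * (LINT y:ball x r|M. \<bar>f y\<bar> powr p)"
    using r by (subst set_integral_add(2)) (auto intro: set_integrable_const setint)
  also have "(LINT y:ball x r|M. c) = measure M (ball x r) * c"
    using ball(2)[OF r, of x] by (subst set_integral_const) (auto simp: ball_sets)
  also have "(LINT y:ball x r|M. \<bar>f y\<bar> powr p) \<le> c powr p"
  proof -
    have "(LINT y:ball x r|M. \<bar>f y\<bar> powr p) \<le> (\<integral>y. \<bar>f y\<bar> powr p \<partial>M)"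
      unfolding set_lebesgue_integral_def
      using setint int by (intro integral_mono) (auto simp: set_integrable_def split: split_indicator)
    with le show ?thesis by simp
  qed
  finally have "(LINT y:ball x r|M. f y) \<le> measure M (ball x r) * c + c powr (1 - p) * c powr p"
    by (simp add: mult_left_mono)
  also have "c powr (1 - p) * c powr p = c" using c by (simp add: powr_add[symmetric])
  finally show ?thesis using pos by (simp add: average_def field_simps)
qed

text \<open>
  The trace is the limit of the averages over dyadic balls. Fatou's lemma reduces its distance from a single
  average to the distances between averages.
\<close>

lemma Lp_norm_trace_minus_average_le:
  assumes H: "sigma_finite_measure H" and id: "(\<lambda>x. x) \<in> H \<rightarrow>\<^sub>M borel"
    and p: "1 \<le> p" and f: "f \<in> L1_loc M" and C: "0 \<le> C"
    and upper: "\<And>t y. 0 < t \<Longrightarrow> 2 * t \<le> 1 \<Longrightarrow>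
      emeasure H {x \<in> space H. dist x y < t} \<le> ennreal (C * t powr (- \<theta>) * measure M (ball y t))"
    and trace: "AE x in H. (\<lambda>m. average M (ball x (dyadic m)) f) \<longlonglongrightarrow> \<phi> x"
    and c: "0 \<le> c" "\<And>m. (\<Sum>j=k..<m. dyadic_besov (\<theta> / p) p j f) \<le> ennreal c"
  shows "Lp_norm p H (\<lambda>x. \<phi> x - average M (ball x (dyadic (Suc k))) f)
    \<le> ennreal (D * (C * D * (2 * D\<^sup>2) powr p) powr (1 / p) * 2 powr (\<theta> / p) * c)"
proof -
  define A where "A j x = average M (ball x (dyadic j)) f" for j x
  define B where "B = D * (C * D * (2 * D\<^sup>2) powr p) powr (1 / p) * 2 powr (\<theta> / p)"
  have B: "0 \<le> B" using D_ge_1 by (simp add: B_def)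
  have [measurable]: "A j \<in> borel_measurable H" for j
    using measurable_comp[OF id measurable_ball_average[of f "dyadic j"]] f by (simp add: L1_locD A_def[abs_def] comp_def)
  have bound: "(\<integral>\<^sup>+x. ennreal (\<bar>A (Suc m) x - A (Suc k) x\<bar> powr p) \<partial>H) \<le> ennreal ((B * c) powr p)" if "k \<le> m" for m
  proof -
    have "Lp_norm p H (\<lambda>x. A (Suc m) x - A (Suc k) x) \<le> ennreal B * (\<Sum>j=k..<m. dyadic_besov (\<theta> / p) p j f)"
      unfolding A_def B_def by (rule Lp_norm_dyadic_average_diff_le[OF H id p f C upper that])
    also have "\<dots> \<le> ennreal B * ennreal c" by (intro mult_left_mono c) simp
    also have "\<dots> = ennreal (B * c)" using B by (simp add: ennreal_mult')
    finally show ?thesis using B c by (subst (asm) Lp_norm_le_iff[OF p]) auto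
  qed
  have "(\<integral>\<^sup>+x. ennreal (\<bar>\<phi> x - A (Suc k) x\<bar> powr p) \<partial>H)
      = (\<integral>\<^sup>+x. liminf (\<lambda>m. ennreal (\<bar>A (Suc m) x - A (Suc k) x\<bar> powr p)) \<partial>H)"
  proof (rule nn_integral_cong_AE, rule eventually_mono[OF trace])
    fix x assume "(\<lambda>m. average M (ball x (dyadic m)) f) \<longlonglongrightarrow> \<phi> x"
    then have "(\<lambda>m. A (Suc m) x) \<longlonglongrightarrow> \<phi> x" unfolding A_def by (rule LIMSEQ_Suc)
    then have "(\<lambda>m. \<bar>A (Suc m) x - A (Suc k) x\<bar>) \<longlonglongrightarrow> \<bar>\<phi> x - A (Suc k) x\<bar>"
      by (intro tendsto_intros)
    then have "(\<lambda>m. \<bar>A (Suc m) x - A (Suc k) x\<bar> powr p) \<longlonglongrightarrow> \<bar>\<phi> x - A (Suc k) x\<bar> powr p"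
      using p by (intro tendsto_powr' tendsto_const) auto
    then have "(\<lambda>m. ennreal (\<bar>A (Suc m) x - A (Suc k) x\<bar> powr p)) \<longlonglongrightarrow> ennreal (\<bar>\<phi> x - A (Suc k) x\<bar> powr p)"
      by (rule tendsto_ennrealI)
    then show "ennreal (\<bar>\<phi> x - A (Suc k) x\<bar> powr p) = liminf (\<lambda>m. ennreal (\<bar>A (Suc m) x - A (Suc k) x\<bar> powr p))"
      by (intro lim_imp_Liminf[symmetric]) auto
  qed
  also have "\<dots> \<le> liminf (\<lambda>m. \<integral>\<^sup>+x. ennreal (\<bar>A (Suc m) x - A (Suc k) x\<bar> powr p) \<partial>H)"
    by (rule nn_integral_liminf) measurable
  also have "\<dots> \<le> limsup (\<lambda>m. \<integral>\<^sup>+x. ennreal (\<bar>A (Suc m) x - A (Suc k) x\<bar> powr p) \<partial>H)"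
    by (rule Liminf_le_Limsup) simp
  also have "\<dots> \<le> ennreal ((B * c) powr p)"
    by (rule Limsup_bounded) (use bound in \<open>auto simp: eventually_sequentially\<close>)
  finally show ?thesis
    using B c by (subst Lp_norm_le_iff[OF p]) (auto simp: A_def B_def)
qed

end

section \<open>The Hausdorff measure on a regular set\<close>

lemma emeasure_caratheodory_ball:
  assumes "metric_measure_space \<mu>"
  shows "emeasure (caratheodory_measure \<mu>) (ball x r) = \<mu> (ball x r)"
  using assms by (intro emeasure_caratheodory_measure) (auto simp: metric_measure_space_def)

lemma doubling_space_caratheodory:
  fixes \<mu> :: "'a::polish_space set \<Rightarrow> ennreal"
  assumes mm: "metric_measure_space \<mu>" and dbl: "uniformly_locally_doubling \<mu>"
  shows "\<exists>D. doubling_space (caratheodory_measure \<mu>) D"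
proof -
  obtain C where C: "0 < C" "\<And>x r. 0 < r \<Longrightarrow> r \<le> 1 \<Longrightarrow> \<mu> (ball x (2 * r)) \<le> ennreal C * \<mu> (ball x r)"
    using dbl unfolding uniformly_locally_doubling_def by (meson zero_less_one)
  have fin: "0 < \<mu> (ball x r)" "\<mu> (ball x r) < \<infinity>" if "0 < r" for x r
    using mm that by (auto simp: metric_measure_space_def)
  have "doubling_space (caratheodory_measure \<mu>) C"
  proof
    show "space (caratheodory_measure \<mu>) = UNIV"
      using mm by (intro space_caratheodory_measure) (simp add: metric_measure_space_def)
    show "sets borel \<subseteq> sets (caratheodory_measure \<mu>)"
      using mm by (simp add: metric_measure_space_def)
    fix x :: 'a and r :: real assume r: "0 < r"
    show "0 < emeasure (caratheodory_measure \<mu>) (ball x r)" "emeasure (caratheodory_measure \<mu>) (ball x r) < \<infinity>"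
      using fin[OF r] by (simp_all add: emeasure_caratheodory_ball[OF mm])
    assume "r \<le> 1"
    then have "enn2real (\<mu> (ball x (2 * r))) \<le> enn2real (ennreal C * \<mu> (ball x r))"
      using C r fin[OF r, of x] by (intro enn2real_mono) (auto simp: ennreal_mult_less_top)
    then show "measure (caratheodory_measure \<mu>) (ball x (2 * r)) \<le> C * measure (caratheodory_measure \<mu>) (ball x r)"
      using C by (simp add: measure_def emeasure_caratheodory_ball[OF mm] enn2real_mult)
  qed
  then show ?thesis ..
qed

text \<open>
  Regularity bounds the measure of balls centred on \<open>E\<close>. A ball with an arbitrary centre that meets \<open>A\<close> lies in
  a ball of twice the radius with centre in \<open>A\<close>, and doubling compares the two.
\<close>

lemma emeasure_codim_hausdorff_on_ball_le:
  fixes \<mu> :: "'a::polish_space set \<Rightarrow> ennreal"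
  assumes mm: "metric_measure_space \<mu>" and dbl: "doubling_space (caratheodory_measure \<mu>) D"
    and reg: "AD_codim_regular \<mu> \<theta> E" and \<theta>: "0 < \<theta>"
    and A: "A \<subseteq> E" "A \<in> sets (caratheodory_measure (codim_hausdorff \<mu> \<theta>))"
  shows "\<exists>C\<ge>0. \<forall>t y. 0 < t \<longrightarrow> 2 * t \<le> 1 \<longrightarrow> emeasure (codim_hausdorff_on \<mu> \<theta> A) {x \<in> space (codim_hausdorff_on \<mu> \<theta> A). dist x y < t}
    \<le> ennreal (C * t powr (- \<theta>) * measure (caratheodory_measure \<mu>) (ball y t))"
proof -
  interpret doubling_space "caratheodory_measure \<mu>" D by (rule dbl)
  let ?N = "caratheodory_measure (codim_hausdorff \<mu> \<theta>)"
  let ?m = "\<lambda>x r. measure (caratheodory_measure \<mu>) (ball x r)"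
  note outer = outer_measure_codim_hausdorff[of \<mu> \<theta>]
  have mono: "codim_hausdorff \<mu> \<theta> G \<le> codim_hausdorff \<mu> \<theta> H" if "G \<subseteq> H" for G H
    using outer that by (simp add: outer_measure_space_def increasing_def)
  obtain C where C: "0 < C" "\<And>x r. x \<in> E \<Longrightarrow> 0 < r \<Longrightarrow> r \<le> 1 \<Longrightarrow>
      codim_hausdorff \<mu> \<theta> (E \<inter> ball x r) \<le> ennreal C * (\<mu> (ball x r) / ennreal (r powr \<theta>))"
    using reg unfolding AD_codim_regular_def by (metis greaterThanAtMost_iff)
  have space: "space (codim_hausdorff_on \<mu> \<theta> A) = A"
    by (simp add: codim_hausdorff_on_def space_restrict_space space_caratheodory_measure[OF outer])
  have main: "codim_hausdorff \<mu> \<theta> (A \<inter> ball y t) \<le> ennreal (C * D\<^sup>2 * t powr (- \<theta>) * ?m y t)"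
    if t: "0 < t" "2 * t \<le> 1" for t y
  proof (cases "A \<inter> ball y t = {}")
    case True
    then show ?thesis using outer by (simp add: outer_measure_space_def positive_def)
  next
    case False
    then obtain z where z: "z \<in> A" "dist y z < t" by auto
    have "A \<inter> ball y t \<subseteq> E \<inter> ball z (2 * t)"
    proof
      fix w assume "w \<in> A \<inter> ball y t"
      then show "w \<in> E \<inter> ball z (2 * t)"
        using A z dist_triangle[of z w y] by (auto simp: dist_commute)
    qed
    then have "codim_hausdorff \<mu> \<theta> (A \<inter> ball y t) \<le> codim_hausdorff \<mu> \<theta> (E \<inter> ball z (2 * t))" by (rule mono)
    also have "\<dots> \<le> ennreal C * (\<mu> (ball z (2 * t)) / ennreal ((2 * t) powr \<theta>))"
      using z A t by (intro C) auto
    also have "\<mu> (ball z (2 * t)) = ennreal (?m z (2 * t))"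
      using emeasure_ball[of "2 * t" z] t by (simp add: emeasure_caratheodory_ball[OF mm])
    also have "ennreal C * (ennreal (?m z (2 * t)) / ennreal ((2 * t) powr \<theta>)) = ennreal (C * (?m z (2 * t) / (2 * t) powr \<theta>))"
      using C(1) t by (subst divide_ennreal) (auto simp: ennreal_mult[symmetric])
    also have "\<dots> \<le> ennreal (C * (D\<^sup>2 * ?m y t / t powr \<theta>))"
    proof (intro ennreal_leI mult_left_mono frac_le)
      have "ball z (2 * t) \<subseteq> ball y (4 * t)"
      proof
        fix w assume "w \<in> ball z (2 * t)"
        then show "w \<in> ball y (4 * t)" using z t dist_triangle[of y w z] by simp
      qed
      then have "?m z (2 * t) \<le> ?m y (4 * t)" using t by (intro measure_ball_mono) auto
      also have "\<dots> \<le> D\<^sup>2 * ?m y t" using t by (rule doubling_twice)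
      finally show "?m z (2 * t) \<le> D\<^sup>2 * ?m y t" .
      show "t powr \<theta> \<le> (2 * t) powr \<theta>" using t \<theta> by (intro powr_mono2) auto
    qed (use C t in auto)
    also have "C * (D\<^sup>2 * ?m y t / t powr \<theta>) = C * D\<^sup>2 * t powr (- \<theta>) * ?m y t"
      by (simp add: powr_minus_divide)
    finally show ?thesis .
  qed
  show ?thesis
  proof (intro exI[of _ "C * D\<^sup>2"] conjI allI impI)
    show "0 \<le> C * D\<^sup>2" using C by simp
    fix t y assume t: "0 < t" "2 * t \<le> (1::real)"
    have b: "A \<inter> ball y t \<in> sets ?N"
      using A borel_subset_codim_hausdorff[of \<mu> \<theta>] by (intro sets.Int) auto
    have "{x \<in> A. dist x y < t} = A \<inter> ball y t" by (auto simp: dist_commute)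
    moreover have "emeasure (codim_hausdorff_on \<mu> \<theta> A) (A \<inter> ball y t) = emeasure ?N (A \<inter> ball y t)"
      unfolding codim_hausdorff_on_def using A
      by (intro emeasure_restrict_space) (auto simp: space_caratheodory_measure[OF outer])
    moreover have "\<dots> = codim_hausdorff \<mu> \<theta> (A \<inter> ball y t)"
      using b by (rule emeasure_caratheodory_measure[OF outer])
    ultimately show "emeasure (codim_hausdorff_on \<mu> \<theta> A) {x \<in> space (codim_hausdorff_on \<mu> \<theta> A). dist x y < t}
        \<le> ennreal (C * D\<^sup>2 * t powr (- \<theta>) * ?m y t)"
      using main[OF t, of y] unfolding space by simp
  qed
qed

lemma Lp_norm_restrict_space_indicator:
  assumes "A \<in> sets N" "E \<in> sets N" "A \<subseteq> E"
  shows "Lp_norm p (restrict_space N E) (\<lambda>x. indicator A x * g x) = Lp_norm p (restrict_space N A) g"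
proof -
  have "(\<integral>\<^sup>+x. ennreal (\<bar>indicator A x * g x\<bar> powr p) \<partial>restrict_space N E)
      = (\<integral>\<^sup>+x. ennreal (\<bar>indicator A x * g x\<bar> powr p) * indicator E x \<partial>N)"
    using assms by (subst nn_integral_restrict_space) auto
  also have "\<dots> = (\<integral>\<^sup>+x. ennreal (\<bar>g x\<bar> powr p) * indicator A x \<partial>N)"
    using assms by (intro nn_integral_cong) (auto split: split_indicator)
  also have "\<dots> = (\<integral>\<^sup>+x. ennreal (\<bar>g x\<bar> powr p) \<partial>restrict_space N A)"
    using assms by (subst nn_integral_restrict_space) auto
  finally show ?thesis by (simp add: Lp_norm_def)
qed

lemma Lp_space_add:
  "1 \<le> p \<Longrightarrow> f \<in> Lp_space p M \<Longrightarrow> g \<in> Lp_space p M \<Longrightarrow> (\<lambda>x. f x + g x) \<in> Lp_space p M"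
  using Lp_norm_triangle[of p f M g] by (auto simp: Lp_space_def intro: le_less_trans)

lemma Lp_space_scale: "1 \<le> p \<Longrightarrow> f \<in> Lp_space p M \<Longrightarrow> (\<lambda>x. a * f x) \<in> Lp_space p M"
  by (auto simp: Lp_space_def Lp_norm_scale ennreal_mult_less_top)

lemma average_tendsto_of_trace:
  assumes "doubling_space M D" and f: "f \<in> L1_loc M"
    and lim: "((\<lambda>r. average M (ball x r) (\<lambda>y. \<bar>f y - c\<bar>)) \<longlongrightarrow> 0) (at_right 0)"
  shows "(\<lambda>m. average M (ball x (dyadic m)) f) \<longlonglongrightarrow> c"
proof -
  interpret doubling_space M D by fact
  have d0: "dyadic \<longlonglongrightarrow> 0" using LIMSEQ_Suc[OF LIMSEQ_power_zero[of "1 / 2 :: real"]] by simp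
  have "filterlim dyadic (at_right 0) sequentially"
    unfolding filterlim_at using d0 by auto
  from filterlim_compose[OF lim this]
  have "(\<lambda>m. average M (ball x (dyadic m)) (\<lambda>y. \<bar>f y - c\<bar>)) \<longlonglongrightarrow> 0" .
  then have "(\<lambda>m. average M (ball x (dyadic m)) f - c) \<longlonglongrightarrow> 0"
    by (rule Lim_null_comparison[rotated])
       (use abs_average_diff_le[OF f dyadic_bounds(1)] in \<open>auto intro!: always_eventually\<close>)
  then show ?thesis by (rule Lim_null[THEN iffD2])
qed

section \<open>Nonexistence of a bounded linear extension operator\<close>

theorem theorem1p2:
  fixes \<mu> :: "'a::polish_space set \<Rightarrow> ennreal" and p \<theta> :: real and E A :: "'a set"
  assumes "1 \<le> p" and "0 < \<theta>" and "\<theta> < p"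
    and "metric_measure_space \<mu>" and "admissible p \<mu>"
    and "AD_codim_regular \<mu> \<theta> E"
    and "A \<subseteq> E" and "A \<in> sets (caratheodory_measure (codim_hausdorff \<mu> \<theta>))"
    and "0 < codim_hausdorff \<mu> \<theta> A" and "codim_hausdorff \<mu> \<theta> A < \<infinity>"
    and "nonatomic (codim_hausdorff_on \<mu> \<theta> A)"
  shows "\<not> (\<exists>Ext. bounded_linear_extension \<mu> p \<theta> E Ext)"
proof
  assume "\<exists>Ext. bounded_linear_extension \<mu> p \<theta> E Ext"
  then obtain T where T: "bounded_linear_extension \<mu> p \<theta> E T" ..
  define M where "M = caratheodory_measure \<mu>"
  define N where "N = caratheodory_measure (codim_hausdorff \<mu> \<theta>)"
  define HE where "HE = codim_hausdorff_on \<mu> \<theta> E"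
  define HA where "HA = codim_hausdorff_on \<mu> \<theta> A"
  note p = assms(1)
  have s: "0 < \<theta> / p" using assms by simp
  note outer = outer_measure_codim_hausdorff[of \<mu> \<theta>]
  have space_N: "space N = UNIV" unfolding N_def by (rule space_caratheodory_measure[OF outer])
  have AN: "A \<in> sets N" using assms(8) by (simp add: N_def)
  have EN: "E \<in> sets N"
    using assms(6) borel_subset_codim_hausdorff[of \<mu> \<theta>] by (auto simp: AD_codim_regular_def N_def)
  have HE: "HE = restrict_space N E" and HA: "HA = restrict_space N A"
    by (simp_all add: HE_def HA_def N_def codim_hausdorff_on_def)
  have space_HA: "space HA = A" by (simp add: HA space_restrict_space space_N)
  have mass_HA: "emeasure HA (space HA) = codim_hausdorff \<mu> \<theta> A"
    unfolding space_HA unfolding HA using AN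
    by (subst emeasure_restrict_space) (auto simp: space_N N_def emeasure_caratheodory_measure[OF outer])
  have fin: "finite_measure HA"
    by (rule finite_measureI) (use mass_HA assms(10) in auto)
  interpret HA: finite_measure HA by (rule fin)
  have sf: "sigma_finite_measure HA" ..
  have id: "(\<lambda>x. x) \<in> HA \<rightarrow>\<^sub>M borel"
    unfolding HA using borel_subset_codim_hausdorff[of \<mu> \<theta>]
    by (intro measurable_restrict_space1) (auto simp: measurable_def space_N N_def[symmetric])
  obtain D where D: "doubling_space M D"
    using doubling_space_caratheodory[OF assms(4)] assms(5) by (auto simp: admissible_def M_def)
  interpret doubling_space M D by (rule D)
  obtain C where C: "0 \<le> C" and upper: "\<And>t y. 0 < t \<Longrightarrow> 2 * t \<le> 1 \<Longrightarrow>
      emeasure HA {x \<in> space HA. dist x y < t} \<le> ennreal (C * t powr (- \<theta>) * measure M (ball y t))"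
    using emeasure_codim_hausdorff_on_ball_le[OF assms(4) D[unfolded M_def] assms(6,2,7,8)]
    unfolding HA_def M_def by blast

  define V where "V = Lp_space p HE"
  define besov where "besov = besov_norm (\<theta> / p) p M"
  have lin: "bounded_linear_ae HE V (Lp_norm p HE) M (besov_space (\<theta> / p) p M) besov T"
    and trace: "\<forall>\<phi>\<in>V. is_trace \<mu> \<theta> E (T \<phi>) \<phi>"
    using T by (simp_all add: bounded_linear_extension_def Let_def V_def HE_def M_def besov_def)
  have T_V: "T \<phi> \<in> besov_space (\<theta> / p) p M" if "\<phi> \<in> V" for \<phi>
    using lin that unfolding bounded_linear_ae_def by blast
  have T_add: "AE x in M. T (\<lambda>z. \<phi> z + \<psi> z) x = T \<phi> x + T \<psi> x" if "\<phi> \<in> V" "\<psi> \<in> V" for \<phi> \<psi>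
    using lin that unfolding bounded_linear_ae_def by blast
  have T_scale: "AE x in M. T (\<lambda>z. a * \<phi> z) x = a * T \<phi> x" if "\<phi> \<in> V" for \<phi> a
    using lin that unfolding bounded_linear_ae_def by blast
  have "\<exists>C. \<forall>\<phi>\<in>V. besov (T \<phi>) \<le> ennreal C * Lp_norm p HE \<phi>"
    using lin unfolding bounded_linear_ae_def by blast
  then obtain C' where C': "\<And>\<phi>. \<phi> \<in> V \<Longrightarrow> besov (T \<phi>) \<le> ennreal C' * Lp_norm p HE \<phi>" by blast
  \<comment> \<open>A positive bound for the operator norm, by which it is possible to divide.\<close>
  define b where "b = max C' 0 + 1"
  have b: "0 < b" "ennreal C' \<le> ennreal b" by (auto simp: b_def simp del: ennreal_plus intro!: ennreal_leI add_nonneg_pos)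
  have T_bound: "besov (T \<phi>) \<le> ennreal b * Lp_norm p HE \<phi>" if "\<phi> \<in> V" for \<phi>
    using C'[OF that] mult_right_mono[OF b(2)] by (rule order_trans) simp
  have T_trace: "is_trace \<mu> \<theta> E (T \<phi>) \<phi>" if "\<phi> \<in> V" for \<phi>
    using trace that by blast
  have T_loc: "T \<phi> \<in> L1_loc M" if "\<phi> \<in> V" for \<phi>
    using T_trace[OF that] by (simp add: is_trace_def M_def)
  have V_add: "(\<lambda>x. \<phi> x + \<psi> x) \<in> V" if "\<phi> \<in> V" "\<psi> \<in> V" for \<phi> \<psi>
    using that p unfolding V_def by (intro Lp_space_add)
  have V_scale: "(\<lambda>x. a * \<phi> x) \<in> V" if "\<phi> \<in> V" for \<phi> a
    using that p unfolding V_def by (intro Lp_space_scale)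

  obtain r :: "nat \<Rightarrow> 'a \<Rightarrow> real"
    where r_meas: "\<And>n. r n \<in> borel_measurable HA" and r_abs: "\<And>n x. \<bar>r n x\<bar> = 1"
    and r_orth: "\<And>m n. m \<noteq> n \<Longrightarrow> (\<integral>x. r m x * r n x \<partial>HA) = 0"
    using nonatomic_orthogonal_signs[OF fin assms(11)[folded HA_def]] by metis
  \<comment> \<open>The signs live on \<open>A\<close>; extended by zero they are elements of \<open>L\<^sub>p(E)\<close>.\<close>
  define \<rho> where "\<rho> n x = indicator A x * r n x" for n x
  have sum_\<rho>: "(\<lambda>x. \<Sum>i\<in>S. e i * \<rho> i x) = (\<lambda>x. indicator A x * (\<Sum>i\<in>S. e i * r i x))" for S :: "nat set" and e
    by (auto simp: \<rho>_def sum_distrib_left mult_ac)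
  have small: "\<exists>K. \<forall>S e. finite S \<longrightarrow> K \<le> card S \<longrightarrow> (\<forall>i\<in>S. \<bar>e i\<bar> = 1) \<longrightarrow>
      Lp_norm p HE (\<lambda>x. \<Sum>i\<in>S. e i * \<rho> i x) \<le> ennreal (\<epsilon> * real (card S))" if "0 < \<epsilon>" for \<epsilon>
    using Lp_norm_random_sum_small[OF fin p r_meas r_abs r_orth that]
    unfolding sum_\<rho> HE Lp_norm_restrict_space_indicator[OF AN EN assms(7)] HA .
  have \<rho>_V: "\<rho> n \<in> V" for n
  proof -
    have "(\<lambda>x. indicator E x *\<^sub>R \<rho> n x) = (\<lambda>x. indicator A x *\<^sub>R r n x)"
      using assms(7) by (intro ext) (auto simp: \<rho>_def split: split_indicator)
    then have "\<rho> n \<in> borel_measurable HE"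
      using r_meas[of n] AN EN unfolding HE HA
      by (simp add: borel_measurable_restrict_space_iff space_N)
    moreover have "Lp_norm p HE (\<rho> n) < \<infinity>"
    proof -
      have "Lp_norm p HE (\<rho> n) = Lp_norm p HA (r n)"
        unfolding \<rho>_def HE HA by (rule Lp_norm_restrict_space_indicator[OF AN EN assms(7)])
      also have "\<dots> < \<infinity>"
        using assms(10) mass_HA by (simp add: Lp_norm_def ennreal_powr_def r_abs less_top)
      finally show ?thesis .
    qed
    ultimately show ?thesis by (simp add: V_def Lp_space_def)
  qed
  have sum_V: "(\<lambda>x. \<Sum>i\<in>S. e i * \<rho> i x) \<in> V"
    and T_sum: "AE x in M. T (\<lambda>x. \<Sum>i\<in>S. e i * \<rho> i x) x = (\<Sum>i\<in>S. e i * T (\<rho> i) x)" if "finite S" for S e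
  proof -
    have "(\<lambda>x. \<Sum>i\<in>S. e i * \<rho> i x) \<in> V \<and>
        (AE x in M. T (\<lambda>x. \<Sum>i\<in>S. e i * \<rho> i x) x = (\<Sum>i\<in>S. e i * T (\<rho> i) x))"
      using that
    proof (induction S rule: finite_induct)
      case empty
      show ?case using V_scale[OF \<rho>_V, of 0] T_scale[OF \<rho>_V, of 0] by simp
    next
      case (insert i S)
      have "AE x in M. T (\<lambda>x. e i * \<rho> i x + (\<Sum>i\<in>S. e i * \<rho> i x)) x = e i * T (\<rho> i) x + (\<Sum>i\<in>S. e i * T (\<rho> i) x)"
        using T_add[OF V_scale[OF \<rho>_V, of "e i" i] conjunct1[OF insert.IH]] T_scale[OF \<rho>_V, of "e i" i] conjunct2[OF insert.IH]
        by eventually_elim simp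
      then show ?case
        using insert V_add[OF V_scale[OF \<rho>_V, of "e i" i] conjunct1[OF insert.IH]] by simp
    qed
    then show "(\<lambda>x. \<Sum>i\<in>S. e i * \<rho> i x) \<in> V"
      "AE x in M. T (\<lambda>x. \<Sum>i\<in>S. e i * \<rho> i x) x = (\<Sum>i\<in>S. e i * T (\<rho> i) x)" by auto
  qed
  have T_small: "\<exists>K. \<forall>S e. finite S \<longrightarrow> K \<le> card S \<longrightarrow> (\<forall>i\<in>S. \<bar>e i\<bar> = 1) \<longrightarrow>
      besov (T (\<lambda>x. \<Sum>i\<in>S. e i * \<rho> i x)) \<le> ennreal (\<epsilon> * real (card S))" if \<epsilon>: "0 < \<epsilon>" for \<epsilon>
  proof -
    obtain K where K: "\<forall>S e. finite S \<longrightarrow> K \<le> card S \<longrightarrow> (\<forall>i\<in>S. \<bar>e i\<bar> = 1) \<longrightarrow>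
      Lp_norm p HE (\<lambda>x. \<Sum>i\<in>S. e i * \<rho> i x) \<le> ennreal (\<epsilon> / b * real (card S))"
      using small[of "\<epsilon> / b"] \<epsilon> b by auto
    show ?thesis
    proof (intro exI[of _ K] allI impI)
      fix S :: "nat set" and e assume S: "finite S" "K \<le> card S" "\<forall>i\<in>S. \<bar>e i\<bar> = (1::real)"
      have "besov (T (\<lambda>x. \<Sum>i\<in>S. e i * \<rho> i x)) \<le> ennreal b * Lp_norm p HE (\<lambda>x. \<Sum>i\<in>S. e i * \<rho> i x)"
        by (intro T_bound sum_V S)
      also have "\<dots> \<le> ennreal b * ennreal (\<epsilon> / b * real (card S))"
        using K S by (intro mult_left_mono) auto
      also have "\<dots> = ennreal (\<epsilon> * real (card S))" using b \<epsilon> by (simp add: ennreal_mult[symmetric])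
      finally show "besov (T (\<lambda>x. \<Sum>i\<in>S. e i * \<rho> i x)) \<le> ennreal (\<epsilon> * real (card S))" .
    qed
  qed

  \<comment> \<open>The averages over a fixed ball are values of a bounded functional, hence tend to zero.\<close>
  have null: "(\<lambda>n. average M (ball x t) (T (\<rho> n))) \<longlonglongrightarrow> 0" if t: "0 < t" for x t
  proof (rule functional_null_of_small_sums)
    fix \<epsilon> :: real assume \<epsilon>: "0 < \<epsilon>"
    define m where "m = 1 + 1 / measure M (ball x t)"
    have m: "0 < m" using measure_ball_pos[OF t, of x] by (simp add: m_def add_pos_pos)
    obtain K where K: "\<forall>S e. finite S \<longrightarrow> K \<le> card S \<longrightarrow> (\<forall>i\<in>S. \<bar>e i\<bar> = 1) \<longrightarrow>
        besov (T (\<lambda>x. \<Sum>i\<in>S. e i * \<rho> i x)) \<le> ennreal (\<epsilon> / m * real (card S))"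
      using T_small[of "\<epsilon> / m"] \<epsilon> m by auto
    show "\<exists>N. \<forall>S e. finite S \<longrightarrow> N \<le> card S \<longrightarrow> (\<forall>i\<in>S. \<bar>e i\<bar> = 1) \<longrightarrow>
        (\<Sum>i\<in>S. e i * average M (ball x t) (T (\<rho> i))) \<le> \<epsilon> * real (card S)"
    proof (intro exI[of _ "Suc K"] allI impI)
      fix S :: "nat set" and e assume S: "finite S" "Suc K \<le> card S" "\<forall>i\<in>S. \<bar>e i\<bar> = (1::real)"
      let ?f = "T (\<lambda>x. \<Sum>i\<in>S. e i * \<rho> i x)"
      have loc: "(\<lambda>y. \<Sum>i\<in>S. e i * T (\<rho> i) y) \<in> L1_loc M \<and>
          average M (ball x t) (\<lambda>y. \<Sum>i\<in>S. e i * T (\<rho> i) y) = (\<Sum>i\<in>S. e i * average M (ball x t) (T (\<rho> i)))"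
        using S(1)
      proof (induction S rule: finite_induct)
        case empty
        show ?case using L1_loc_scale[OF T_loc[OF \<rho>_V], of 0] by (simp add: average_def)
      next
        case (insert i S)
        have scaled: "(\<lambda>y. e i * T (\<rho> i) y) \<in> L1_loc M"
          by (rule L1_loc_scale[OF T_loc[OF \<rho>_V]])
        show ?case
          using insert.hyps insert.IH L1_loc_add[OF scaled conjunct1[OF insert.IH]]
            average_add[OF scaled conjunct1[OF insert.IH] t, of x]
          by (simp add: average_scale)
      qed
      have "average M (ball x t) ?f = average M (ball x t) (\<lambda>y. \<Sum>i\<in>S. e i * T (\<rho> i) y)"
        by (intro average_cong_AE L1_locD(1) T_loc sum_V T_sum S conjunct1[OF loc] ball_sets)
      then have eq: "(\<Sum>i\<in>S. e i * average M (ball x t) (T (\<rho> i))) = average M (ball x t) ?f"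
        using loc by simp
      have "Lp_norm p M ?f \<le> besov ?f" by (simp add: besov_def besov_norm_def add_increasing2)
      also have "\<dots> \<le> ennreal (\<epsilon> / m * real (card S))" using K S by auto
      finally have norm: "Lp_norm p M ?f \<le> ennreal (\<epsilon> / m * real (card S))" .
      have "0 < \<epsilon> / m * real (card S)" using S(2) \<epsilon> m by simp
      then have "average M (ball x t) ?f \<le> \<epsilon> / m * real (card S) * m"
        unfolding m_def[symmetric] using average_le_of_Lp_norm[OF p T_loc[OF sum_V[OF S(1)]] _ norm t, of x]
        by (simp add: m_def[symmetric])
      then show "(\<Sum>i\<in>S. e i * average M (ball x t) (T (\<rho> i))) \<le> \<epsilon> * real (card S)"
        using m by (simp add: eq)
    qed
  qed

  \<comment> \<open>The Besov mass of the extension at scale \<open>j\<close>, a seminorm on \<open>L\<^sub>p(E)\<close>.\<close>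
  define q where "q j \<phi> = enn2real (dyadic_besov (\<theta> / p) p j (T \<phi>))" for j \<phi>
  define d where "d = 2 * D * 2 powr (\<theta> / p + 1)"
  have d: "0 < d" using D_ge_1 by (simp add: d_def)
  have sum_le: "(\<Sum>j<K. dyadic_besov (\<theta> / p) p j (T \<phi>)) \<le> ennreal d * besov (T \<phi>)" if "\<phi> \<in> V" for \<phi> K
    unfolding d_def besov_def by (rule sum_dyadic_besov_le[OF p s T_loc[OF that]])
  have q_fin: "dyadic_besov (\<theta> / p) p j (T \<phi>) = ennreal (q j \<phi>)" if "\<phi> \<in> V" for j \<phi>
  proof -
    have "dyadic_besov (\<theta> / p) p j (T \<phi>) \<le> (\<Sum>j<Suc j. dyadic_besov (\<theta> / p) p j (T \<phi>))" by simp
    also have "\<dots> \<le> ennreal d * besov (T \<phi>)" by (rule sum_le[OF that])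
    also have "\<dots> < \<infinity>"
      using T_V[OF that] by (simp add: besov_space_def besov_def ennreal_mult_less_top)
    finally show ?thesis by (simp add: q_def)
  qed
  have q_nonneg: "0 \<le> q j \<phi>" for j \<phi> by (simp add: q_def)
  have q_sum: "(\<Sum>j\<in>J. dyadic_besov (\<theta> / p) p j (T \<phi>)) = ennreal (\<Sum>j\<in>J. q j \<phi>)" if "\<phi> \<in> V" for \<phi> J
    using that by (simp add: q_fin sum_ennreal q_nonneg)

  define B where "B = D * (C * D * (2 * D\<^sup>2) powr p) powr (1 / p) * 2 powr (\<theta> / p)"
  have B: "0 \<le> B" using D_ge_1 by (simp add: B_def)
  define a where "a = measure HA (space HA)"
  have mass_a: "emeasure HA (space HA) = ennreal a" by (simp add: a_def HA.emeasure_eq_measure)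
  then have "0 < ennreal a" using mass_HA assms(9) by simp
  then have a: "0 < a" "emeasure HA (space HA) = ennreal a" using mass_a by simp_all
  \<comment> \<open>Chosen such that mass at most \<open>c\<close> beyond scale \<open>k\<close> forces an integral of at most half of \<open>\<H>\<^sub>\<theta>(A)\<close>.\<close>
  define c where "c = (a / 2) powr (1 / p) / (B + 1)"
  have c: "0 < c" using a B by (simp add: c_def)
  have Bc: "(B * c) powr p \<le> a / 2"
  proof -
    have "B * c \<le> (a / 2) powr (1 / p)" using B a by (simp add: c_def field_simps)
    then have "(B * c) powr p \<le> ((a / 2) powr (1 / p)) powr p" using B c p by (intro powr_mono2) auto
    then show ?thesis using p a by (simp add: powr_powr)
  qed
  \<comment> \<open>Since \<open>\<bar>r n\<bar> = 1\<close> and the averages \<open>g n\<close> tend to zero pointwise, the integrals of \<open>\<bar>r n - g n\<bar>\<^sup>p\<close> eventually exceed \<open>a / 2\<close>.\<close>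
  have escape: "\<exists>n0. \<forall>n\<ge>n0. \<exists>K. c \<le> (\<Sum>j=k..<K. q j (\<rho> n))" for k
  proof -
    define g where "g n x = average M (ball x (dyadic (Suc k))) (T (\<rho> n))" for n x
    have [measurable]: "g n \<in> borel_measurable HA" for n
      using measurable_comp[OF id measurable_ball_average[OF L1_locD(1)[OF T_loc[OF \<rho>_V[of n]]], of "dyadic (Suc k)"]]
      by (simp add: g_def[abs_def] comp_def)
    note r_meas[measurable]
    have "ennreal a = (\<integral>\<^sup>+x. liminf (\<lambda>n. ennreal (\<bar>r n x - g n x\<bar> powr p)) \<partial>HA)"
    proof -
      have "liminf (\<lambda>n. ennreal (\<bar>r n x - g n x\<bar> powr p)) = 1" for x
      proof -
        have g0: "(\<lambda>n. \<bar>g n x\<bar>) \<longlonglongrightarrow> 0"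
          unfolding g_def using null[OF dyadic_bounds(1), of x "Suc k"] by (rule tendsto_rabs_zero)
        have "(\<lambda>n. \<bar>r n x - g n x\<bar> - 1) \<longlonglongrightarrow> 0"
        proof (rule Lim_null_comparison[OF always_eventually g0], rule allI)
          fix n show "norm (\<bar>r n x - g n x\<bar> - 1) \<le> \<bar>g n x\<bar>"
            using r_abs[of n x] by (auto simp: abs_if split: if_splits)
        qed
        then have "(\<lambda>n. \<bar>r n x - g n x\<bar>) \<longlonglongrightarrow> 1" by (rule Lim_null[THEN iffD2])
        then have "(\<lambda>n. \<bar>r n x - g n x\<bar> powr p) \<longlonglongrightarrow> 1 powr p"
          using p by (intro tendsto_powr tendsto_const) auto
        then have "(\<lambda>n. ennreal (\<bar>r n x - g n x\<bar> powr p)) \<longlonglongrightarrow> ennreal 1"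
          by (intro tendsto_ennrealI) simp
        then show ?thesis using lim_imp_Liminf[OF sequentially_bot] by force
      qed
      then show ?thesis using a by simp
    qed
    also have "\<dots> \<le> liminf (\<lambda>n. \<integral>\<^sup>+x. ennreal (\<bar>r n x - g n x\<bar> powr p) \<partial>HA)"
      by (rule nn_integral_liminf) measurable
    finally have "ennreal (a / 2) < liminf (\<lambda>n. \<integral>\<^sup>+x. ennreal (\<bar>r n x - g n x\<bar> powr p) \<partial>HA)"
      using a by (elim less_le_trans[rotated]) (simp add: ennreal_less_iff)
    then have "\<forall>\<^sub>F n in sequentially. ennreal (a / 2) < (\<integral>\<^sup>+x. ennreal (\<bar>r n x - g n x\<bar> powr p) \<partial>HA)"
      by (rule less_LiminfD)
    then obtain n0 where n0: "\<And>n. n \<ge> n0 \<Longrightarrow> ennreal (a / 2) < (\<integral>\<^sup>+x. ennreal (\<bar>r n x - g n x\<bar> powr p) \<partial>HA)"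
      by (auto simp: eventually_sequentially)
    show ?thesis
    proof (rule exI[of _ n0], intro allI impI, rule ccontr)
      fix n assume n: "n0 \<le> n" and "\<nexists>K. c \<le> (\<Sum>j=k..<K. q j (\<rho> n))"
      then have less: "(\<Sum>j=k..<K. q j (\<rho> n)) \<le> c" for K by (meson linorder_le_cases)
      have "AE x in HE. ((\<lambda>r. average M (ball x r) (\<lambda>y. \<bar>T (\<rho> n) y - \<rho> n x\<bar>)) \<longlongrightarrow> 0) (at_right 0)"
        using T_trace[OF \<rho>_V[of n]] unfolding is_trace_def M_def HE_def by blast
      then have "AE x in HE. (\<lambda>m. average M (ball x (dyadic m)) (T (\<rho> n))) \<longlonglongrightarrow> \<rho> n x"
        by (rule eventually_mono) (rule average_tendsto_of_trace[OF D T_loc[OF \<rho>_V]])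
      then have tr: "AE x in HA. (\<lambda>m. average M (ball x (dyadic m)) (T (\<rho> n))) \<longlonglongrightarrow> r n x"
        unfolding HE HA using AN EN assms(7)
        by (subst (asm) AE_restrict_space_iff, simp add: space_N, subst AE_restrict_space_iff, simp add: space_N)
           (auto simp: \<rho>_def elim!: eventually_mono)
      have "Lp_norm p HA (\<lambda>x. r n x - average M (ball x (dyadic (Suc k))) (T (\<rho> n))) \<le> ennreal (B * c)"
        unfolding B_def
      proof (rule Lp_norm_trace_minus_average_le[OF sf id p T_loc[OF \<rho>_V] C upper tr])
        show "0 \<le> c" using c by simp
        show "(\<Sum>j=k..<m. dyadic_besov (\<theta> / p) p j (T (\<rho> n))) \<le> ennreal c" for m
          unfolding q_sum[OF \<rho>_V] by (rule ennreal_leI) (rule less)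
      qed
      then have "(\<integral>\<^sup>+x. ennreal (\<bar>r n x - g n x\<bar> powr p) \<partial>HA) \<le> ennreal ((B * c) powr p)"
        unfolding g_def using B c by (subst (asm) Lp_norm_le_iff[OF p]) auto
      also have "\<dots> \<le> ennreal (a / 2)" by (rule ennreal_leI[OF Bc])
      finally show False using n0[OF n] by simp
    qed
  qed

  show False
  proof (rule no_escaping_seminorm_mass[where V = V and q = q and r = \<rho> and c = c])
    show "(\<lambda>x. f x + g x) \<in> V" if "f \<in> V" "g \<in> V" for f g by (rule V_add[OF that])
    show "(\<lambda>x. a * f x) \<in> V" if "f \<in> V" for a f by (rule V_scale[OF that])
    show "q j (\<lambda>x. f x + g x) \<le> q j f + q j g" if fg: "f \<in> V" "g \<in> V" for j f g
    proof -
      have "ennreal (q j (\<lambda>x. f x + g x)) = dyadic_besov (\<theta> / p) p j (\<lambda>x. T f x + T g x)"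
        unfolding q_fin[OF V_add[OF fg], symmetric]
        by (intro dyadic_besov_cong_AE T_loc V_add L1_loc_add T_add fg)
      also have "\<dots> \<le> ennreal (q j f + q j g)"
        using dyadic_besov_add[OF p T_loc[OF fg(1)] T_loc[OF fg(2)], of "\<theta> / p" j]
        by (simp add: q_fin fg q_nonneg)
      finally show ?thesis by (simp add: q_nonneg del: ennreal_plus)
    qed
    show "q j (\<lambda>x. a * f x) = \<bar>a\<bar> * q j f" if f: "f \<in> V" for j a f
    proof -
      have "ennreal (q j (\<lambda>x. a * f x)) = dyadic_besov (\<theta> / p) p j (\<lambda>x. a * T f x)"
        unfolding q_fin[OF V_scale[OF f], symmetric]
        by (intro dyadic_besov_cong_AE T_loc V_scale L1_loc_scale T_scale f)
      also have "\<dots> = ennreal (\<bar>a\<bar> * q j f)"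
        using dyadic_besov_scale[OF p T_loc[OF f], of "\<theta> / p" j a]
        by (simp add: q_fin f q_nonneg ennreal_mult)
      finally show ?thesis by (simp add: q_nonneg)
    qed
    show "\<rho> n \<in> V" for n by (rule \<rho>_V)
    show "\<exists>N. \<forall>S e K. finite S \<longrightarrow> N \<le> card S \<longrightarrow> (\<forall>i\<in>S. \<bar>e i\<bar> = 1) \<longrightarrow>
        (\<Sum>j<K. q j (\<lambda>x. \<Sum>i\<in>S. e i * \<rho> i x)) \<le> \<epsilon> * real (card S)" if \<epsilon>: "0 < \<epsilon>" for \<epsilon>
    proof -
      obtain N' where N': "\<forall>S e. finite S \<longrightarrow> N' \<le> card S \<longrightarrow> (\<forall>i\<in>S. \<bar>e i\<bar> = 1) \<longrightarrow>
          besov (T (\<lambda>x. \<Sum>i\<in>S. e i * \<rho> i x)) \<le> ennreal (\<epsilon> / d * real (card S))"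
        using T_small[of "\<epsilon> / d"] \<epsilon> d by auto
      show ?thesis
      proof (intro exI[of _ N'] allI impI)
        fix S :: "nat set" and e K assume S: "finite S" "N' \<le> card S" "\<forall>i\<in>S. \<bar>e i\<bar> = (1::real)"
        let ?\<phi> = "\<lambda>x. \<Sum>i\<in>S. e i * \<rho> i x"
        have "ennreal (\<Sum>j<K. q j ?\<phi>) \<le> ennreal d * besov (T ?\<phi>)"
          unfolding q_sum[OF sum_V[OF S(1)], symmetric] by (rule sum_le[OF sum_V[OF S(1)]])
        also have "\<dots> \<le> ennreal d * ennreal (\<epsilon> / d * real (card S))"
          using N' S by (intro mult_left_mono) auto
        also have "\<dots> = ennreal (\<epsilon> * real (card S))" using d \<epsilon> by (simp add: ennreal_mult[symmetric])
        finally show "(\<Sum>j<K. q j ?\<phi>) \<le> \<epsilon> * real (card S)"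
          using \<epsilon> by (subst (asm) ennreal_le_iff) auto
      qed
    qed
    show "0 < c" by (rule c)
    show "\<exists>n0. \<forall>n\<ge>n0. \<exists>K. c \<le> (\<Sum>j=k..<K. q j (\<rho> n))" for k by (rule escape)
  qed
qed

end
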